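(* Let $$F(z)=e^z\,\frac{\prod_{i=1}^k(1+\alpha_iz)}{\prod_{i=1}^l(1-\beta_iz)},$$ where $k,l$ are natural numbers (possibly zero) and $\alpha_i,\beta_i\ge0$. Let $[a,b]$, $a<b$, be a fixed compact interval with $[a,b]\subset(r_{\mathrm z},r_{\mathrm p})$, where $r_{\mathrm z}$ and $r_{\mathrm p}$ are, respectively, the largest zero and the smallest pole of $F$ ($r_{\mathrm z}=-\infty$ if $F$ has no zeros, $r_{\mathrm p}=\infty$ if $F$ has no poles). For each $n\ge1$ let $\nu_n$ be a finite Borel measure with $\operatorname{supp}\nu_n\subseteq[a,b]$ and $\#\operatorname{supp}\nu_n\ge n$, let $T_n=\{a\le t_1<\cdots<t_n\le b\}$ (the points may depend on $n$), and let $R_n=Q_n/P_n$ be the AAA approximant of $F$ corresponding to $(\nu_n,T_n)$. Then $R_n$ is irreducible for all sufficiently large $n$ (that is, $P_n$ and $Q_n$ have no common zeros). Moreover, $$\lim_{n\to\infty}R_n(z)=F(z)$$ locally uniformly in $\mathbb{C}\setminus\{1/\beta_i: 1\le i\le l,\ \beta_i>0\}$. Furthermore, if $F(z)=e^z$, then for every compact set $K\subset\mathbb{C}$ there exist constants $0<c_K<C_K<\infty$ such that $$c_K|V_n(z)|\le\frac{(2n-2)!\,(2n-1)!}{(n-1)!\,(n-1)!}\,|e^z-R_n(z)|\le C_K|V_n(z)|$$ for all sufficiently large $n$ and all $z\in K$, where $V_n(z)=\prod_{k=1}^n(z-t_k)\prod_{k=1}^{n-1}(z-t_k')$ and $a<t_1'<\cdots<t_{n-1}'<b$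 are points such that $(P_nF-Q_n)/V_n$ extends analytically to a domain containing $[a,b]$.
   Context: Loewner kernel: $K_F(x,y):=\frac{F(x)-F(y)}{x-y}$ on $[a,b]\times[a,b]$, with $K_F(x,x)=F'(x)$. AAA approximant of $F$ corresponding to $(\nu_n,T_n)$: the rational function $R_n=Q_n/P_n$, where $$P_n(z)=\sum_{k=1}^nb_kL_k(z),\quad Q_n(z)=\sum_{k=1}^nb_kF(t_k)L_k(z),\quad L_k(z)=\prod_{i\ne k}(z-t_i),$$ and the real weights $b_k$ satisfy $b_1^2+\cdots+b_n^2=1$, the non-zero $b_k$ with the smallest index is positive, and $$\int\Big(\sum_{k=1}^nb_kK_F(x,t_k)\Big)^2d\nu_n(x)=\min_{c_1^2+\cdots+c_n^2=1}\int\Big(\sum_{k=1}^nc_kK_F(x,t_k)\Big)^2d\nu_n(x).$$ It is a separate result that, for each $n$, points $t_1',\dots,t_{n-1}'$ with the property stated in the claim exist. *)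

theory Defs
  imports "HOL-Analysis.Analysis" "HOL-Complex_Analysis.Complex_Analysis"
begin

text \<open>Polymorphic, so that it can be read both as a function on the complex plane and, by
  restriction, as a function on the real line. At a pole it takes the value 0, as x / 0 = 0.\<close>

definition edrei_fun ::
  "nat \<Rightarrow> nat \<Rightarrow> (nat \<Rightarrow> real) \<Rightarrow> (nat \<Rightarrow> real) \<Rightarrow> 'a \<Rightarrow> 'a::{real_normed_field,banach}" where
  "edrei_fun k l \<alpha> \<beta> z =
     exp z * ((\<Prod>i=1..k. 1 + of_real (\<alpha> i) * z) / (\<Prod>i=1..l. 1 - of_real (\<beta> i) * z))"

text \<open>Supremum and infimum in the extended reals yield -\<infinity> (no zeros) and \<infinity>
  (no poles). Poles have to be excluded from the zeros because of x / 0 = 0.\<close>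

definition largest_real_zero :: "(complex \<Rightarrow> complex) \<Rightarrow> ereal" where
  "largest_real_zero f =
     Sup {ereal x | x. \<not> is_pole f (of_real x) \<and> f (of_real x) = 0}"

definition smallest_real_pole :: "(complex \<Rightarrow> complex) \<Rightarrow> ereal" where
  "smallest_real_pole f = Inf {ereal x | x. is_pole f (of_real x)}"

definition measure_support :: "'a::topological_space measure \<Rightarrow> 'a set" where
  "measure_support M = {x. \<forall>U. open U \<longrightarrow> x \<in> U \<longrightarrow> emeasure M U > 0}"

definition loewner_kernel :: "(real \<Rightarrow> real) \<Rightarrow> real \<Rightarrow> real \<Rightarrow> real" where
  "loewner_kernel f x y = (if x = y then deriv f x else (f x - f y) / (x - y))"

definition aaa_error ::
  "(real \<Rightarrow> real) \<Rightarrow> real measure \<Rightarrow> nat \<Rightarrow> (nat \<Rightarrow> real) \<Rightarrow> (nat \<Rightarrow> real) \<Rightarrow> real" where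
  "aaa_error f \<nu> n t c = (\<integral>x. (\<Sum>k=1..n. c k * loewner_kernel f x (t k))\<^sup>2 \<partial>\<nu>)"

definition aaa_weights ::
  "(real \<Rightarrow> real) \<Rightarrow> real measure \<Rightarrow> nat \<Rightarrow> (nat \<Rightarrow> real) \<Rightarrow> (nat \<Rightarrow> real) \<Rightarrow> bool" where
  "aaa_weights f \<nu> n t b \<longleftrightarrow>
     is_arg_min (aaa_error f \<nu> n t) (\<lambda>c. (\<Sum>k=1..n. (c k)\<^sup>2) = 1) b \<and>
     (\<forall>k\<in>{1..n}. b k \<noteq> 0 \<and> (\<forall>i\<in>{1..<k}. b i = 0) \<longrightarrow> b k > 0)"

definition node_basis :: "nat \<Rightarrow> (nat \<Rightarrow> real) \<Rightarrow> nat \<Rightarrow> complex poly" where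
  "node_basis n t k = (\<Prod>i\<in>{1..n} - {k}. [:- of_real (t i), 1:])"

definition aaa_denom :: "nat \<Rightarrow> (nat \<Rightarrow> real) \<Rightarrow> (nat \<Rightarrow> real) \<Rightarrow> complex poly" where
  "aaa_denom n t b = (\<Sum>k=1..n. smult (of_real (b k)) (node_basis n t k))"

definition aaa_numer ::
  "(real \<Rightarrow> real) \<Rightarrow> nat \<Rightarrow> (nat \<Rightarrow> real) \<Rightarrow> (nat \<Rightarrow> real) \<Rightarrow> complex poly" where
  "aaa_numer f n t b = (\<Sum>k=1..n. smult (of_real (b k * f (t k))) (node_basis n t k))"

definition aaa_approx ::
  "(real \<Rightarrow> real) \<Rightarrow> nat \<Rightarrow> (nat \<Rightarrow> real) \<Rightarrow> (nat \<Rightarrow> real) \<Rightarrow> complex \<Rightarrow> complex" where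
  "aaa_approx f n t b z = poly (aaa_numer f n t b) z / poly (aaa_denom n t b) z"

definition nodal_fun :: "nat \<Rightarrow> (nat \<Rightarrow> real) \<Rightarrow> (nat \<Rightarrow> real) \<Rightarrow> complex \<Rightarrow> complex" where
  "nodal_fun n t t' z = (\<Prod>k=1..n. z - of_real (t k)) * (\<Prod>k=1..n-1. z - of_real (t' k))"

text \<open>The points of t' may coincide with points of t; the zeros of the nodal function are
  then double, and the condition accounts for multiplicities.\<close>

definition extra_nodes ::
  "real \<Rightarrow> real \<Rightarrow> (complex \<Rightarrow> complex) \<Rightarrow> complex poly \<Rightarrow> complex poly \<Rightarrow>
     nat \<Rightarrow> (nat \<Rightarrow> real) \<Rightarrow> (nat \<Rightarrow> real) \<Rightarrow> bool" where
  "extra_nodes a b F P Q n t t' \<longleftrightarrow>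
     strict_mono_on {1..n-1} t' \<and> t' ` {1..n-1} \<subseteq> {a<..<b} \<and>
     (\<exists>D g. open D \<and> connected D \<and> of_real ` {a..b} \<subseteq> D \<and> g holomorphic_on D \<and>
        (\<forall>z\<in>D. nodal_fun n t t' z \<noteq> 0 \<longrightarrow>
           g z = (poly P z * F z - poly Q z) / nodal_fun n t t' z))"

end

theory Submission imports Defs begin

text \<open>The linearised error of \<open>R\<^sub>n\<close> is \<open>P A exp - Q B\<close>, where \<open>F = exp * A / B\<close>. Multiplication by
  \<open>1 + \<alpha> z\<close>, by \<open>1 / (1 - \<beta> z)\<close>, and hence by \<open>exp\<close>, acts on Newton coefficients at real nodes by
  matrices that do not increase the number of sign changes. It follows that a nontrivial pair \<open>(P, Q)\<close> of
  degrees at most \<open>dp, dq\<close> cannot have a linearised error with \<open>dp + dq + 2\<close> zeros in \<open>[a, b]\<close>.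

  The weights of the AAA approximant form a lowest eigenvector of a Gram matrix. By the uniqueness just
  described the inverse of this matrix has a checkerboard sign pattern, so by Perron-Frobenius the weights
  alternate in sign, and orthogonality then forces \<open>n - 1\<close> zeros of the linearised error in \<open>[a, b]\<close>
  besides the \<open>n\<close> support points. Thus \<open>R\<^sub>n\<close> is a multipoint Pade approximant with \<open>2 n - 1\<close> real nodes,
  and a common zero of \<open>P\<close> and \<open>Q\<close> would contradict uniqueness.

  For \<open>F = exp\<close> and \<open>N = deg Q + 1\<close> the polynomial \<open>(1 + D) ^ N P\<close> has all its zeros in \<open>[a, b]\<close> by Rolle's
  theorem. Inverting the operator gives \<open>2 P' + P = O(1/n)\<close> after normalisation, whence
  \<open>P \<sim> exp (- z / 2)\<close> and \<open>Q \<sim> exp (z / 2)\<close>. Linear factors of \<open>A\<close> and \<open>B\<close> are added one at a time by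
  combining two interpolants of neighbouring degrees. The error bounds come from telescoping
  along nested node sets, where consecutive interpolants differ by a multiple of the nodal polynomial.\<close>

subsection \<open>Entire functions vanishing at a list of nodes\<close>

text \<open>Nothing is known about the distribution of the nodes as n grows, so every estimate is
  uniform over all node lists in [a, b]; the AAA structure enters only through the existence of 2 n
  - 1 zeros. Lists carry multiplicities, because the additional zeros may coincide with each other
  or with support points. The zero count has to be sharp, yet the Newton coefficients of Q simply
  end at its degree and show no sign changes there. The way out is to divide the interpolation
  relation by a small part exp (\<epsilon> z) of the exponential, which turns the zeros beyond the
  degree of Q into alternating entries. In its extremal case the same count yields signs and not
  only uniqueness, and these signs make Perron-Frobenius applicable. Rolle's theorem determines P
  and Q only up to two unrelated factors; a single node ties these together. When a factor 1 +
  \<alpha> z is added, its zero supplies the one condition that selects the new interpolant from a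
  two-dimensional space.\<close>

definition nodal :: "real list \<Rightarrow> complex poly" where
  "nodal X = (\<Prod>x\<leftarrow>X. [:- of_real x, 1:])"

text \<open>Zeros are counted by an entire cofactor instead of derivatives: repeated nodes need no
  separate treatment, and adding or removing a node is multiplication or division by a linear
  factor.\<close>

definition vanishes :: "real list \<Rightarrow> (complex \<Rightarrow> complex) \<Rightarrow> bool" where
  "vanishes X h \<longleftrightarrow> (\<exists>g. g holomorphic_on UNIV \<and> (\<forall>z. h z = poly (nodal X) z * g z))"

lemma nodal_Nil [simp]: "nodal [] = 1"
  by (simp add: nodal_def)

lemma nodal_Cons: "nodal (x # X) = [:- of_real x, 1:] * nodal X"
  by (simp add: nodal_def)

lemma nodal_append: "nodal (X @ Y) = nodal X * nodal Y"
  by (simp add: nodal_def)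

lemma poly_nodal_Cons: "poly (nodal (x # X)) z = (z - of_real x) * poly (nodal X) z"
  by (simp add: nodal_Cons algebra_simps)

lemma poly_nodal: "poly (nodal X) z = (\<Prod>x\<leftarrow>X. z - of_real x)"
  by (induction X) (simp_all add: poly_nodal_Cons)

lemma nodal_mset_cong: "mset X = mset Y \<Longrightarrow> nodal X = nodal Y"
proof -
  have *: "nodal X = prod_mset (image_mset (\<lambda>x. [:- of_real x, 1:]) (mset X))" for X
    by (induction X) (simp_all add: nodal_Cons)
  show "mset X = mset Y \<Longrightarrow> nodal X = nodal Y" by (simp only: *)
qed

text \<open>Newton coefficients depend on the order of the nodes, vanishing does not. Reordering is
  used to put a prescribed node first or to collect the copies of one node.\<close>

lemma vanishes_mset_cong: "mset X = mset Y \<Longrightarrow> vanishes X h = vanishes Y h"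
  unfolding vanishes_def by (metis nodal_mset_cong)

lemma poly_nodal_eq_0_iff: "poly (nodal X) z = 0 \<longleftrightarrow> z \<in> of_real ` set X"
  by (induction X) (auto simp: poly_nodal_Cons)

lemma nodal_nonzero [simp]: "nodal X \<noteq> 0"
  by (induction X) (auto simp: nodal_Cons simp del: mult_pCons_left)

lemma degree_nodal [simp]: "degree (nodal X) = length X"
  by (induction X) (auto simp: nodal_Cons degree_mult_eq simp del: mult_pCons_left)

lemma lead_coeff_nodal [simp]: "coeff (nodal X) (length X) = 1"
proof (induction X)
  case (Cons x X)
  have "lead_coeff (nodal (x # X)) = lead_coeff [:- of_real x, 1 :: complex:] * lead_coeff (nodal X)"
    unfolding nodal_Cons by (rule lead_coeff_mult)
  with Cons show ?case
    by (simp add: degree_nodal)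
qed simp

lemma entire_imp_continuous: "f holomorphic_on UNIV \<Longrightarrow> continuous_on UNIV f"
  by (rule holomorphic_on_imp_continuous_on)

lemma continuous_cancel_linear:
  fixes f g :: "complex \<Rightarrow> complex"
  assumes "continuous_on UNIV f" "continuous_on UNIV g"
    and eq: "\<And>z. z \<noteq> x \<Longrightarrow> f z = g z"
  shows "f = g"
proof -
  have "f x = g x"
  proof (rule tendsto_unique)
    show "(f \<longlongrightarrow> f x) (at x)"
      using assms(1) by (simp add: continuous_on_eq_continuous_at isContD)
    have "(g \<longlongrightarrow> g x) (at x)"
      using assms(2) by (simp add: continuous_on_eq_continuous_at isContD)
    then show "(f \<longlongrightarrow> g x) (at x)"
      by (rule Lim_transform_eventually) (auto simp: eventually_at_filter eq)
  qed simp
  then show ?thesis by (intro ext) (metis eq)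
qed

lemma entire_cancel_linear:
  fixes f g :: "complex \<Rightarrow> complex"
  assumes "f holomorphic_on UNIV" "g holomorphic_on UNIV"
    and eq: "\<And>z. (z - x) * f z = (z - x) * g z"
  shows "f = g"
proof (rule continuous_cancel_linear[of f g x])
  show "f z = g z" if "z \<noteq> x" for z
    using eq[of z] that by simp
qed (use assms entire_imp_continuous in auto)

lemma entire_factor:
  assumes "f holomorphic_on UNIV" "f x = 0"
  obtains g where "g holomorphic_on UNIV" "\<And>z. f z = (z - x) * g z"
proof
  let ?g = "\<lambda>z. if z = x then deriv f x else (f z - f x) / (z - x)"
  show "?g holomorphic_on UNIV"
    by (rule pole_lemma) (use assms in auto)
  show "f z = (z - x) * ?g z" for z
    using assms(2) by auto
qed

lemma vanishes_Nil [simp]: "vanishes [] h \<longleftrightarrow> h holomorphic_on UNIV"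
proof
  assume "vanishes [] h"
  then obtain g where "g holomorphic_on UNIV" "\<And>z. h z = g z"
    by (auto simp: vanishes_def)
  moreover from this have "h = g" by blast
  ultimately show "h holomorphic_on UNIV" by simp
qed (auto simp: vanishes_def)

lemma vanishes_Cons:
  "vanishes (x # X) h \<longleftrightarrow> (\<exists>k. vanishes X k \<and> (\<forall>z. h z = (z - of_real x) * k z))"
proof
  assume "vanishes (x # X) h"
  then obtain g where g: "g holomorphic_on UNIV" "\<And>z. h z = poly (nodal (x # X)) z * g z"
    by (auto simp: vanishes_def)
  then have "vanishes X (\<lambda>z. poly (nodal X) z * g z)" unfolding vanishes_def by blast
  moreover have "\<forall>z. h z = (z - of_real x) * (poly (nodal X) z * g z)"
    using g by (simp add: poly_nodal_Cons mult.assoc)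
  ultimately show "\<exists>k. vanishes X k \<and> (\<forall>z. h z = (z - of_real x) * k z)" by blast
next
  assume "\<exists>k. vanishes X k \<and> (\<forall>z. h z = (z - of_real x) * k z)"
  then show "vanishes (x # X) h"
    unfolding vanishes_def poly_nodal_Cons by (metis mult.assoc)
qed

lemma vanishes_entire: "vanishes X h \<Longrightarrow> h holomorphic_on UNIV"
proof -
  assume "vanishes X h"
  then obtain g where g: "g holomorphic_on UNIV" "\<And>z. h z = poly (nodal X) z * g z"
    by (auto simp: vanishes_def)
  then have "h = (\<lambda>z. poly (nodal X) z * g z)" by auto
  with g show ?thesis by (auto intro!: holomorphic_intros)
qed

lemma vanishes_Cons_cancel:
  assumes "vanishes (x # X) (\<lambda>z. (z - of_real x) * k z)" "k holomorphic_on UNIV"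
  shows "vanishes X k"
proof -
  obtain k' where k': "vanishes X k'" "\<And>z. (z - of_real x) * k z = (z - of_real x) * k' z"
    using assms(1) by (auto simp: vanishes_Cons)
  have "k = k'"
    by (rule entire_cancel_linear[OF assms(2) vanishes_entire[OF k'(1)] k'(2)])
  with k' show ?thesis by simp
qed

lemma vanishes_Cons_at: "vanishes (x # X) h \<Longrightarrow> h (of_real x) = 0"
  by (auto simp: vanishes_Cons)

lemma vanishes_at: "vanishes X h \<Longrightarrow> x \<in> set X \<Longrightarrow> h (of_real x) = 0"
  by (auto simp: vanishes_def poly_nodal_eq_0_iff)

lemma vanishes_append_left:
  "vanishes (X @ Y) h \<Longrightarrow> vanishes X h"
  unfolding vanishes_def nodal_append
proof (elim exE conjE)
  fix g assume "g holomorphic_on UNIV" "\<forall>z. h z = poly (nodal X * nodal Y) z * g z"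
  then show "\<exists>g. g holomorphic_on UNIV \<and> (\<forall>z. h z = poly (nodal X) z * g z)"
    by (intro exI[of _ "\<lambda>z. poly (nodal Y) z * g z"]) (auto intro!: holomorphic_intros)
qed

lemma vanishes_mult:
  assumes "vanishes X h" "f holomorphic_on UNIV"
  shows "vanishes X (\<lambda>z. f z * h z)"
proof -
  obtain g where g: "g holomorphic_on UNIV" "\<And>z. h z = poly (nodal X) z * g z"
    using assms(1) by (auto simp: vanishes_def)
  show ?thesis unfolding vanishes_def
    by (rule exI[of _ "\<lambda>z. f z * g z"]) (auto intro!: holomorphic_intros g assms simp: g(2))
qed

lemma vanishes_add:
  assumes "vanishes X h" "vanishes X k"
  shows "vanishes X (\<lambda>z. h z + k z)"
proof -
  obtain g where g: "g holomorphic_on UNIV" "\<And>z. h z = poly (nodal X) z * g z"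
    using assms(1) by (auto simp: vanishes_def)
  obtain g' where g': "g' holomorphic_on UNIV" "\<And>z. k z = poly (nodal X) z * g' z"
    using assms(2) by (auto simp: vanishes_def)
  show ?thesis unfolding vanishes_def
    by (rule exI[of _ "\<lambda>z. g z + g' z"])
       (auto intro!: holomorphic_intros g g' simp: g(2) g'(2) algebra_simps)
qed

lemma vanishes_cmult: "vanishes X h \<Longrightarrow> vanishes X (\<lambda>z. c * h z)"
  using vanishes_mult[of X h "\<lambda>_. c"] by simp

lemma vanishes_diff: "vanishes X h \<Longrightarrow> vanishes X k \<Longrightarrow> vanishes X (\<lambda>z. h z - k z)"
  using vanishes_add[of X h "\<lambda>z. (-1) * k z"] vanishes_cmult[of X k "-1"] by simp

lemma vanishes_cong: "vanishes X h \<Longrightarrow> (\<And>z. h z = k z) \<Longrightarrow> vanishes X k"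
  by (simp add: vanishes_def)

lemma vanishes_times_nodal:
  "vanishes Y h \<Longrightarrow> vanishes (X @ Y) (\<lambda>z. poly (nodal X) z * h z)"
  unfolding vanishes_def nodal_append poly_mult by (metis mult.assoc)

lemma vanishes_distinct:
  assumes "h holomorphic_on UNIV" "distinct X" "\<And>x. x \<in> set X \<Longrightarrow> h (of_real x) = 0"
  shows "vanishes X h"
  using assms
proof (induction X arbitrary: h)
  case (Cons x X)
  have "h (of_real x) = 0" using Cons.prems by simp
  then obtain g where g: "g holomorphic_on UNIV" "\<And>z. h z = (z - of_real x) * g z"
    using entire_factor[OF Cons.prems(1)] by metis
  have "vanishes X g"
  proof (rule Cons.IH)
    fix y assume y: "y \<in> set X"
    then have "(of_real y - of_real x) * g (of_real y) = 0" "y \<noteq> x"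
      using Cons.prems(2,3) g(2)[of "of_real y"] by auto
    then show "g (of_real y) = 0" by simp
  qed (use g Cons.prems in auto)
  then show ?case using g(2) by (auto simp: vanishes_Cons)
qed simp

text \<open>A zero of P u at a node belongs to P since u is nonzero there. The factors are split off
  one by one, so multiplicities are respected.\<close>

lemma nodal_dvd_if_vanishes:
  assumes "vanishes X (\<lambda>z. poly P z * u z)" "u holomorphic_on UNIV"
    and "\<And>x. x \<in> set X \<Longrightarrow> u (of_real x) \<noteq> 0"
  shows "nodal X dvd P"
  using assms
proof (induction X arbitrary: P)
  case (Cons x X)
  have "poly P (of_real x) * u (of_real x) = 0"
    using vanishes_Cons_at[OF Cons.prems(1)] .
  then have "poly P (of_real x) = 0" using Cons.prems(3) by simp
  then obtain P1 where P1: "P = [:- of_real x, 1:] * P1"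
    by (metis dvdE poly_eq_0_iff_dvd)
  have "vanishes X (\<lambda>z. poly P1 z * u z)"
    by (rule vanishes_Cons_cancel[of x])
       (use Cons.prems(1,2) in \<open>auto simp: P1 algebra_simps intro!: holomorphic_intros\<close>)
  then have "nodal X dvd P1" using Cons by (meson list.set_intros(2))
  then show ?case unfolding P1 nodal_Cons by (rule mult_dvd_mono[OF dvd_refl])
qed simp

subsection \<open>Newton coefficients and their sign changes\<close>

text \<open>The divided difference of \<open>h\<close> at the nodes \<open>X ! 0, ..., X ! i\<close>, as a contour integral.\<close>

definition newton_coeff :: "real \<Rightarrow> real list \<Rightarrow> (complex \<Rightarrow> complex) \<Rightarrow> nat \<Rightarrow> complex" where
  "newton_coeff R X h i =
     contour_integral (circlepath 0 R) (\<lambda>z. h z / poly (nodal (take (Suc i) X)) z) / (2 * of_real pi * \<i>)"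

lemma nodal_nonzero_on_circle:
  assumes "\<forall>x\<in>set X. \<bar>x\<bar> < R" "norm z \<ge> R"
  shows "poly (nodal (take i X)) z \<noteq> 0"
proof
  assume "poly (nodal (take i X)) z = 0"
  then obtain x where "x \<in> set (take i X)" "z = of_real x" by (auto simp: poly_nodal_eq_0_iff)
  then show False using assms by (metis in_set_takeD linorder_not_less norm_of_real real_norm_def)
qed

lemma newton_integrable:
  assumes "\<forall>x\<in>set X. \<bar>x\<bar> < R" "h holomorphic_on UNIV" "R > 0"
  shows "(\<lambda>z. h z / poly (nodal (take i X)) z) contour_integrable_on circlepath 0 R"
proof (rule contour_integrable_continuous_circlepath)
  have "continuous_on (sphere 0 R) h"
    using assms(2) entire_imp_continuous continuous_on_subset by blast
  then show "continuous_on (path_image (circlepath 0 R)) (\<lambda>z. h z / poly (nodal (take i X)) z)"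
    using assms(3) nodal_nonzero_on_circle[OF assms(1), where i = i]
    by (intro continuous_intros) (auto simp: dist_norm)
qed

lemma contour_integral_entire_circlepath:
  "h holomorphic_on UNIV \<Longrightarrow> contour_integral (circlepath 0 R) h = 0"
  by (rule contour_integral_unique, rule Cauchy_theorem_convex_simple[of _ UNIV]) auto

text \<open>The first i + 1 nodes cancel against the nodal polynomial, which leaves an entire
  integrand. Hence functions that agree at the nodes, with multiplicity, have the same Newton
  coefficients.\<close>

lemma newton_coeff_vanishes:
  assumes "vanishes X h" "R > 0" "\<forall>x\<in>set X. \<bar>x\<bar> < R" "i < length X"
  shows "newton_coeff R X h i = 0"
proof -
  obtain g where g: "g holomorphic_on UNIV" "\<And>z. h z = poly (nodal X) z * g z"
    using assms(1) by (auto simp: vanishes_def)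
  have "contour_integral (circlepath 0 R) (\<lambda>z. h z / poly (nodal (take (Suc i) X)) z) =
        contour_integral (circlepath 0 R) (\<lambda>z. poly (nodal (drop (Suc i) X)) z * g z)"
  proof (rule contour_integral_cong)
    fix z assume "z \<in> path_image (circlepath 0 R)"
    then have "poly (nodal (take (Suc i) X)) z \<noteq> 0"
      using nodal_nonzero_on_circle[OF assms(3)] assms(2) by (auto simp: dist_norm)
    moreover have "nodal X = nodal (take (Suc i) X) * nodal (drop (Suc i) X)"
      by (metis append_take_drop_id nodal_append)
    ultimately show "h z / poly (nodal (take (Suc i) X)) z = poly (nodal (drop (Suc i) X)) z * g z"
      by (simp add: g(2))
  qed simp
  also have "\<dots> = 0"
    by (rule contour_integral_entire_circlepath) (auto intro!: holomorphic_intros g)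
  finally show ?thesis by (simp add: newton_coeff_def)
qed

lemma newton_coeff_add:
  assumes "\<forall>x\<in>set X. \<bar>x\<bar> < R" "R > 0" "h holomorphic_on UNIV" "k holomorphic_on UNIV"
  shows "newton_coeff R X (\<lambda>z. h z + k z) i = newton_coeff R X h i + newton_coeff R X k i"
  unfolding newton_coeff_def add_divide_distrib
  by (subst contour_integral_add) (auto intro!: newton_integrable assms simp: add_divide_distrib)

lemma newton_coeff_cmult:
  assumes "\<forall>x\<in>set X. \<bar>x\<bar> < R" "R > 0" "h holomorphic_on UNIV"
  shows "newton_coeff R X (\<lambda>z. c * h z) i = c * newton_coeff R X h i"
proof -
  have "contour_integral (circlepath 0 R) (\<lambda>z. c * (h z / poly (nodal (take (Suc i) X)) z)) =
    c * contour_integral (circlepath 0 R) (\<lambda>z. h z / poly (nodal (take (Suc i) X)) z)"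
    by (rule contour_integral_lmul) (auto intro!: newton_integrable assms)
  then show ?thesis by (simp add: newton_coeff_def)
qed

lemma newton_coeff_sum:
  assumes "\<forall>x\<in>set X. \<bar>x\<bar> < R" "R > 0" "finite J" "\<And>j. j \<in> J \<Longrightarrow> h j holomorphic_on UNIV"
  shows "newton_coeff R X (\<lambda>z. \<Sum>j\<in>J. h j z) i = (\<Sum>j\<in>J. newton_coeff R X (h j) i)"
  using assms(3,4)
proof (induction J rule: finite_induct)
  case (insert j J)
  then show ?case
    by (simp add: newton_coeff_add[OF assms(1,2)] holomorphic_on_sum)
qed (simp add: newton_coeff_def)

text \<open>From \<open>u + v * z = (u + v * x) + v * (z - x)\<close> with x the last node of the
  divided difference: the second summand removes that node. Multiplication by a linear function thus
  acts on Newton coefficients as a lower bidiagonal matrix.\<close>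

lemma newton_coeff_linear_mult:
  assumes "\<forall>x\<in>set X. \<bar>x\<bar> < R" "R > 0" "h holomorphic_on UNIV" "i < length X"
  shows "newton_coeff R X (\<lambda>z. (u + v * z) * h z) i =
     (u + v * of_real (X ! i)) * newton_coeff R X h i + (if i = 0 then 0 else v * newton_coeff R X h (i - 1))"
proof -
  let ?w = "\<lambda>i z. poly (nodal (take i X)) z"
  have w: "?w (Suc i) z = (z - of_real (X ! i)) * ?w i z" for z
    using assms(4) by (simp add: take_Suc_conv_app_nth nodal_append poly_nodal_Cons)
  have nz: "?w (Suc i) z \<noteq> 0" if "z \<in> path_image (circlepath 0 R)" for z
    using nodal_nonzero_on_circle[OF assms(1)] that assms(2) by (auto simp: dist_norm)
  have int: "(\<lambda>z. h z / ?w j z) contour_integrable_on circlepath 0 R" for j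
    using newton_integrable[OF assms(1,3,2)] .
  have "contour_integral (circlepath 0 R) (\<lambda>z. (u + v * z) * h z / ?w (Suc i) z) =
    contour_integral (circlepath 0 R) (\<lambda>z. (u + v * of_real (X ! i)) * (h z / ?w (Suc i) z) + v * (h z / ?w i z))"
  proof (rule contour_integral_cong)
    fix z assume z: "z \<in> path_image (circlepath 0 R)"
    from nz[OF z] have nz': "?w i z \<noteq> 0" "z - of_real (X ! i) \<noteq> 0" by (auto simp: w)
    define y where "y = (of_real (X ! i) :: complex)"
    have "(u + v * z) * h z / ((z - y) * ?w i z) =
      (u + v * y) * (h z / ((z - y) * ?w i z)) + v * (h z / ?w i z)"
      using nz' unfolding y_def[symmetric] by (simp add: field_simps)
    then show "(u + v * z) * h z / ?w (Suc i) z =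
      (u + v * of_real (X ! i)) * (h z / ?w (Suc i) z) + v * (h z / ?w i z)"
      unfolding w y_def .
  qed simp
  also have "\<dots> = (u + v * of_real (X ! i)) * contour_integral (circlepath 0 R) (\<lambda>z. h z / ?w (Suc i) z)
      + v * contour_integral (circlepath 0 R) (\<lambda>z. h z / ?w i z)"
    by (subst contour_integral_add)
       (auto intro!: contour_integrable_lmul int simp only: contour_integral_lmul[OF int])
  finally have eq: "contour_integral (circlepath 0 R) (\<lambda>z. (u + v * z) * h z / ?w (Suc i) z) = \<dots>" .
  show ?thesis
  proof (cases "i = 0")
    case True
    then have "contour_integral (circlepath 0 R) (\<lambda>z. h z / ?w i z) = 0"
      using contour_integral_entire_circlepath[OF assms(3)] by simp
    with True eq show ?thesis by (simp add: newton_coeff_def)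
  next
    case False
    then show ?thesis using eq by (simp add: newton_coeff_def add_divide_distrib)
  qed
qed

lemma newton_coeff_0:
  assumes "\<forall>x\<in>set X. \<bar>x\<bar> < R" "R > 0" "h holomorphic_on UNIV" "X \<noteq> []"
  shows "newton_coeff R X h 0 = h (of_real (hd X))"
proof -
  have "take (Suc 0) X = [hd X]" using assms(4) by (cases X) auto
  moreover have "((\<lambda>z. h z / (z - of_real (hd X))) has_contour_integral (2 * of_real pi * \<i> * h (of_real (hd X)))) (circlepath 0 R)"
    by (rule Cauchy_integral_circlepath_simple)
       (use assms in \<open>auto intro: holomorphic_on_subset simp: dist_norm\<close>)
  ultimately show ?thesis
    by (simp add: newton_coeff_def poly_nodal_Cons contour_integral_unique)
qed

lemma nodal_norm_ge:
  assumes "\<forall>x\<in>set X. \<bar>x\<bar> \<le> R" "norm z \<ge> R"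
  shows "norm (poly (nodal X) z) \<ge> (norm z - R) ^ length X"
  using assms(1)
proof (induction X)
  case (Cons x X)
  have "norm z - R \<le> norm (z - of_real x)"
    using Cons.prems norm_triangle_ineq2[of z "of_real x"] by (simp add: norm_of_real)
  moreover have "(norm z - R) ^ length X \<le> norm (poly (nodal X) z)"
    using Cons by simp
  ultimately show ?case
    using assms(2) by (simp add: poly_nodal_Cons norm_mult mult_mono)
qed simp

text \<open>The integrand decays at least quadratically, because i > 0 leaves at least two nodes,
  and the circle can be enlarged without changing the integral.\<close>

lemma newton_coeff_1:
  assumes "\<forall>x\<in>set X. \<bar>x\<bar> < R" "R > 0" "0 < i" "i < length X"
  shows "newton_coeff R X (\<lambda>_. 1) i = 0"
proof -
  let ?w = "poly (nodal (take (Suc i) X))"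
  let ?I = "\<lambda>r. contour_integral (circlepath 0 r) (\<lambda>z. 1 / ?w z)"
  have nz: "?w z \<noteq> 0" if "norm z \<ge> R" for z
    using nodal_nonzero_on_circle[OF assms(1)] that by blast
  have indep: "?I R = ?I r" if "r \<ge> R" for r
  proof (rule Cauchy_theorem_homotopic_loops)
    show "homotopic_loops {z. ?w z \<noteq> 0} (circlepath 0 R) (circlepath 0 r)"
    proof (rule homotopic_loops_linear)
      fix t x :: real assume "t \<in> {0..1}"
      define e where "e = exp (2 * of_real pi * \<i> * of_real t)"
      have e: "norm e = 1" by (simp add: e_def norm_exp_eq_Re)
      \<comment> \<open>Corresponding points of the two circles lie on a common ray, so the segment
        between them stays at distance at least R from the origin and avoids the nodes.\<close>
      show "closed_segment (circlepath 0 R t) (circlepath 0 r t) \<subseteq> {z. ?w z \<noteq> 0}"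
      proof
        fix y assume "y \<in> closed_segment (circlepath 0 R t) (circlepath 0 r t)"
        then obtain s where s: "0 \<le> s" "s \<le> 1" "y = (1 - s) *\<^sub>R (of_real R * e) + s *\<^sub>R (of_real r * e)"
          by (auto simp: closed_segment_def circlepath e_def)
        have "y = of_real ((1 - s) * R + s * r) * e"
          by (simp add: s(3) scaleR_conv_of_real algebra_simps)
        then have "norm y = \<bar>(1 - s) * R + s * r\<bar>"
          using e by (simp only: norm_mult norm_of_real) simp
        moreover have "(1 - s) * R + s * r \<ge> R"
          using s mult_left_mono[OF that, of s] by (simp add: algebra_simps)
        ultimately show "y \<in> {z. ?w z \<noteq> 0}" using nz by simp
      qed
    qed simp_all
    show "(\<lambda>z. 1 / ?w z) holomorphic_on {z. ?w z \<noteq> 0}"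
      by (auto intro!: holomorphic_intros)
    have "finite {z. ?w z = 0}" by (rule poly_roots_finite) simp
    moreover have "{z. ?w z \<noteq> 0} = - {z. ?w z = 0}" by auto
    ultimately show "open {z. ?w z \<noteq> 0}" by (simp add: open_Compl finite_imp_closed)
  qed simp_all
  have le: "\<forall>x\<in>set (take (Suc i) X). \<bar>x\<bar> \<le> R"
    using assms(1) by (meson in_set_takeD less_imp_le)
  have bound: "norm (?I R) \<le> 4 * pi / s" if s: "s \<ge> 1" "s \<ge> R" for s
  proof -
    have len: "length (take (Suc i) X) = Suc i" using assms(4) by simp
    have "norm (?I (R + s)) \<le> (1 / s ^ 2) * (2 * pi * (R + s))"
    proof (rule has_contour_integral_bound_circlepath)
      have "(\<lambda>z. 1 / ?w z) contour_integrable_on circlepath 0 (R + s)"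
        by (rule contour_integrable_continuous_circlepath)
           (use nz s assms(2) in \<open>auto intro!: continuous_intros simp: dist_norm\<close>)
      then show "((\<lambda>z. 1 / ?w z) has_contour_integral ?I (R + s)) (circlepath 0 (R + s))"
        by (rule has_contour_integral_integral)
      fix z :: complex assume "norm (z - 0) = R + s"
      then have "s ^ Suc i \<le> norm (?w z)"
        using nodal_norm_ge[of "take (Suc i) X" R z] le s by (simp only: len) simp
      moreover have "s ^ 2 \<le> s ^ Suc i" using s assms(3) by (intro power_increasing) auto
      ultimately have "s ^ 2 \<le> norm (?w z)" by linarith
      then show "norm (1 / ?w z) \<le> 1 / s ^ 2"
        using s by (simp add: norm_divide frac_le)
    qed (use s assms(2) in auto)
    also have "\<dots> \<le> (1 / s ^ 2) * (2 * pi * (2 * s))"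
      using s by (intro mult_left_mono) auto
    also have "\<dots> = 4 * pi / s" using s by (simp add: power2_eq_square)
    finally show ?thesis using indep[of "R + s"] s by simp
  qed
  have "?I R = 0"
  proof (rule ccontr)
    assume "?I R \<noteq> 0"
    then have pos: "norm (?I R) > 0" by simp
    \<comment> \<open>At this radius the bound \<open>4 * pi / s\<close> is at most half of the
      integral that it bounds.\<close>
    define s where "s = max (max 1 R) (8 * pi / norm (?I R))"
    have s: "s \<ge> 1" "s \<ge> R" "s \<ge> 8 * pi / norm (?I R)" by (auto simp: s_def)
    have "8 * pi \<le> s * norm (?I R)" using s(3) pos by (simp add: field_simps)
    moreover have "s * norm (?I R) \<le> 4 * pi" using bound[OF s(1,2)] s(1) by (simp add: field_simps)
    ultimately show False using pi_gt_zero by linarith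
  qed
  then show ?thesis by (simp add: newton_coeff_def)
qed

lemma newton_coeff_power:
  assumes "\<forall>x\<in>set X. \<bar>x\<bar> < R" "R > 0" "i < length X" "m \<le> i"
  shows "newton_coeff R X (\<lambda>z. z ^ m) i = (if m = i then 1 else 0)"
  using assms(3,4)
proof (induction m arbitrary: i)
  case 0
  show ?case
  proof (cases "i = 0")
    case True
    then show ?thesis using newton_coeff_0[OF assms(1,2), of "\<lambda>_. 1"] 0 by auto
  next
    case False
    then show ?thesis using newton_coeff_1[OF assms(1,2)] 0 by simp
  qed
next
  case (Suc m)
  have "newton_coeff R X (\<lambda>z. (0 + 1 * z) * z ^ m) i =
     (0 + 1 * of_real (X ! i)) * newton_coeff R X (\<lambda>z. z ^ m) i
     + (if i = 0 then 0 else 1 * newton_coeff R X (\<lambda>z. z ^ m) (i - 1))"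
    by (rule newton_coeff_linear_mult[OF assms(1,2) _ Suc.prems(1)]) (auto intro!: holomorphic_intros)
  then show ?case using Suc by auto
qed

lemma newton_coeff_poly:
  assumes "\<forall>x\<in>set X. \<bar>x\<bar> < R" "R > 0" "i < length X" "degree p \<le> i"
  shows "newton_coeff R X (poly p) i = coeff p i"
proof -
  have "poly p = (\<lambda>z. \<Sum>m\<le>degree p. coeff p m * z ^ m)"
    by (simp add: poly_altdef fun_eq_iff)
  then have "newton_coeff R X (poly p) i = (\<Sum>m\<le>degree p. newton_coeff R X (\<lambda>z. coeff p m * z ^ m) i)"
    using newton_coeff_sum[OF assms(1,2), of "{..degree p}" "\<lambda>m z. coeff p m * z ^ m"]
    by (simp add: holomorphic_on_mult holomorphic_on_power)
  also have "\<dots> = (\<Sum>m\<le>degree p. coeff p m * (if m = i then 1 else 0))"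
  proof (rule sum.cong)
    fix m assume "m \<in> {..degree p}"
    then have "m \<le> i" using assms(4) by simp
    then show "newton_coeff R X (\<lambda>z. coeff p m * z ^ m) i = coeff p m * (if m = i then 1 else 0)"
      using newton_coeff_cmult[OF assms(1,2), of "\<lambda>z. z ^ m"] newton_coeff_power[OF assms(1,2,3)]
      by (simp add: holomorphic_on_power)
  qed simp
  also have "\<dots> = coeff p i"
    by (simp add: if_distrib[of "\<lambda>x. _ * x"] sum.delta coeff_eq_0 cong: if_cong)
  finally show ?thesis .
qed

lemma newton_coeff_limit:
  assumes "\<forall>x\<in>set X. \<bar>x\<bar> < R" "R > 0" "\<And>n. h n holomorphic_on UNIV" "k holomorphic_on UNIV"
    and "uniform_limit (sphere 0 R) h k F" "F \<noteq> bot"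
  shows "((\<lambda>n. newton_coeff R X (h n) i) \<longlongrightarrow> newton_coeff R X k i) F"
proof -
  let ?w = "poly (nodal (take (Suc i) X))"
  have nz: "?w z \<noteq> 0" if "z \<in> sphere 0 R" for z
    using nodal_nonzero_on_circle[OF assms(1)] that by simp
  have comp: "compact (?w ` sphere 0 R)"
    by (intro compact_continuous_image continuous_intros compact_sphere)
  have "bounded ((\<lambda>z. inverse (?w z)) ` sphere 0 R)"
    by (intro compact_imp_bounded compact_continuous_image continuous_intros) (use nz in auto)
  moreover have "bounded (k ` sphere 0 R)"
    by (intro compact_imp_bounded compact_continuous_image)
       (use continuous_on_subset[OF entire_imp_continuous[OF assms(4)]] in auto)
  ultimately have "uniform_limit (sphere 0 R) (\<lambda>n z. h n z * inverse (?w z)) (\<lambda>z. k z * inverse (?w z)) F"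
    using assms(5) by (intro uniform_lim_mult uniform_limit_const)
  then have "((\<lambda>n. contour_integral (circlepath 0 R) (\<lambda>z. h n z / ?w z)) \<longlongrightarrow>
      contour_integral (circlepath 0 R) (\<lambda>z. k z / ?w z)) F"
    by (intro contour_integral_uniform_limit_circlepath(2))
       (use newton_integrable[OF assms(1,3,2)] assms(2,6) in \<open>auto simp: divide_inverse\<close>)
  then show ?thesis unfolding newton_coeff_def by (intro tendsto_divide tendsto_const) auto
qed

lemma newton_coeff_bound:
  assumes "\<forall>x\<in>set X. \<bar>x\<bar> < R" "R > 0" "\<And>z. norm z = R \<Longrightarrow> norm (h z) \<le> B" "h holomorphic_on UNIV" "B \<ge> 0"
  shows "norm (newton_coeff R X h i) \<le> B * (R / (R - Max (insert 0 (abs ` set X))) ^ length (take (Suc i) X))"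
proof -
  let ?m = "Max (insert 0 (abs ` set X))" and ?w = "poly (nodal (take (Suc i) X))"
  let ?l = "length (take (Suc i) X)"
  have m: "?m < R" using assms(1,2) by (subst Max_less_iff) auto
  have "norm (contour_integral (circlepath 0 R) (\<lambda>z. h z / ?w z)) \<le> (B / (R - ?m) ^ ?l) * (2 * pi * R)"
  proof (rule has_contour_integral_bound_circlepath)
    show "((\<lambda>z. h z / ?w z) has_contour_integral contour_integral (circlepath 0 R) (\<lambda>z. h z / ?w z)) (circlepath 0 R)"
      using newton_integrable[OF assms(1,4,2)] by (rule has_contour_integral_integral)
    fix z :: complex assume z: "norm (z - 0) = R"
    have "(norm z - ?m) ^ ?l \<le> norm (?w z)"
    proof (rule nodal_norm_ge)
      show "\<forall>x\<in>set (take (Suc i) X). \<bar>x\<bar> \<le> ?m"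
        by (auto intro!: Max_ge dest: in_set_takeD)
    qed (use z m in auto)
    then show "norm (h z / ?w z) \<le> B / (R - ?m) ^ ?l"
      using z m assms(3)[of z] assms(5) by (simp add: norm_divide frac_le)
  next
    have "(R - ?m) ^ ?l > 0" using m by (intro zero_less_power) linarith
    then show "0 \<le> B / (R - ?m) ^ ?l" using assms(5) by (intro divide_nonneg_pos)
  qed (rule assms(2))
  moreover have "norm (newton_coeff R X h i) = norm (contour_integral (circlepath 0 R) (\<lambda>z. h z / ?w z)) / (2 * pi)"
    by (simp add: newton_coeff_def norm_divide norm_mult)
  moreover have "b \<le> (B / c) * (2 * pi * R) \<Longrightarrow> b / (2 * pi) \<le> B * (R / c)" for b c :: real
    using divide_right_mono[of b "(B / c) * (2 * pi * R)" "2 * pi"] by (simp add: mult_ac)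
  ultimately show ?thesis by metis
qed

text \<open>The first \<open>N\<close> entries of \<open>d\<close> have at least \<open>m\<close> sign changes.\<close>

definition alternates :: "(nat \<Rightarrow> real) \<Rightarrow> nat \<Rightarrow> nat \<Rightarrow> bool" where
  "alternates d N m \<longleftrightarrow> (\<exists>f \<sigma>. (\<forall>j<m. f j < f (Suc j)) \<and>
     (\<forall>j\<le>m. f j < N \<and> \<sigma> * (-1) ^ j * d (f j) > 0))"

section \<open>Variation diminution by bidiagonal matrices and their inverses\<close>

text \<open>If d does not already have the required sign at \<open>f j\<close>, the sign of the
  image there must come from the subdiagonal term, so \<open>d (f j - 1)\<close> has it. The shifted
  positions cannot collide, because consecutive required signs are opposite.\<close>

lemma alternates_bidiagonal:
  assumes alt: "alternates e N m"
    and e: "\<And>i. i < N \<Longrightarrow> e i = u i * d i + (if i = 0 then 0 else v * d (i - 1))"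
    and u: "\<And>i. i < N \<Longrightarrow> u i > 0" and v: "v \<ge> 0"
  shows "alternates d N m"
proof -
  obtain f \<sigma> where f: "\<And>j. j < m \<Longrightarrow> f j < f (Suc j)"
    "\<And>j. j \<le> m \<Longrightarrow> f j < N" "\<And>j. j \<le> m \<Longrightarrow> \<sigma> * (-1) ^ j * e (f j) > 0"
    using alt unfolding alternates_def by blast
  define g where "g j = (if \<sigma> * (-1) ^ j * d (f j) > 0 then f j else f j - 1)" for j
  have pos: "\<sigma> * (-1) ^ j * d (g j) > 0" if "j \<le> m" for j
  proof (cases "\<sigma> * (-1) ^ j * d (f j) > 0")
    case False
    let ?s = "\<sigma> * (-1) ^ j"
    have "u (f j) * (?s * d (f j)) \<le> 0"
      by (rule mult_nonneg_nonpos) (use False u[OF f(2)[OF that]] in linarith)+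
    moreover have "?s * e (f j) = u (f j) * (?s * d (f j)) + (if f j = 0 then 0 else v * (?s * d (f j - 1)))"
      unfolding e[OF f(2)[OF that]] by (simp add: algebra_simps)
    ultimately have "v * (?s * d (f j - 1)) > 0"
      using f(3)[OF that] by (auto split: if_splits)
    then have "?s * d (f j - 1) > 0" using v by (simp add: zero_less_mult_iff)
    then show ?thesis using False by (simp add: g_def)
  qed (simp add: g_def)
  have "g j < g (Suc j)" if "j < m" for j
  proof -
    have "g j \<le> f j" "f (Suc j) - 1 \<le> g (Suc j)" by (auto simp: g_def)
    then have "g j \<le> g (Suc j)" using f(1)[OF that] by linarith
    moreover have "g j \<noteq> g (Suc j)"
      using pos[of j] pos[of "Suc j"] that by (auto simp: mult.assoc)
    ultimately show ?thesis by simp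
  qed
  moreover have "g j < N" if "j \<le> m" for j
    using f(2)[OF that] by (auto simp: g_def)
  ultimately show ?thesis unfolding alternates_def using pos by blast
qed

text \<open>The inverse of this matrix is nonnegative, and h is the image of c under it. At the
  first suitable position after the previous marker the sign of h cannot be inherited from the entry
  before, so c has the same sign there.\<close>

lemma alternates_inverse_bidiagonal:
  assumes alt: "alternates h N m"
    and c: "\<And>i. i < N \<Longrightarrow> c i = u i * h i - (if i = 0 then 0 else v * h (i - 1))"
    and u: "\<And>i. i < N \<Longrightarrow> u i > 0" and v: "v \<ge> 0"
  shows "alternates c N m"
proof -
  obtain f \<sigma> where f: "\<And>j. j < m \<Longrightarrow> f j < f (Suc j)"
    "\<And>j. j \<le> m \<Longrightarrow> f j < N" "\<And>j. j \<le> m \<Longrightarrow> \<sigma> * (-1) ^ j * h (f j) > 0"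
    using alt unfolding alternates_def by blast
  define A where "A j k \<longleftrightarrow> (j = 0 \<or> f (j - 1) < k) \<and> \<sigma> * (-1) ^ j * h k > 0" for j k
  define g where "g j = (LEAST k. A j k)" for j
  have Af: "A j (f j)" if "j \<le> m" for j
    using f(3)[OF that] f(1)[of "j - 1"] that by (cases j) (auto simp: A_def)
  have Ag: "A j (g j)" and gf: "g j \<le> f j" if "j \<le> m" for j
    unfolding g_def using Af[OF that] by (auto intro: LeastI Least_le)
  have gN: "g j < N" if "j \<le> m" for j
    using gf[OF that] f(2)[OF that] by linarith
  have "\<sigma> * (-1) ^ j * c (g j) > 0" if j: "j \<le> m" for j
  proof -
    let ?s = "\<sigma> * (-1) ^ j"
    have 1: "u (g j) * (?s * h (g j)) > 0"
      using Ag[OF j] u[OF gN[OF j]] by (auto simp: A_def)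
    have 2: "?s * h (g j - 1) \<le> 0" if "g j \<noteq> 0"
    \<comment> \<open>Either the predecessor was rejected for its sign, or it is the previous
      marker, whose sign is opposite.\<close>
    proof (cases "j = 0 \<or> f (j - 1) < g j - 1")
      case True
      have "\<not> A j (g j - 1)"
        using not_less_Least[of "g j - 1" "A j"] that by (simp add: g_def[symmetric])
      with True show ?thesis by (auto simp: A_def)
    next
      case False
      then obtain j' where j': "j = Suc j'" by (cases j) auto
      have "f j' < g j" using Ag[OF j] j' by (auto simp: A_def)
      then have "g j - 1 = f j'" using False j' by auto
      then show ?thesis using f(3)[of j'] j j' by (auto simp: mult.assoc)
    qed
    have "?s * c (g j) = u (g j) * (?s * h (g j)) - (if g j = 0 then 0 else v * (?s * h (g j - 1)))"
      unfolding c[OF gN[OF j]] by (simp add: algebra_simps)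
    moreover have "v * (?s * h (g j - 1)) \<le> 0" if "g j \<noteq> 0"
      using 2[OF that] v by (rule mult_nonneg_nonpos[rotated])
    ultimately show ?thesis using 1 by (auto split: if_splits)
  qed
  moreover have "g j < g (Suc j)" if "j < m" for j
    using gf[of j] Ag[of "Suc j"] that by (auto simp: A_def)
  ultimately show ?thesis unfolding alternates_def using gN by blast
qed

lemma alternates_limit:
  assumes "alternates d N m" and lim: "\<And>i. i < N \<Longrightarrow> ((\<lambda>n. e n i) \<longlongrightarrow> d i) F"
  shows "\<forall>\<^sub>F n in F. alternates (e n) N m"
proof -
  obtain f \<sigma> where f: "\<And>j. j < m \<Longrightarrow> f j < f (Suc j)"
    "\<And>j. j \<le> m \<Longrightarrow> f j < N" "\<And>j. j \<le> m \<Longrightarrow> \<sigma> * (-1) ^ j * d (f j) > 0"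
    using assms(1) unfolding alternates_def by blast
  have "\<forall>\<^sub>F n in F. \<forall>j\<in>{..m}. \<sigma> * (-1) ^ j * e n (f j) > 0"
  proof (rule eventually_ball_finite)
    show "\<forall>j\<in>{..m}. \<forall>\<^sub>F n in F. \<sigma> * (-1) ^ j * e n (f j) > 0"
    proof
      fix j assume "j \<in> {..m}"
      then have j: "j \<le> m" by simp
      have "((\<lambda>n. \<sigma> * (-1) ^ j * e n (f j)) \<longlongrightarrow> \<sigma> * (-1) ^ j * d (f j)) F"
        by (intro tendsto_mult tendsto_const lim f(2)[OF j])
      then show "\<forall>\<^sub>F n in F. \<sigma> * (-1) ^ j * e n (f j) > 0"
        using f(3)[OF j] by (rule order_tendstoD(1))
    qed
  qed simp
  then show ?thesis
    by eventually_elim (unfold alternates_def, use f in blast)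
qed

lemma alternates_le_support:
  assumes "alternates d N m" "\<And>i. i > p \<Longrightarrow> i < N \<Longrightarrow> d i = 0"
  shows "m \<le> p"
proof -
  obtain f \<sigma> where f: "\<And>j. j < m \<Longrightarrow> f j < f (Suc j)"
    "\<And>j. j \<le> m \<Longrightarrow> f j < N" "\<And>j. j \<le> m \<Longrightarrow> \<sigma> * (-1) ^ j * d (f j) > 0"
    using assms(1) unfolding alternates_def by blast
  have "j \<le> m \<Longrightarrow> j \<le> f j" for j
  proof (induction j)
    case (Suc j)
    then show ?case using f(1)[of j] by linarith
  qed simp
  then have "m \<le> f m" by simp
  moreover have "f m \<le> p" using assms(2)[of "f m"] f(2,3)[of m] by force
  ultimately show ?thesis by simp
qed

text \<open>With as many sign changes as the support permits there is no freedom left: the first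
  position is 0 and the last is p. This comparison of two entries is the origin of the sign pattern
  of the weights.\<close>

lemma alternates_full_support:
  assumes "alternates d N p" "\<And>i. i > p \<Longrightarrow> i < N \<Longrightarrow> d i = 0"
  shows "(-1) ^ p * d 0 * d p > 0"
proof -
  obtain f \<sigma> where f: "\<And>j. j < p \<Longrightarrow> f j < f (Suc j)"
    "\<And>j. j \<le> p \<Longrightarrow> f j < N" "\<And>j. j \<le> p \<Longrightarrow> \<sigma> * (-1) ^ j * d (f j) > 0"
    using assms(1) unfolding alternates_def by blast
  have lb: "j \<le> p \<Longrightarrow> j \<le> f j" for j
  proof (induction j)
    case (Suc j)
    then show ?case using f(1)[of j] by linarith
  qed simp
  have ub: "i \<le> p \<Longrightarrow> f (p - i) \<le> p - i" for i
  proof (induction i)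
    case 0
    then show ?case using assms(2)[of "f p"] f(2,3)[of p] by force
  next
    case (Suc i)
    then have "f (p - Suc i) < f (p - i)" using f(1)[of "p - Suc i"] by (simp add: Suc_diff_Suc)
    then show ?case using Suc by linarith
  qed
  have "f 0 = 0" "f p = p" using ub[of p] ub[of 0] lb[of p] by auto
  then have "\<sigma> * d 0 > 0" "\<sigma> * ((-1) ^ p * d p) > 0"
    using f(3)[of 0] f(3)[of p] by (auto simp: mult.assoc)
  then have "(\<sigma> * d 0) * (\<sigma> * ((-1) ^ p * d p)) > 0" by (rule mult_pos_pos)
  moreover have "(\<sigma> * d 0) * (\<sigma> * ((-1) ^ p * d p)) = \<sigma>\<^sup>2 * ((-1) ^ p * d 0 * d p)"
    by (simp add: power2_eq_square)
  ultimately show ?thesis using zero_less_mult_pos zero_le_power2 by (metis zero_less_mult_iff not_less)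
qed

section \<open>Linear factors and the exponential acting on Newton coefficients\<close>

definition edrei_poly :: "(nat \<Rightarrow> real) \<Rightarrow> nat \<Rightarrow> complex poly" where
  "edrei_poly \<alpha> k = (\<Prod>i=1..k. [:1, of_real (\<alpha> i):])"

lemma edrei_poly_0 [simp]: "edrei_poly \<alpha> 0 = 1"
  by (simp add: edrei_poly_def)

lemma edrei_poly_Suc: "edrei_poly \<alpha> (Suc k) = edrei_poly \<alpha> k * [:1, of_real (\<alpha> (Suc k)):]"
  by (simp add: edrei_poly_def)

lemma poly_edrei_poly: "poly (edrei_poly \<alpha> k) z = (\<Prod>i=1..k. 1 + of_real (\<alpha> i) * z)"
  by (simp add: edrei_poly_def poly_prod mult.commute)

text \<open>Both 1 + w / n and exp (w / n) are divided by c = exp (norm w / n), which brings them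
  into the unit disc. There the difference of n-th powers is at most n times the difference of the
  bases.\<close>

lemma exp_power_bound:
  fixes w :: complex
  assumes "n > 0"
  shows "norm ((1 + w / of_nat n) ^ n - exp w) \<le> exp (2 * norm w) * norm w ^ 2 / n"
proof -
  define v where "v = w / of_nat n"
  define c where "c = exp (norm v)"
  have c: "c \<ge> 1" by (simp add: c_def)
  have "norm (1 + v) \<le> 1 + norm v" using norm_triangle_ineq[of 1 v] by simp
  also have "\<dots> \<le> c" by (simp add: c_def)
  finally have 1: "norm (1 + v) \<le> c" .
  have 2: "norm (exp v) \<le> c" by (simp add: c_def norm_exp_eq_Re complex_Re_le_cmod)
  have "norm (((1 + v) / of_real c) ^ n - (exp v / of_real c) ^ n) \<le> n * norm ((1 + v) / of_real c - exp v / of_real c)"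
    by (rule norm_power_diff) (use 1 2 c in \<open>auto simp: norm_divide\<close>)
  also have "\<dots> \<le> n * norm (exp v - (1 + v))"
  proof (rule mult_left_mono)
    have "norm ((1 + v) / of_real c - exp v / of_real c) = norm (exp v - (1 + v)) / c"
      using c by (simp add: diff_divide_distrib[symmetric] norm_divide norm_minus_commute)
    also have "\<dots> \<le> norm (exp v - (1 + v)) / 1" using c by (intro divide_left_mono) auto
    finally show "norm ((1 + v) / of_real c - exp v / of_real c) \<le> norm (exp v - (1 + v))" by simp
  qed simp
  also have "norm (exp v - (1 + v)) \<le> exp (norm v) * norm v ^ 2"
    using Taylor_exp_field[of v 1] by (simp add: power2_eq_square)
  finally have 3: "norm (((1 + v) / of_real c) ^ n - (exp v / of_real c) ^ n) \<le> n * (exp (norm v) * norm v ^ 2)"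
    by (simp add: mult_left_mono)
  have cn: "c ^ n = exp (norm w)"
    using assms by (simp add: c_def v_def norm_divide exp_of_nat_mult[symmetric])
  have "exp v ^ n = exp w" using assms by (simp add: v_def exp_of_nat_mult[symmetric])
  then have "(1 + v) ^ n - exp w = of_real (c ^ n) * (((1 + v) / of_real c) ^ n - (exp v / of_real c) ^ n)"
    using c by (simp add: power_divide right_diff_distrib)
  then have "norm ((1 + v) ^ n - exp w) = c ^ n * norm (((1 + v) / of_real c) ^ n - (exp v / of_real c) ^ n)"
    using c by (simp only: norm_mult norm_of_real) simp
  also have "\<dots> \<le> c ^ n * (n * (exp (norm v) * norm v ^ 2))"
    using 3 c by (intro mult_left_mono) auto
  also have "\<dots> \<le> exp (norm w) * (n * (exp (norm w) * (norm w / n) ^ 2))"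
  proof -
    have "norm v \<le> norm w"
      using assms by (auto simp: v_def norm_divide divide_le_eq mult_le_cancel_left1)
    moreover have "norm v = norm w / n" by (simp add: v_def norm_divide)
    ultimately show ?thesis
      unfolding cn by (intro mult_left_mono mult_mono) auto
  qed
  also have "\<dots> = exp (2 * norm w) * norm w ^ 2 / n"
    using assms by (simp add: power2_eq_square field_simps exp_add[symmetric])
  finally show ?thesis by (simp add: v_def)
qed

lemma uniform_limit_exp_power:
  assumes S: "\<And>z. z \<in> S \<Longrightarrow> norm z \<le> R" and \<tau>: "\<tau> \<ge> 0"
  shows "uniform_limit S (\<lambda>n z. (1 + of_real (\<tau> / real n) * z :: complex) ^ n) (\<lambda>z. exp (of_real \<tau> * z)) sequentially"
proof (rule uniform_limitI)
  fix e :: real assume "e > 0"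
  define B where "B = exp (2 * (\<tau> * R)) * (\<tau> * R) ^ 2"
  have "(\<lambda>n. B / real n) \<longlonglongrightarrow> 0" by (rule lim_const_over_n)
  then have "\<forall>\<^sub>F n in sequentially. B / real n < e" using \<open>e > 0\<close> by (rule order_tendstoD(2))
  with eventually_gt_at_top[of "0::nat"]
  show "\<forall>\<^sub>F n in sequentially. \<forall>z\<in>S. dist ((1 + of_real (\<tau> / real n) * z :: complex) ^ n) (exp (of_real \<tau> * z)) < e"
  proof eventually_elim
    case (elim n)
    show ?case
    proof
      fix z assume z: "z \<in> S"
      let ?w = "of_real \<tau> * z :: complex"
      have w: "norm ?w \<le> \<tau> * R" using S[OF z] \<tau> by (auto simp: norm_mult intro: mult_left_mono)
      have "norm ((1 + ?w / of_nat n) ^ n - exp ?w) \<le> exp (2 * norm ?w) * norm ?w ^ 2 / n"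
        by (rule exp_power_bound) (use elim in simp)
      also have "\<dots> \<le> B / n" unfolding B_def
        using w by (intro divide_right_mono mult_mono power_mono) auto
      also have "\<dots> < e" using elim by simp
      finally show "dist ((1 + of_real (\<tau> / real n) * z) ^ n) (exp ?w) < e"
        by (simp add: dist_norm)
    qed
  qed
qed

text \<open>Real parts suffice: the matrices involved are real, so real parts obey the same
  recurrences, and polynomials with complex coefficients can be treated directly.\<close>

abbreviation newton_re :: "real \<Rightarrow> real list \<Rightarrow> (complex \<Rightarrow> complex) \<Rightarrow> nat \<Rightarrow> real" where
  "newton_re R X h \<equiv> (\<lambda>i. Re (newton_coeff R X h i))"

context
  fixes R :: real and X :: "real list"
  assumes R: "R > 0" "\<forall>x\<in>set X. \<bar>x\<bar> < R"
begin

lemma newton_re_linear_mult: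
  assumes "h holomorphic_on UNIV" "i < length X"
  shows "newton_re R X (\<lambda>z. (1 + of_real v * z) * h z) i =
    (1 + v * X ! i) * newton_re R X h i + (if i = 0 then 0 else v * newton_re R X h (i - 1))"
  using newton_coeff_linear_mult[OF R(2,1) assms, of 1 "of_real v"] by simp

lemma alternates_linear_mult:
  assumes "h holomorphic_on UNIV" "v \<ge> 0" "\<forall>x\<in>set X. 1 + v * x > 0"
    and "alternates (newton_re R X (\<lambda>z. (1 + of_real v * z) * h z)) (length X) m"
  shows "alternates (newton_re R X h) (length X) m"
  by (rule alternates_bidiagonal[OF assms(4) newton_re_linear_mult[OF assms(1)]]) (use assms in auto)

text \<open>Division by \<open>1 - v * z\<close> is the inverse of a bidiagonal matrix with
  nonpositive subdiagonal and creates no sign changes; read from quotient to product, alternation is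
  handed on.\<close>

lemma alternates_linear_div:
  assumes "h holomorphic_on UNIV" "v \<ge> 0" "\<forall>x\<in>set X. 1 - v * x > 0"
    and "alternates (newton_re R X h) (length X) m"
  shows "alternates (newton_re R X (\<lambda>z. (1 - of_real v * z) * h z)) (length X) m"
  by (rule alternates_inverse_bidiagonal[OF assms(4), where u = "\<lambda>i. 1 - v * X ! i" and v = v])
     (use newton_re_linear_mult[OF assms(1), of _ "- v"] assms in auto)

lemma alternates_edrei_mult:
  assumes "h holomorphic_on UNIV" "\<forall>i\<in>{1..k}. \<alpha> i \<ge> 0" "\<forall>i\<in>{1..k}. \<forall>x\<in>set X. 1 + \<alpha> i * x > 0"
    and "alternates (newton_re R X (\<lambda>z. poly (edrei_poly \<alpha> k) z * h z)) (length X) m"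
  shows "alternates (newton_re R X h) (length X) m"
  using assms
proof (induction k arbitrary: h)
  case (Suc k)
  have "alternates (newton_re R X (\<lambda>z. (1 + of_real (\<alpha> (Suc k)) * z) * h z)) (length X) m"
  proof (rule Suc.IH)
    have eq: "(\<lambda>z. poly (edrei_poly \<alpha> (Suc k)) z * h z) =
      (\<lambda>z. poly (edrei_poly \<alpha> k) z * ((1 + of_real (\<alpha> (Suc k)) * z) * h z))"
      by (simp add: edrei_poly_Suc algebra_simps fun_eq_iff)
    show "alternates (newton_re R X (\<lambda>z. poly (edrei_poly \<alpha> k) z *
            ((1 + of_real (\<alpha> (Suc k)) * z) * h z))) (length X) m"
      using Suc.prems(4) unfolding eq .
  qed (use Suc.prems in \<open>auto intro!: holomorphic_intros\<close>)
  then show ?case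
    by (rule alternates_linear_mult[rotated 3]) (use Suc.prems in auto)
qed simp

lemma alternates_edrei_div:
  assumes "h holomorphic_on UNIV" "\<forall>i\<in>{1..k}. \<beta> i \<ge> 0" "\<forall>i\<in>{1..k}. \<forall>x\<in>set X. 1 - \<beta> i * x > 0"
    and "alternates (newton_re R X h) (length X) m"
  shows "alternates (newton_re R X (\<lambda>z. poly (edrei_poly (\<lambda>i. - \<beta> i) k) z * h z)) (length X) m"
  using assms(2-)
proof (induction k)
  case (Suc k)
  have eq: "(\<lambda>z. poly (edrei_poly (\<lambda>i. - \<beta> i) (Suc k)) z * h z) =
      (\<lambda>z. (1 - of_real (\<beta> (Suc k)) * z) * (poly (edrei_poly (\<lambda>i. - \<beta> i) k) z * h z))"
      by (simp add: edrei_poly_Suc algebra_simps fun_eq_iff)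
  show ?case unfolding eq
    by (rule alternates_linear_div) (use Suc assms(1) in \<open>auto intro!: holomorphic_intros\<close>)
qed simp

lemma alternates_exp_mult:
  assumes h: "h holomorphic_on UNIV" and \<tau>: "\<tau> \<ge> 0"
    and alt: "alternates (newton_re R X (\<lambda>z. exp (of_real \<tau> * z) * h z)) (length X) m"
  shows "alternates (newton_re R X h) (length X) m"
proof -
  let ?E = "\<lambda>n z. (1 + of_real (\<tau> / real n) * z :: complex) ^ n"
  have E_hol: "(\<lambda>z. ?E n z * h z) holomorphic_on UNIV" for n
    by (intro holomorphic_intros h)
  have bdd: "bounded (h ` sphere 0 R)"
    by (intro compact_imp_bounded compact_continuous_image compact_sphere)
       (rule continuous_on_subset[OF entire_imp_continuous[OF h]], simp)
  have "uniform_limit (sphere 0 R) (\<lambda>n z. ?E n z) (\<lambda>z. exp (of_real \<tau> * z)) sequentially"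
    by (rule uniform_limit_exp_power[of _ R, OF _ \<tau>]) simp
  moreover have "bounded ((\<lambda>z::complex. exp (of_real \<tau> * z)) ` sphere 0 R)"
    by (intro compact_imp_bounded compact_continuous_image compact_sphere continuous_intros)
  ultimately have "uniform_limit (sphere 0 R) (\<lambda>n z. ?E n z * h z) (\<lambda>z. exp (of_real \<tau> * z) * h z) sequentially"
    using bdd by (intro uniform_lim_mult uniform_limit_const)
  then have lim: "(\<lambda>n. newton_re R X (\<lambda>z. ?E n z * h z) i) \<longlonglongrightarrow> newton_re R X (\<lambda>z. exp (of_real \<tau> * z) * h z) i" for i
    by (intro tendsto_Re newton_coeff_limit R E_hol holomorphic_intros h) auto
  have ev: "\<forall>\<^sub>F n in sequentially. alternates (newton_re R X (\<lambda>z. ?E n z * h z)) (length X) m"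
    by (rule alternates_limit[OF alt lim])
  \<comment> \<open>Alternation is an open condition and therefore holds for large n already; n >
    \<tau> R makes each factor 1 + \<tau> x / n positive at the nodes.\<close>
  obtain n where n: "alternates (newton_re R X (\<lambda>z. ?E n z * h z)) (length X) m" "n > 0" "real n > \<tau> * R"
  proof -
    have "\<forall>\<^sub>F n in sequentially. real n > \<tau> * R"
      using filterlim_real_sequentially by (simp add: filterlim_at_top_dense)
    then have "\<forall>\<^sub>F n in sequentially. alternates (newton_re R X (\<lambda>z. ?E n z * h z)) (length X) m
        \<and> n > 0 \<and> real n > \<tau> * R"
      using ev eventually_gt_at_top[of "0::nat"] by eventually_elim auto
    then show thesis using that by (auto simp: eventually_sequentially)
  qed
  have pos: "\<forall>x\<in>set X. 1 + \<tau> / real n * x > 0"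
  proof
    fix x assume "x \<in> set X"
    then have "\<bar>x\<bar> < R" using R by blast
    then have "\<tau> * \<bar>x\<bar> \<le> \<tau> * R" using \<tau> by (intro mult_left_mono) auto
    then have "\<tau> * (- x) < real n" using n(3) \<tau> by (smt (verit) mult_left_mono abs_ge_minus_self)
    then show "1 + \<tau> / real n * x > 0" using n(2) by (simp add: field_simps)
  qed
  have "alternates (newton_re R X h) (length X) m"
    if "alternates (newton_re R X (\<lambda>z. (1 + of_real (\<tau> / real n) * z) ^ j * h z)) (length X) m" for j
    using that
  proof (induction j)
    case (Suc j)
    have "alternates (newton_re R X (\<lambda>z. (1 + of_real (\<tau> / real n) * z) ^ j * h z)) (length X) m"
    proof (rule alternates_linear_mult)
      show "alternates (newton_re R X (\<lambda>z. (1 + of_real (\<tau> / real n) * z) *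
         ((1 + of_real (\<tau> / real n) * z) ^ j * h z))) (length X) m"
        using Suc.prems by (simp only: power_Suc mult.assoc)
    qed (use pos \<tau> in \<open>auto intro!: holomorphic_intros h\<close>)
    then show ?case by (rule Suc.IH)
  qed simp
  then show ?thesis using n(1) .
qed

text \<open>A Taylor term of order below j, times q, has degree below \<open>degree q + j\<close>
  and contributes nothing; the term of order j contributes the leading coefficient; the rest is
  O(\<epsilon> ^ (j + 1)).\<close>

lemma newton_exp_poly_expansion:
  assumes "degree q + j < length X"
  obtains C where "C \<ge> 0" "\<And>\<epsilon>. 0 \<le> \<epsilon> \<Longrightarrow> \<epsilon> \<le> 1 \<Longrightarrow>
    norm (newton_coeff R X (\<lambda>z. exp (of_real (- \<epsilon>) * z) * poly q z) (degree q + j)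
      - (- of_real \<epsilon>) ^ j / fact j * lead_coeff q) \<le> C * \<epsilon> ^ Suc j"
proof -
  let ?i = "degree q + j"
  define B where "B = exp R * R ^ Suc j / fact j"
  have "bounded (poly q ` sphere 0 R)"
    by (intro compact_imp_bounded compact_continuous_image compact_sphere continuous_intros)
  then obtain M where M: "M > 0" "\<And>z. norm z = R \<Longrightarrow> norm (poly q z) \<le> M"
    by (force simp: bounded_pos)
  define D where "D = R / (R - Max (insert 0 (abs ` set X))) ^ length (take (Suc ?i) X)"
  show thesis
  proof
    have m: "Max (insert 0 (abs ` set X)) < R" using R by (subst Max_less_iff) auto
    have D: "D \<ge> 0" unfolding D_def
      by (rule divide_nonneg_nonneg, use R in simp, rule zero_le_power, use m in linarith)
    have B: "B \<ge> 0" using R by (simp add: B_def)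
    show "B * M * D \<ge> 0" using B M D by simp
    fix \<epsilon> :: real assume \<epsilon>: "0 \<le> \<epsilon>" "\<epsilon> \<le> 1"
    let ?T = "\<lambda>z::complex. \<Sum>n\<le>j. (of_real (- \<epsilon>) * z) ^ n / fact n"
    let ?r = "\<lambda>z. (exp (of_real (- \<epsilon>) * z) - ?T z) * poly q z"
    let ?T' = "\<lambda>n z. (of_real (- \<epsilon>) ^ n / fact n) * poly (monom 1 n * q) z"
    have hol: "?T' n holomorphic_on UNIV" "(\<lambda>z. \<Sum>n\<le>j. ?T' n z) holomorphic_on UNIV" "?r holomorphic_on UNIV" for n
      by (intro holomorphic_intros; simp)+
    have eq: "(\<lambda>z. exp (of_real (- \<epsilon>) * z) * poly q z) = (\<lambda>z. (\<Sum>n\<le>j. ?T' n z) + ?r z)"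
    proof
      fix z
      have "?T z * poly q z = (\<Sum>n\<le>j. ?T' n z)"
        by (simp add: sum_distrib_right poly_monom power_mult_distrib sum_distrib_left mult_ac del: of_real_minus)
      then show "exp (of_real (- \<epsilon>) * z) * poly q z = (\<Sum>n\<le>j. ?T' n z) + ?r z"
        by (simp add: left_diff_distrib)
    qed
    have c: "newton_coeff R X (?T' n) ?i = (of_real (- \<epsilon>) ^ n / fact n) * (if n = j then lead_coeff q else 0)"
      if "n \<le> j" for n
    proof -
      have "newton_coeff R X (poly (monom 1 n * q)) ?i = coeff (monom 1 n * q) ?i"
        by (rule newton_coeff_poly[OF R(2,1) assms])
           (use degree_mult_le[of "monom 1 n" q] degree_monom_le[of "1::complex" n] that in linarith)
      also have "\<dots> = (if n = j then lead_coeff q else 0)"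
        using that by (auto simp: coeff_monom_mult coeff_eq_0)
      finally show ?thesis
        by (subst newton_coeff_cmult[OF R(2,1)]) (auto intro!: holomorphic_intros)
    qed
    have "newton_coeff R X (\<lambda>z. exp (of_real (- \<epsilon>) * z) * poly q z) ?i =
       (\<Sum>n\<le>j. newton_coeff R X (?T' n) ?i) + newton_coeff R X ?r ?i"
      unfolding eq by (subst newton_coeff_add[OF R(2,1) hol(2,3)], subst newton_coeff_sum[OF R(2,1)]) (use hol in auto)
    also have "(\<Sum>n\<le>j. newton_coeff R X (?T' n) ?i) =
       (\<Sum>n\<le>j. (of_real (- \<epsilon>) ^ n / fact n) * (if n = j then lead_coeff q else 0))"
      by (intro sum.cong refl c) simp
    also have "\<dots> = (- of_real \<epsilon>) ^ j / fact j * lead_coeff q"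
      by (simp add: if_distrib[of "\<lambda>x. _ * x"] sum.delta cong: if_cong)
    finally have "newton_coeff R X (\<lambda>z. exp (of_real (- \<epsilon>) * z) * poly q z) ?i
      - (- of_real \<epsilon>) ^ j / fact j * lead_coeff q = newton_coeff R X ?r ?i" by simp
    moreover have "norm (newton_coeff R X ?r ?i) \<le> (B * \<epsilon> ^ Suc j * M) * D" unfolding D_def
    proof (rule newton_coeff_bound[OF R(2,1) _ hol(3)])
      fix z :: complex assume z: "norm z = R"
      have "norm (exp (of_real (- \<epsilon>) * z) - ?T z) \<le> exp (norm (of_real (- \<epsilon>) * z)) * norm (of_real (- \<epsilon>) * z) ^ Suc j / fact j"
        by (rule Taylor_exp_field)
      also have "norm (of_real (- \<epsilon>) * z) = \<epsilon> * R" using z \<epsilon> by (simp add: norm_mult)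
      also have "exp (\<epsilon> * R) * (\<epsilon> * R) ^ Suc j / fact j \<le> exp R * (\<epsilon> * R) ^ Suc j / fact j"
        using \<epsilon> R by (intro divide_right_mono mult_right_mono) (auto simp: mult_le_cancel_right1)
      also have "\<dots> = B * \<epsilon> ^ Suc j" unfolding B_def by (simp add: power_mult_distrib)
      finally show "norm (?r z) \<le> B * \<epsilon> ^ Suc j * M"
        unfolding norm_mult using M(2)[OF z] B \<epsilon> by (intro mult_mono) auto
    qed (use B M \<epsilon> in auto)
    ultimately show "norm (newton_coeff R X (\<lambda>z. exp (of_real (- \<epsilon>) * z) * poly q z) ?i
        - (- of_real \<epsilon>) ^ j / fact j * lead_coeff q) \<le> B * M * D * \<epsilon> ^ Suc j"
      by (simp add: mult_ac)
  qed
qed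

text \<open>A small negative exponential turns the vanishing Newton coefficients beyond the degree
  into alternating ones.\<close>

lemma alternates_exp_poly:
  assumes "degree q + m < length X" "lead_coeff q = 1"
  obtains \<epsilon> where "0 < \<epsilon>" "\<epsilon> \<le> 1"
    "alternates (newton_re R X (\<lambda>z. exp (of_real (- \<epsilon>) * z) * poly q z)) (length X) m"
proof -
  let ?c = "\<lambda>\<epsilon> j. newton_coeff R X (\<lambda>z. exp (of_real (- \<epsilon>) * z) * poly q z) (degree q + j)"
  have "\<exists>C\<ge>0. \<forall>\<epsilon>. 0 \<le> \<epsilon> \<longrightarrow> \<epsilon> \<le> 1 \<longrightarrow> norm (?c \<epsilon> j - (- of_real \<epsilon>) ^ j / fact j) \<le> C * \<epsilon> ^ Suc j" if "j \<le> m" for j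
  proof -
    have "degree q + j < length X" using assms that by simp
    from newton_exp_poly_expansion[OF this] obtain C where "C \<ge> 0" "\<And>\<epsilon>. 0 \<le> \<epsilon> \<Longrightarrow> \<epsilon> \<le> 1 \<Longrightarrow>
      norm (?c \<epsilon> j - (- of_real \<epsilon>) ^ j / fact j * lead_coeff q) \<le> C * \<epsilon> ^ Suc j" by blast
    then show ?thesis unfolding assms(2) by (intro exI[of _ C]) simp
  qed
  then obtain C where C: "\<And>j. j \<le> m \<Longrightarrow> C j \<ge> (0::real)"
    "\<And>j \<epsilon>. j \<le> m \<Longrightarrow> 0 \<le> \<epsilon> \<Longrightarrow> \<epsilon> \<le> 1 \<Longrightarrow> norm (?c \<epsilon> j - (- of_real \<epsilon>) ^ j / fact j) \<le> C j * \<epsilon> ^ Suc j"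
    by metis
  \<comment> \<open>S exceeds each \<open>C j * fact j\<close>, so that for \<epsilon> = 1 / S the
    error \<open>C j * \<epsilon> ^ Suc j\<close> stays below the main term
    \<open>\<epsilon> ^ j / fact j\<close>.\<close>
  define S where "S = 1 + (\<Sum>j\<le>m. C j * fact j)"
  have CS: "C j * fact j < S" if "j \<le> m" for j
    using member_le_sum[of j "{..m}" "\<lambda>j. C j * fact j"] C(1) that by (force simp: S_def)
  have S1: "S \<ge> 1" using C(1) by (auto simp: S_def intro!: sum_nonneg)
  define \<epsilon> where "\<epsilon> = 1 / S"
  have \<epsilon>: "0 < \<epsilon>" "\<epsilon> \<le> 1" using S1 by (auto simp: \<epsilon>_def)
  have "1 * (-1) ^ j * Re (?c \<epsilon> j) > 0" if j: "j \<le> m" for j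
  proof -
    have eq: "(- of_real \<epsilon>) ^ j / fact j = (of_real ((- 1) ^ j * \<epsilon> ^ j / fact j) :: complex)"
      by (simp add: power_minus[of "of_real \<epsilon>"])
    have "\<bar>Re (?c \<epsilon> j) - (- 1) ^ j * \<epsilon> ^ j / fact j\<bar> \<le> norm (?c \<epsilon> j - (- of_real \<epsilon>) ^ j / fact j)"
      unfolding eq using abs_Re_le_cmod[of "?c \<epsilon> j - of_real ((- 1) ^ j * \<epsilon> ^ j / fact j)"]
      by (simp only: minus_complex.sel Re_complex_of_real)
    also have "\<dots> \<le> C j * \<epsilon> ^ Suc j" using C(2)[OF j] \<epsilon> by simp
    also have "\<dots> < \<epsilon> ^ j / fact j"
      using CS[OF j] \<epsilon>(1) S1 by (simp add: \<epsilon>_def field_simps)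
    finally have "\<bar>(-1) ^ j * (Re (?c \<epsilon> j) - (- 1) ^ j * \<epsilon> ^ j / fact j)\<bar> < \<epsilon> ^ j / fact j"
      by (simp add: abs_mult)
    moreover have "(-1) ^ j * (Re (?c \<epsilon> j) - (- 1) ^ j * \<epsilon> ^ j / fact j) = (-1) ^ j * Re (?c \<epsilon> j) - \<epsilon> ^ j / fact j"
      by (simp add: right_diff_distrib flip: power_mult_distrib)
    ultimately show ?thesis by linarith
  qed
  then have "alternates (newton_re R X (\<lambda>z. exp (of_real (- \<epsilon>) * z) * poly q z)) (length X) m"
    unfolding alternates_def
    by (intro exI[of _ "\<lambda>j. degree q + j"] exI[of _ 1]) (use assms in auto)
  with \<epsilon> that show thesis by blast
qed

end

subsection \<open>Uniqueness of rational interpolants\<close>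

text \<open>The linearised error P F - Q multiplied by the denominator B of F = A exp / B: an entire
  function with the same zeros wherever B does not vanish.\<close>

definition remainder :: "complex poly \<Rightarrow> complex poly \<Rightarrow> complex poly \<Rightarrow> complex poly \<Rightarrow> complex \<Rightarrow> complex" where
  "remainder A B P Q z = poly P z * poly A z * exp z - poly Q z * poly B z"

lemma bound_exists:
  obtains R :: real where "R > 0" "\<forall>x\<in>set X. \<bar>x\<bar> < R"
proof
  let ?R = "1 + Max (insert 0 (abs ` set X))"
  have "x < ?R" if "x \<in> insert 0 (abs ` set X)" for x
    using Max_ge[OF _ that] by simp
  then show "?R > 0" "\<forall>x\<in>set X. \<bar>x\<bar> < ?R" by auto
qed

text \<open>S lies to the right of the zeros and to the left of the poles of F. Equivalently, for
  nodes in S the bidiagonal matrices of the linear factors have positive diagonals.\<close>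

definition admissible :: "nat \<Rightarrow> nat \<Rightarrow> (nat \<Rightarrow> real) \<Rightarrow> (nat \<Rightarrow> real) \<Rightarrow> real set \<Rightarrow> bool" where
  "admissible k l \<alpha> \<beta> S \<longleftrightarrow> (\<forall>i\<in>{1..k}. \<alpha> i \<ge> 0) \<and> (\<forall>i\<in>{1..l}. \<beta> i \<ge> 0) \<and>
     (\<forall>i\<in>{1..k}. \<forall>x\<in>S. 1 + \<alpha> i * x > 0) \<and> (\<forall>i\<in>{1..l}. \<forall>x\<in>S. 1 - \<beta> i * x > 0)"

lemma admissible_subset: "admissible k l \<alpha> \<beta> S \<Longrightarrow> T \<subseteq> S \<Longrightarrow> admissible k l \<alpha> \<beta> T"
  unfolding admissible_def by blast

lemma edrei_poly_nonzero_at: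
  assumes "\<forall>i\<in>{1..k}. 1 + \<alpha> i * x > 0"
  shows "poly (edrei_poly \<alpha> k) (of_real x) \<noteq> 0"
proof -
  have "poly (edrei_poly \<alpha> k) (of_real x) = of_real (\<Prod>i=1..k. 1 + \<alpha> i * x)"
    by (simp add: poly_edrei_poly)
  also have "(\<Prod>i=1..k. 1 + \<alpha> i * x) > 0" using assms by (intro prod_pos) auto
  then have "of_real (\<Prod>i=1..k. 1 + \<alpha> i * x) \<noteq> (0 :: complex)"
    by (metis less_irrefl of_real_eq_0_iff)
  finally show ?thesis .
qed

lemma edrei_poly_nonzero [simp]: "edrei_poly \<alpha> k \<noteq> 0"
  using edrei_poly_nonzero_at[of k \<alpha> 0] by auto

text \<open>The variation-diminishing core: the Newton coefficients of \<open>P\<close> have more sign changes than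
  there are surplus nodes.\<close>

lemma remainder_alternates:
  assumes adm: "admissible k l \<alpha> \<beta> (set X)"
    and van: "vanishes X (remainder (edrei_poly \<alpha> k) (edrei_poly (\<lambda>i. - \<beta> i) l) P Q)"
    and R: "R > 0" "\<forall>x\<in>set X. \<bar>x\<bar> < R"
    and Q: "lead_coeff Q = 1" "degree Q + m < length X"
  shows "alternates (newton_re R X (poly P)) (length X) m"
proof -
  let ?A = "edrei_poly \<alpha> k" and ?B = "edrei_poly (\<lambda>i. - \<beta> i) l"
  obtain \<epsilon> where \<epsilon>: "0 < \<epsilon>" "\<epsilon> \<le> 1"
    "alternates (newton_re R X (\<lambda>z. exp (of_real (- \<epsilon>) * z) * poly Q z)) (length X) m"
    using alternates_exp_poly[OF R Q(2,1)] by blast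
  have 1: "alternates (newton_re R X (\<lambda>z. poly ?B z * (exp (of_real (- \<epsilon>) * z) * poly Q z))) (length X) m"
    by (rule alternates_edrei_div[OF R _ _ _ \<epsilon>(3)])
       (use adm in \<open>auto simp: admissible_def intro!: holomorphic_intros\<close>)
  \<comment> \<open>At the nodes P A exp equals Q B. Multiplication by exp (- \<epsilon> z) moves a
    part of the exponential to the side of Q, and \<open>?g\<close> and \<open>?h\<close> still
    agree at the nodes.\<close>
  let ?g = "\<lambda>z. exp (of_real (1 - \<epsilon>) * z) * (poly ?A z * poly P z)"
  let ?h = "\<lambda>z. poly ?B z * (exp (of_real (- \<epsilon>) * z) * poly Q z)"
  let ?d = "\<lambda>z. exp (of_real (- \<epsilon>) * z) * remainder ?A ?B P Q z"
  have "vanishes X ?d"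
    by (rule vanishes_mult[OF van]) (intro holomorphic_intros)
  then have d: "newton_coeff R X ?d i = 0" "?d holomorphic_on UNIV" if "i < length X" for i
    using newton_coeff_vanishes[OF _ R that] vanishes_entire by auto
  have gh: "?g = (\<lambda>z. ?h z + ?d z)"
  proof
    fix z :: complex
    have "exp (of_real (1 - \<epsilon>) * z) = exp (of_real (- \<epsilon>) * z) * exp z"
      by (simp add: exp_add[symmetric] algebra_simps)
    then show "?g z = ?h z + ?d z" by (simp only: remainder_def) (simp add: algebra_simps)
  qed
  have "newton_re R X ?g i = newton_re R X ?h i" if "i < length X" for i
    unfolding gh
    by (subst newton_coeff_add[OF R(2,1) _ d(2)[OF that]])
       (use d(1)[OF that] in \<open>auto intro!: holomorphic_intros\<close>)
  then have "alternates (newton_re R X ?g) (length X) m"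
    using 1 unfolding alternates_def by (metis (no_types, lifting))
  then have "alternates (newton_re R X (\<lambda>z. poly ?A z * poly P z)) (length X) m"
    by (rule alternates_exp_mult[OF R _ _ , rotated 2]) (use \<epsilon> in \<open>auto intro!: holomorphic_intros\<close>)
  then show ?thesis
    by (rule alternates_edrei_mult[OF R, rotated 3])
       (use adm in \<open>auto simp: admissible_def intro!: holomorphic_intros\<close>)
qed

lemma remainder_smult: "remainder A B (smult c P) (smult c Q) z = c * remainder A B P Q z"
  by (simp add: remainder_def algebra_simps)

lemma vanishes_remainder_smult:
  "vanishes X (remainder A B P Q) \<Longrightarrow> vanishes X (remainder A B (smult c P) (smult c Q))"
  using vanishes_cong[OF vanishes_cmult[of X _ c]] remainder_smult by metis

text \<open>If Q is nonzero, P must have p + 1 sign changes among its Newton coefficients, although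
  only the first p + 1 of them can be nonzero. If Q is zero, all nodes are zeros of P, whose degree
  is too small.\<close>

theorem remainder_unique:
  assumes adm: "admissible k l \<alpha> \<beta> (set X)"
    and van: "vanishes X (remainder (edrei_poly \<alpha> k) (edrei_poly (\<lambda>i. - \<beta> i) l) P Q)"
    and deg: "degree P \<le> p" "degree Q \<le> q" "p + q + 2 \<le> length X"
  shows "P = 0 \<and> Q = 0"
proof -
  let ?A = "edrei_poly \<alpha> k" and ?B = "edrei_poly (\<lambda>i. - \<beta> i) l"
  obtain R where R: "R > 0" "\<forall>x\<in>set X. \<bar>x\<bar> < R" by (rule bound_exists)
  have Q: "Q = 0"
  proof (rule ccontr)
    assume "Q \<noteq> 0"
    define c where "c = 1 / lead_coeff Q"
    have c: "c \<noteq> 0" "lead_coeff (smult c Q) = 1" using \<open>Q \<noteq> 0\<close> by (auto simp: c_def)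
    have "alternates (newton_re R X (poly (smult c P))) (length X) (Suc p)"
      by (rule remainder_alternates[OF adm vanishes_remainder_smult[OF van] R c(2)]) (use deg c in auto)
    moreover have "newton_re R X (poly (smult c P)) i = 0" if "i > p" "i < length X" for i
    proof -
      have "coeff P i = 0" using deg(1) that(1) by (simp add: coeff_eq_0)
      then show ?thesis using newton_coeff_poly[OF R(2,1) that(2), of "smult c P"] deg(1) that(1) c by simp
    qed
    ultimately have "Suc p \<le> p" by (rule alternates_le_support)
    then show False by simp
  qed
  have "nodal X dvd P * ?A"
  proof (rule nodal_dvd_if_vanishes)
    show "vanishes X (\<lambda>z. poly (P * ?A) z * exp z)"
      using van by (rule vanishes_cong) (simp add: remainder_def Q)
  qed (auto intro!: holomorphic_intros)
  then have "nodal X dvd P"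
  proof -
    assume "nodal X dvd P * ?A"
    then obtain G where G: "P * ?A = nodal X * G" by (auto simp: dvd_def)
    show ?thesis
    proof (rule nodal_dvd_if_vanishes)
      show "vanishes X (\<lambda>z. poly P z * poly ?A z)"
        unfolding vanishes_def
        by (rule exI[of _ "poly G"]) (use G in \<open>auto intro!: holomorphic_intros simp flip: poly_mult\<close>)
      show "poly ?A (of_real x) \<noteq> 0" if "x \<in> set X" for x
        using edrei_poly_nonzero_at adm that by (auto simp: admissible_def)
    qed (intro holomorphic_intros)
  qed
  then have "P = 0" using deg dvd_imp_degree_le[of "nodal X" P] by fastforce
  with Q show ?thesis by simp
qed

text \<open>One node less than in \<open>remainder_unique\<close> makes the sign count extremal.
  With x as first node, the zeroth Newton coefficient is the value of P at x and the p-th is the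
  leading coefficient. Since x is arbitrary, P has the same sign at all nodes.\<close>

lemma remainder_lead_sign:
  assumes adm: "admissible k l \<alpha> \<beta> (set X)"
    and van: "vanishes X (remainder (edrei_poly \<alpha> k) (edrei_poly (\<lambda>i. - \<beta> i) l) P Q)"
    and deg: "degree P \<le> p" "degree Q \<le> q" "p + q + 1 = length X" and P: "P \<noteq> 0"
    and real: "\<And>i. coeff P i \<in> \<real>" "\<And>i. coeff Q i \<in> \<real>" and x: "x \<in> set X"
  shows "(-1) ^ p * Re (poly P (of_real x)) * Re (coeff P p) > 0"
proof -
  let ?A = "edrei_poly \<alpha> k" and ?B = "edrei_poly (\<lambda>i. - \<beta> i) l"
  define Y where "Y = x # remove1 x X"
  have m: "mset Y = mset X" using x by (simp add: Y_def)
  have Y: "set Y = set X" "length Y = length X" using m mset_eq_setD mset_eq_length by blast+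
  have vanY: "vanishes Y (remainder ?A ?B P Q)" using van vanishes_mset_cong[OF m] by simp
  have admY: "admissible k l \<alpha> \<beta> (set Y)" using adm Y by simp
  obtain R where R: "R > 0" "\<forall>x\<in>set Y. \<bar>x\<bar> < R" by (rule bound_exists)
  have Q: "Q \<noteq> 0"
  proof
    assume Q: "Q = 0"
    have "nodal Y dvd P"
    proof (rule nodal_dvd_if_vanishes)
      show "vanishes Y (\<lambda>z. poly P z * (poly ?A z * exp z))"
        using vanY by (rule vanishes_cong) (simp add: remainder_def Q)
      show "poly ?A (of_real x) * exp (of_real x) \<noteq> 0" if "x \<in> set Y" for x
        using edrei_poly_nonzero_at admY that by (auto simp: admissible_def)
    qed (intro holomorphic_intros)
    then have "length Y \<le> p" using dvd_imp_degree_le[of "nodal Y" P] P deg(1) by simp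
    then show False using deg(3) Y by simp
  qed
  define c where "c = 1 / lead_coeff Q"
  have c: "c \<noteq> 0" "lead_coeff (smult c Q) = 1" "c \<in> \<real>" using Q real(2) by (auto simp: c_def)
  then obtain c' where c': "c = of_real c'" "c' \<noteq> 0" by (auto elim: Reals_cases)
  have alt: "alternates (newton_re R Y (poly (smult c P))) (length Y) p"
    by (rule remainder_alternates[OF admY vanishes_remainder_smult[OF vanY] R c(2)]) (use deg c Y in auto)
  have supp: "newton_re R Y (poly (smult c P)) i = Re (coeff (smult c P) i)" if "i \<ge> p" "i < length Y" for i
    using newton_coeff_poly[OF R(2,1) that(2), of "smult c P"] deg(1) that(1) c by simp
  have "(-1) ^ p * newton_re R Y (poly (smult c P)) 0 * newton_re R Y (poly (smult c P)) p > 0"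
  proof (rule alternates_full_support[OF alt])
    fix i assume i: "p < i" "i < length Y"
    then have "coeff P i = 0" using deg(1) by (simp add: coeff_eq_0)
    then show "newton_re R Y (poly (smult c P)) i = 0" using supp[of i] i by simp
  qed
  moreover have "newton_re R Y (poly (smult c P)) 0 = c' * Re (poly P (of_real x))"
    using newton_coeff_0[OF R(2,1), of "poly (smult c P)"] by (simp add: Y_def c' holomorphic_intros)
  moreover have "newton_re R Y (poly (smult c P)) p = c' * Re (coeff P p)"
    using supp[of p] deg(3) Y by (simp add: c')
  ultimately have "c' ^ 2 * ((-1) ^ p * Re (poly P (of_real x)) * Re (coeff P p)) > 0"
    by (simp add: power2_eq_square mult_ac)
  then show ?thesis using zero_le_power2[of c'] by (metis zero_less_mult_iff not_less)
qed

section \<open>Real interpolants: existence, exact degrees, proportionality\<close>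

definition conj_symmetric :: "(complex \<Rightarrow> complex) \<Rightarrow> bool" where
  "conj_symmetric h \<longleftrightarrow> (\<forall>z. h (cnj z) = cnj (h z))"

lemma conj_symmetric_real: "conj_symmetric h \<Longrightarrow> Im (h (of_real x)) = 0"
proof -
  assume "conj_symmetric h"
  then have "h (cnj (of_real x)) = cnj (h (of_real x))" unfolding conj_symmetric_def by blast
  then show ?thesis by (simp add: complex_eq_iff)
qed

lemma continuous_cancel_nodal:
  assumes "continuous_on UNIV f" "continuous_on UNIV g"
    and "\<And>z. poly (nodal X) z * f z = poly (nodal X) z * g z"
  shows "f = g"
  using assms(3)
proof (induction X)
  case (Cons x X)
  have "(\<lambda>z. poly (nodal X) z * f z) = (\<lambda>z. poly (nodal X) z * g z)"
  proof (rule continuous_cancel_linear)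
    fix z assume "z \<noteq> complex_of_real x"
    then show "poly (nodal X) z * f z = poly (nodal X) z * g z"
      using Cons.prems[of z] by (simp add: poly_nodal_Cons mult.assoc)
  qed (intro continuous_intros assms)+
  then show ?case using Cons.IH by meson
qed (auto simp: fun_eq_iff)

lemma cnj_poly_nodal: "cnj (poly (nodal X) z) = poly (nodal X) (cnj z)"
  by (induction X) (auto simp: poly_nodal_Cons)

text \<open>The function z to cnj (g (cnj z)) is a second cofactor of h, and cancelling the nodal
  polynomial requires only continuity, which conjugation clearly preserves.\<close>

lemma conj_symmetric_cofactor:
  assumes h: "conj_symmetric h" and eq: "\<And>z. h z = poly (nodal X) z * g z" and g: "g holomorphic_on UNIV"
  shows "conj_symmetric g"
proof -
  have cont: "continuous_on UNIV g" using g by (rule entire_imp_continuous)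
  have "(\<lambda>z. cnj (g (cnj z))) = g"
  proof (rule continuous_cancel_nodal)
    show "continuous_on UNIV (\<lambda>z. cnj (g (cnj z)))"
      by (intro continuous_on_cnj continuous_on_compose2[OF cont] continuous_on_id) auto
    fix z
    have "poly (nodal X) z * cnj (g (cnj z)) = cnj (h (cnj z))"
      by (simp add: eq cnj_poly_nodal)
    also have "\<dots> = h z" using h by (simp add: conj_symmetric_def)
    finally show "poly (nodal X) z * cnj (g (cnj z)) = poly (nodal X) z * g z" by (simp add: eq)
  qed (rule cont)
  then show ?thesis unfolding conj_symmetric_def by (metis complex_cnj_cnj)
qed

lemma conj_symmetric_poly: "(\<And>i. coeff p i \<in> \<real>) \<Longrightarrow> conj_symmetric (poly p)"
  by (simp add: conj_symmetric_def poly_cnj_real)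

text \<open>Gaussian elimination, one node at a time: a member that is nonzero at x serves as pivot
  to make the others vanish at x, and division by z - x leaves entire functions for the remaining
  nodes. Dividing treats repeated nodes like simple ones.\<close>

lemma exists_vanishing_combination:
  fixes h :: "'i \<Rightarrow> complex \<Rightarrow> complex"
  assumes "finite I" "card I > length X"
    and "\<And>i. i \<in> I \<Longrightarrow> h i holomorphic_on UNIV" "\<And>i. i \<in> I \<Longrightarrow> conj_symmetric (h i)"
  shows "\<exists>c :: 'i \<Rightarrow> real. (\<exists>i\<in>I. c i \<noteq> 0) \<and> vanishes X (\<lambda>z. \<Sum>i\<in>I. of_real (c i) * h i z)"
  using assms
proof (induction X arbitrary: I h)
  case Nil
  then have "I \<noteq> {}" by auto
  with Nil show ?case
    by (intro exI[of _ "\<lambda>_. 1"]) (auto intro!: holomorphic_intros)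
next
  case (Cons x X)
  let ?x = "complex_of_real x"
  have quot: "\<exists>k. k holomorphic_on UNIV \<and> conj_symmetric k \<and> (\<forall>z. g z = (z - ?x) * k z)"
    if g: "g holomorphic_on UNIV" "conj_symmetric g" "g ?x = 0" for g
  proof -
    obtain k where k: "k holomorphic_on UNIV" "\<And>z. g z = (z - ?x) * k z"
      using entire_factor[OF g(1,3)] by metis
    have "conj_symmetric k"
      by (rule conj_symmetric_cofactor[OF g(2) _ k(1), of "[x]"]) (simp add: k(2) poly_nodal_Cons)
    with k show ?thesis by blast
  qed
  show ?case
  proof (cases "\<forall>i\<in>I. h i ?x = 0")
    case True
    then have "\<forall>i\<in>I. \<exists>k. k holomorphic_on UNIV \<and> conj_symmetric k \<and> (\<forall>z. h i z = (z - ?x) * k z)"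
      using quot Cons.prems(3,4) by blast
    then obtain k where k: "\<And>i. i \<in> I \<Longrightarrow> k i holomorphic_on UNIV" "\<And>i. i \<in> I \<Longrightarrow> conj_symmetric (k i)"
      "\<And>i z. i \<in> I \<Longrightarrow> h i z = (z - ?x) * k i z"
      by metis
    have "\<exists>c :: 'i \<Rightarrow> real. (\<exists>i\<in>I. c i \<noteq> 0) \<and> vanishes X (\<lambda>z. \<Sum>i\<in>I. of_real (c i) * k i z)"
      using Cons.prems k by (intro Cons.IH) auto
    then obtain c :: "'i \<Rightarrow> real" where c: "\<exists>i\<in>I. c i \<noteq> 0" "vanishes X (\<lambda>z. \<Sum>i\<in>I. of_real (c i) * k i z)"
      by blast
    have "vanishes (x # X) (\<lambda>z. \<Sum>i\<in>I. of_real (c i) * h i z)"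
      unfolding vanishes_Cons
    proof (intro exI[of _ "\<lambda>z. \<Sum>i\<in>I. of_real (c i) * k i z"] conjI allI c(2))
      fix z
      have "(\<Sum>i\<in>I. of_real (c i) * h i z) = (\<Sum>i\<in>I. of_real (c i) * ((z - ?x) * k i z))"
        by (intro sum.cong refl) (simp only: k(3))
      then show "(\<Sum>i\<in>I. of_real (c i) * h i z) = (z - ?x) * (\<Sum>i\<in>I. of_real (c i) * k i z)"
        by (simp add: sum_distrib_left mult_ac)
    qed
    with c show ?thesis by blast
  next
    case False
    then obtain j where j: "j \<in> I" "h j ?x \<noteq> 0" by blast
    define \<rho> where "\<rho> i = Re (h i ?x) / Re (h j ?x)" for i
    have re: "h i ?x = of_real (Re (h i ?x))" if "i \<in> I" for i
      using conj_symmetric_real[OF Cons.prems(4)[OF that]] by (simp add: complex_eq_iff)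
    have \<rho>: "of_real (\<rho> i) * h j ?x = h i ?x" if "i \<in> I" for i
    proof -
      have "Re (h j ?x) \<noteq> 0" using re[OF j(1)] j(2) by force
      then have "\<rho> i * Re (h j ?x) = Re (h i ?x)" by (simp add: \<rho>_def)
      then show ?thesis using re[OF that] re[OF j(1)] by (metis of_real_mult)
    qed
    let ?J = "I - {j}" and ?g = "\<lambda>i z. h i z - of_real (\<rho> i) * h j z"
    have "\<forall>i\<in>?J. \<exists>k. k holomorphic_on UNIV \<and> conj_symmetric k \<and> (\<forall>z. ?g i z = (z - ?x) * k z)"
    proof
      fix i assume i: "i \<in> ?J"
      show "\<exists>k. k holomorphic_on UNIV \<and> conj_symmetric k \<and> (\<forall>z. ?g i z = (z - ?x) * k z)"
      proof (rule quot)
        show "?g i holomorphic_on UNIV" using i j Cons.prems(3) by (intro holomorphic_intros) auto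
        show "conj_symmetric (?g i)" using Cons.prems(4)[of i] Cons.prems(4)[of j] i j by (simp add: conj_symmetric_def)
        show "?g i ?x = 0" using \<rho>[of i] i by simp
      qed
    qed
    then obtain k where k: "\<And>i. i \<in> ?J \<Longrightarrow> k i holomorphic_on UNIV" "\<And>i. i \<in> ?J \<Longrightarrow> conj_symmetric (k i)"
      "\<And>i z. i \<in> ?J \<Longrightarrow> ?g i z = (z - ?x) * k i z" by metis
    have "\<exists>c :: 'i \<Rightarrow> real. (\<exists>i\<in>?J. c i \<noteq> 0) \<and> vanishes X (\<lambda>z. \<Sum>i\<in>?J. of_real (c i) * k i z)"
      using Cons.prems k j by (intro Cons.IH) auto
    then obtain c :: "'i \<Rightarrow> real" where c: "\<exists>i\<in>?J. c i \<noteq> 0" "vanishes X (\<lambda>z. \<Sum>i\<in>?J. of_real (c i) * k i z)"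
      by blast
    define d where "d i = (if i = j then - (\<Sum>i\<in>?J. c i * \<rho> i) else c i)" for i
    have "(\<Sum>i\<in>I. of_real (d i) * h i z) = (z - ?x) * (\<Sum>i\<in>?J. of_real (c i) * k i z)" for z
    proof -
      have "(\<Sum>i\<in>I. of_real (d i) * h i z) = of_real (d j) * h j z + (\<Sum>i\<in>?J. of_real (d i) * h i z)"
        using Cons.prems(1) j(1) by (rule sum.remove)
      also have "(\<Sum>i\<in>?J. of_real (d i) * h i z) = (\<Sum>i\<in>?J. of_real (c i) * h i z)"
        by (rule sum.cong) (auto simp: d_def)
      also have "of_real (d j) * h j z + \<dots> = (\<Sum>i\<in>?J. of_real (c i) * ?g i z)"
        by (simp add: d_def sum_distrib_right right_diff_distrib sum_subtractf sum_distrib_left mult_ac)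
      also have "\<dots> = (\<Sum>i\<in>?J. of_real (c i) * ((z - ?x) * k i z))"
        by (intro sum.cong refl) (simp only: k(3))
      also have "\<dots> = (z - ?x) * (\<Sum>i\<in>?J. of_real (c i) * k i z)"
        by (simp add: sum_distrib_left mult_ac)
      finally show ?thesis .
    qed
    then have "vanishes (x # X) (\<lambda>z. \<Sum>i\<in>I. of_real (d i) * h i z)"
      unfolding vanishes_Cons using c(2) by blast
    moreover have "\<exists>i\<in>I. d i \<noteq> 0" using c(1) by (auto simp: d_def)
    ultimately show ?thesis by blast
  qed
qed

text \<open>The linear condition costs one more member of the family: it is eliminated first, with a
  pivot where \<phi> is nonzero.\<close>

lemma exists_vanishing_combination_orthogonal:
  fixes h :: "'i \<Rightarrow> complex \<Rightarrow> complex" and \<phi> :: "'i \<Rightarrow> real"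
  assumes "finite I" "card I > Suc (length X)"
    and "\<And>i. i \<in> I \<Longrightarrow> h i holomorphic_on UNIV" "\<And>i. i \<in> I \<Longrightarrow> conj_symmetric (h i)"
  shows "\<exists>c :: 'i \<Rightarrow> real. (\<exists>i\<in>I. c i \<noteq> 0) \<and> (\<Sum>i\<in>I. \<phi> i * c i) = 0
     \<and> vanishes X (\<lambda>z. \<Sum>i\<in>I. of_real (c i) * h i z)"
proof (cases "\<forall>i\<in>I. \<phi> i = 0")
  case True
  then show ?thesis using exists_vanishing_combination[OF assms(1) _ assms(3,4), of X] assms(2) by auto
next
  case False
  then obtain j where j: "j \<in> I" "\<phi> j \<noteq> 0" by blast
  define \<rho> where "\<rho> i = \<phi> i / \<phi> j" for i
  let ?J = "I - {j}" and ?g = "\<lambda>i z. h i z - of_real (\<rho> i) * h j z"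
  have "\<exists>c :: 'i \<Rightarrow> real. (\<exists>i\<in>?J. c i \<noteq> 0) \<and> vanishes X (\<lambda>z. \<Sum>i\<in>?J. of_real (c i) * ?g i z)"
  proof (rule exists_vanishing_combination)
    show "length X < card ?J" using assms(1,2) j by simp
    fix i assume i: "i \<in> ?J"
    show "?g i holomorphic_on UNIV" using i j assms(3) by (intro holomorphic_intros) auto
    show "conj_symmetric (?g i)" using assms(4)[of i] assms(4)[of j] i j by (simp add: conj_symmetric_def)
  qed (use assms in auto)
  then obtain c :: "'i \<Rightarrow> real" where c: "\<exists>i\<in>?J. c i \<noteq> 0" "vanishes X (\<lambda>z. \<Sum>i\<in>?J. of_real (c i) * ?g i z)"
    by blast
  define d where "d i = (if i = j then - (\<Sum>i\<in>?J. c i * \<rho> i) else c i)" for i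
  have eq: "(\<Sum>i\<in>I. of_real (d i) * h i z) = (\<Sum>i\<in>?J. of_real (c i) * ?g i z)" for z
  proof -
    have "(\<Sum>i\<in>I. of_real (d i) * h i z) = of_real (d j) * h j z + (\<Sum>i\<in>?J. of_real (d i) * h i z)"
      using assms(1) j(1) by (rule sum.remove)
    also have "(\<Sum>i\<in>?J. of_real (d i) * h i z) = (\<Sum>i\<in>?J. of_real (c i) * h i z)"
      by (rule sum.cong) (auto simp: d_def)
    also have "of_real (d j) * h j z + \<dots> = (\<Sum>i\<in>?J. of_real (c i) * ?g i z)"
      by (simp add: d_def sum_distrib_right right_diff_distrib sum_subtractf sum_distrib_left mult_ac)
    finally show ?thesis .
  qed
  have "(\<Sum>i\<in>I. \<phi> i * d i) = \<phi> j * d j + (\<Sum>i\<in>?J. \<phi> i * d i)"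
    using assms(1) j(1) by (rule sum.remove)
  also have "(\<Sum>i\<in>?J. \<phi> i * d i) = (\<Sum>i\<in>?J. \<phi> i * c i)"
    by (rule sum.cong) (auto simp: d_def)
  also have "\<phi> j * d j + \<dots> = 0"
    using j(2) by (simp add: d_def \<rho>_def sum_distrib_left sum_negf mult_ac)
  finally have "(\<Sum>i\<in>I. \<phi> i * d i) = 0" .
  moreover have "\<exists>i\<in>I. d i \<noteq> 0" using c(1) by (auto simp: d_def)
  ultimately show ?thesis using c(2) eq by (intro exI[of _ d]) auto
qed

lemma exp_symmetric: "conj_symmetric exp"
  by (simp add: conj_symmetric_def exp_cnj)

lemma edrei_poly_real: "coeff (edrei_poly \<alpha> k) i \<in> \<real>"
proof (induction k arbitrary: i)
  case (Suc k)
  then show ?case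
    by (auto simp: edrei_poly_Suc coeff_pCons mult.commute[of "edrei_poly \<alpha> k"] split: nat.splits)
qed (auto simp: coeff_1)

lemma interpolant_exists:
  assumes A: "\<And>i. coeff A i \<in> \<real>" and B: "\<And>i. coeff B i \<in> \<real>" and len: "length X \<le> dp + dq + 1"
  obtains p q where "\<And>i. coeff p i \<in> \<real>" "\<And>i. coeff q i \<in> \<real>" "degree p \<le> dp" "degree q \<le> dq"
    "p \<noteq> 0 \<or> q \<noteq> 0" "vanishes X (remainder A B p q)"
proof -
  let ?m = "\<lambda>i::nat. monom (1::complex) i"
  \<comment> \<open>The monomials of P come first, those of Q follow with offset
    \<open>dp + 1\<close>; together they outnumber the nodes.\<close>
  define h where "h i = (if i \<le> dp then (\<lambda>z. poly (?m i * A) z * exp z)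
    else (\<lambda>z. - poly (?m (i - dp - 1) * B) z))" for i
  have real: "coeff (?m i * A) j \<in> \<real>" "coeff (?m i * B) j \<in> \<real>" for i j
    using A B by (auto simp: coeff_monom_mult)
  have "\<exists>c :: nat \<Rightarrow> real. (\<exists>i\<in>{..dp+dq+1}. c i \<noteq> 0) \<and> vanishes X (\<lambda>z. \<Sum>i\<in>{..dp+dq+1}. of_real (c i) * h i z)"
  proof (rule exists_vanishing_combination)
    fix i
    show "h i holomorphic_on UNIV" unfolding h_def by (auto intro!: holomorphic_intros)
    show "conj_symmetric (h i)"
      using conj_symmetric_poly[of "?m i * A"] conj_symmetric_poly[of "?m (i - dp - 1) * B"] real exp_symmetric
      by (simp add: h_def conj_symmetric_def)
  qed (use len in auto)
  then obtain c :: "nat \<Rightarrow> real" where c: "\<exists>i\<in>{..dp+dq+1}. c i \<noteq> 0"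
    "vanishes X (\<lambda>z. \<Sum>i\<in>{..dp+dq+1}. of_real (c i) * h i z)" by blast
  define p where "p = (\<Sum>i\<le>dp. monom (of_real (c i) :: complex) i)"
  define q where "q = (\<Sum>i\<le>dq. monom (of_real (c (i + dp + 1)) :: complex) i)"
  have cp: "coeff p i = (if i \<le> dp then of_real (c i) else 0)" for i
    by (simp add: p_def coeff_sum)
  have cq: "coeff q i = (if i \<le> dq then of_real (c (i + dp + 1)) else 0)" for i
    by (simp add: q_def coeff_sum)
  have split: "{..dp+dq+1} = {..dp} \<union> (\<lambda>i. i + dp + 1) ` {..dq}"
  proof (intro equalityI subsetI)
    fix i assume i: "i \<in> {..dp+dq+1}"
    show "i \<in> {..dp} \<union> (\<lambda>i. i + dp + 1) ` {..dq}"
    proof (cases "i \<le> dp")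
      case False
      then have "i = (i - dp - 1) + dp + 1" "i - dp - 1 \<le> dq" using i by auto
      then show ?thesis by blast
    qed simp
  qed auto
  have sum: "(\<Sum>i\<in>{..dp+dq+1}. of_real (c i) * h i z) = remainder A B p q z" for z
  proof -
    have "(\<Sum>i\<in>{..dp+dq+1}. of_real (c i) * h i z) = (\<Sum>i\<le>dp. of_real (c i) * h i z) + (\<Sum>i\<in>(\<lambda>i. i + dp + 1) ` {..dq}. of_real (c i) * h i z)"
      unfolding split by (rule sum.union_disjoint) auto
    also have "(\<Sum>i\<le>dp. of_real (c i) * h i z) = poly p z * poly A z * exp z"
      by (simp add: p_def poly_sum poly_monom h_def sum_distrib_right sum_distrib_left mult_ac)
    also have "(\<Sum>i\<in>(\<lambda>i. i + dp + 1) ` {..dq}. of_real (c i) * h i z) = - (poly q z * poly B z)"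
      by (subst sum.reindex) (auto simp: inj_on_def q_def poly_sum poly_monom h_def sum_distrib_right sum_distrib_left sum_negf mult_ac)
    finally show ?thesis by (simp add: remainder_def)
  qed
  show thesis
  proof
    show "coeff p i \<in> \<real>" "coeff q i \<in> \<real>" for i by (auto simp: cp cq)
    show "degree p \<le> dp" "degree q \<le> dq" by (auto intro!: degree_le simp: cp cq)
    show "vanishes X (remainder A B p q)" by (rule vanishes_cong[OF c(2) sum])
    show "p \<noteq> 0 \<or> q \<noteq> 0"
    proof -
      obtain i where i: "i \<in> {..dp+dq+1}" "c i \<noteq> 0" using c(1) by blast
      then consider "i \<le> dp" | j where "j \<le> dq" "i = j + dp + 1" unfolding split by auto
      then show ?thesis
      proof cases
        case 1
        then have "coeff p i \<noteq> 0" using i cp by simp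
        then show ?thesis by auto
      next
        case 2
        then have "coeff q j \<noteq> 0" using i cq by simp
        then show ?thesis by auto
      qed
    qed
  qed
qed

lemma remainder_diff: "remainder A B (P - P') (Q - Q') z = remainder A B P Q z - remainder A B P' Q' z"
  by (simp add: remainder_def algebra_simps)

text \<open>If either degree dropped, p + q + 1 nodes would be too many for a nonzero pair.
  Positivity of p and q makes the truncated \<open>p - 1\<close> and \<open>q - 1\<close> a genuine
  drop.\<close>

lemma interpolant_degree_exact:
  assumes adm: "admissible k l \<alpha> \<beta> (set X)"
    and van: "vanishes X (remainder (edrei_poly \<alpha> k) (edrei_poly (\<lambda>i. - \<beta> i) l) P Q)"
    and deg: "degree P \<le> p" "degree Q \<le> q" "p + q + 1 \<le> length X" and nz: "P \<noteq> 0 \<or> Q \<noteq> 0"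
    and pos: "p \<ge> 1" "q \<ge> 1"
  shows "coeff P p \<noteq> 0" "coeff Q q \<noteq> 0" "degree P = p" "degree Q = q"
proof -
  have small: "degree R \<le> r - 1" if "degree R \<le> r" "coeff R r = 0" for R :: "complex poly" and r
  proof (rule degree_le, intro allI impI)
    fix i assume "i > r - 1"
    then show "coeff R i = 0" using that by (cases "i = r") (auto simp: coeff_eq_0)
  qed
  show P: "coeff P p \<noteq> 0"
  proof
    assume "coeff P p = 0"
    from remainder_unique[OF adm van small[OF deg(1) this] deg(2)] deg(3) nz pos show False by auto
  qed
  show Q: "coeff Q q \<noteq> 0"
  proof
    assume "coeff Q q = 0"
    from remainder_unique[OF adm van deg(1) small[OF deg(2) this]] deg(3) nz pos show False by auto
  qed
  show "degree P = p" "degree Q = q"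
    using P Q deg by (auto intro!: antisym intro: le_degree)
qed

text \<open>The multiple s cancels the leading coefficients of the first components; the difference
  has deficient degree and must vanish.\<close>

lemma interpolant_proportional:
  assumes adm: "admissible k l \<alpha> \<beta> (set X)"
    and van: "vanishes X (remainder (edrei_poly \<alpha> k) (edrei_poly (\<lambda>i. - \<beta> i) l) P Q)"
      "vanishes X (remainder (edrei_poly \<alpha> k) (edrei_poly (\<lambda>i. - \<beta> i) l) P' Q')"
    and deg: "degree P \<le> p" "degree Q \<le> q" "degree P' \<le> p" "degree Q' \<le> q" "p + q + 1 \<le> length X"
    and nz: "P \<noteq> 0 \<or> Q \<noteq> 0" and pos: "p \<ge> 1" "q \<ge> 1"
  obtains s where "P' = smult s P" "Q' = smult s Q"
proof -
  note ex = interpolant_degree_exact[OF adm van(1) deg(1,2,5) nz pos]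
  define s where "s = coeff P' p / coeff P p"
  have van': "vanishes X (remainder (edrei_poly \<alpha> k) (edrei_poly (\<lambda>i. - \<beta> i) l) (P' - smult s P) (Q' - smult s Q))"
    by (rule vanishes_cong[OF vanishes_diff[OF van(2) vanishes_remainder_smult[OF van(1)]]])
       (simp add: remainder_diff)
  have "coeff (P' - smult s P) p = 0" using ex by (simp add: s_def)
  moreover have "degree (P' - smult s P) \<le> p" "degree (Q' - smult s Q) \<le> q"
    using deg by (auto intro!: degree_diff_le degree_smult_le[THEN order_trans])
  ultimately have "P' - smult s P = 0 \<and> Q' - smult s Q = 0"
    using interpolant_degree_exact(1)[OF adm van' _ _ deg(5) _ pos] by blast
  then show thesis using that[of s] by auto
qed

subsection \<open>Interpolants of the exponential function\<close>

text \<open>Here \<open>f j\<close> is meant to be the \<open>j\<close>-th derivative of \<open>f 0\<close>.\<close>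

definition mzeros :: "(nat \<Rightarrow> real \<Rightarrow> real) \<Rightarrow> real list \<Rightarrow> bool" where
  "mzeros f X \<longleftrightarrow> (\<forall>y. \<forall>j<count_list X y. f j y = 0)"

text \<open>Equal neighbours lose one multiplicity and distinct neighbours produce a simple zero
  strictly between them, so exactly one entry is lost altogether. The second alternative in the
  count is for these new points.\<close>

lemma rolle_list:
  assumes der: "\<forall>j x. (f j has_real_derivative f (Suc j) x) (at x)"
    and "sorted (x # X)" "mzeros f (x # X)"
  shows "\<exists>X'. length X' = length X \<and> sorted X' \<and> (\<forall>y\<in>set X'. x \<le> y \<and> y \<le> last (x # X)) \<and>
    (\<forall>y. count_list X' y \<le> count_list (x # X) y - 1 \<or> (y \<notin> set (x # X) \<and> count_list X' y \<le> 1 \<and> f 1 y = 0))"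
  using assms(2,3)
proof (induction X arbitrary: x)
  case Nil
  then show ?case by auto
next
  case (Cons y ys)
  have "mzeros f (y # ys)"
    using Cons.prems(2) unfolding mzeros_def by (metis count_list.simps(2) less_SucI add.commute plus_1_eq_Suc)
  then obtain X' where X': "length X' = length ys" "sorted X'" "\<forall>u\<in>set X'. y \<le> u \<and> u \<le> last (y # ys)"
    "\<forall>u. count_list X' u \<le> count_list (y # ys) u - 1 \<or> (u \<notin> set (y # ys) \<and> count_list X' u \<le> 1 \<and> f 1 u = 0)"
    using Cons.IH[of y] Cons.prems(1) by auto
  have yl: "y \<le> last (y # ys)" using Cons.prems(1) by (cases ys) auto
  show ?case
  proof (cases "x = y")
    case True
    show ?thesis
    proof (intro exI[of _ "x # X'"] conjI allI)
      fix u
      show "count_list (x # X') u \<le> count_list (x # y # ys) u - 1 \<or>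
        (u \<notin> set (x # y # ys) \<and> count_list (x # X') u \<le> 1 \<and> f 1 u = 0)"
        using X'(4)[rule_format, of u] True by auto
    qed (use X' True yl in auto)
  next
    case False
    then have xy: "x < y" using Cons.prems(1) by auto
    have z: "f 0 x = 0" "f 0 y = 0" using Cons.prems(2) by (auto simp: mzeros_def)
    have "\<exists>\<xi>. x < \<xi> \<and> \<xi> < y \<and> f 1 \<xi> = 0"
    proof -
      have "continuous_on {x..y} (f 0)"
        using der by (meson DERIV_isCont continuous_at_imp_continuous_on)
      moreover have "\<And>u. f 0 differentiable (at u)" using der by (auto simp: real_differentiable_def)
      ultimately obtain \<xi> where "x < \<xi>" "\<xi> < y" "(f 0 has_real_derivative 0) (at \<xi>)"
        using Rolle[of x y "f 0"] xy z by auto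
      moreover have "(f 0 has_real_derivative f 1 \<xi>) (at \<xi>)" using der by simp
      ultimately show ?thesis using DERIV_unique by blast
    qed
    then obtain \<xi> where \<xi>: "x < \<xi>" "\<xi> < y" "f 1 \<xi> = 0" by blast
    have nin: "\<xi> \<notin> set X'" "x \<notin> set X'" "\<xi> \<notin> set (x # y # ys)"
      using X'(3) \<xi> Cons.prems(1) by force+
    show ?thesis
    proof (intro exI[of _ "\<xi> # X'"] conjI allI)
      fix u
      show "count_list (\<xi> # X') u \<le> count_list (x # y # ys) u - 1 \<or>
        (u \<notin> set (x # y # ys) \<and> count_list (\<xi> # X') u \<le> 1 \<and> f 1 u = 0)"
      proof (cases "u = \<xi> \<or> u = x")
        case True
        then show ?thesis using nin \<xi> by (auto simp: count_list_0_iff)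
      next
        case False
        then show ?thesis using X'(4)[rule_format, of u] by auto
      qed
    qed (use X' \<xi> yl in force)+
  qed
qed

lemma rolle_mzeros:
  assumes der: "\<forall>j x. (f j has_real_derivative f (Suc j) x) (at x)"
    and "sorted X" "mzeros f X" "set X \<subseteq> {a..b}" "m \<le> length X"
  shows "\<exists>X'. length X' = length X - m \<and> sorted X' \<and> set X' \<subseteq> {a..b} \<and> mzeros (\<lambda>j. f (m + j)) X'"
  using assms(5)
proof (induction m)
  case 0
  then show ?case using assms by auto
next
  case (Suc m)
  then obtain X' where X': "length X' = length X - m" "sorted X'" "set X' \<subseteq> {a..b}" "mzeros (\<lambda>j. f (m + j)) X'"
    by auto
  then obtain x Y where xY: "X' = x # Y" using Suc.prems by (cases X') auto
  have "\<exists>X''. length X'' = length Y \<and> sorted X'' \<and> (\<forall>y\<in>set X''. x \<le> y \<and> y \<le> last (x # Y)) \<and>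
    (\<forall>y. count_list X'' y \<le> count_list (x # Y) y - 1 \<or> (y \<notin> set (x # Y) \<and> count_list X'' y \<le> 1 \<and> f (m + 1) y = 0))"
    using rolle_list[of "\<lambda>j. f (m + j)" x Y] der X' xY by auto
  then obtain X'' where X'': "length X'' = length Y" "sorted X''" "\<forall>y\<in>set X''. x \<le> y \<and> y \<le> last (x # Y)"
    "\<forall>y. count_list X'' y \<le> count_list (x # Y) y - 1 \<or> (y \<notin> set (x # Y) \<and> count_list X'' y \<le> 1 \<and> f (m + 1) y = 0)"
    by blast
  have "last (x # Y) \<in> set (x # Y)" by (rule last_in_set) simp
  then have "x \<ge> a" "last (x # Y) \<le> b" using X'(3) xY by auto
  then have "set X'' \<subseteq> {a..b}" using X''(3) by force
  moreover have "mzeros (\<lambda>j. f (Suc m + j)) X''"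
    unfolding mzeros_def
  proof (intro allI impI)
    fix y j assume j: "j < count_list X'' y"
    from X''(4)[rule_format, of y] show "f (Suc m + j) y = 0"
    proof
      assume "count_list X'' y \<le> count_list (x # Y) y - 1"
      then have "Suc j < count_list X' y" using j unfolding xY by linarith
      then have "f (m + Suc j) y = 0" using X'(4) unfolding mzeros_def by blast
      then show ?thesis by simp
    next
      assume "y \<notin> set (x # Y) \<and> count_list X'' y \<le> 1 \<and> f (m + 1) y = 0"
      then have "j = 0" "f (m + 1) y = 0" using j by linarith+
      then show ?thesis by simp
    qed
  qed
  ultimately show ?case using X'' X'(1) xY by (intro exI[of _ X'']) auto
qed

section \<open>The operator 1 + D and its inverse\<close>

text \<open>Differentiating P exp amounts to applying 1 + D to P.\<close>

definition pderiv1 :: "complex poly \<Rightarrow> complex poly" where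
  "pderiv1 p = p + pderiv p"

lemma pderiv1_funpow_linear:
  "(pderiv1 ^^ j) ([:- y, 1:] * s) = [:- y, 1:] * (pderiv1 ^^ j) s + smult (of_nat j) ((pderiv1 ^^ (j - 1)) s)"
proof (induction j)
  case (Suc j)
  have "pderiv1 ([:- y, 1:] * t) = [:- y, 1:] * pderiv1 t + t" for t
    unfolding pderiv1_def pderiv_mult by (simp add: pderiv_pCons smult_add_right algebra_simps)
  moreover have "pderiv1 (t + smult c u) = pderiv1 t + smult c (pderiv1 u)" for t u c
    by (simp add: pderiv1_def pderiv_add pderiv_smult smult_add_right)
  moreover have "smult (of_nat j) (pderiv1 ((pderiv1 ^^ (j - 1)) s)) = smult (of_nat j) ((pderiv1 ^^ j) s)"
    by (cases j) simp_all
  moreover have "(pderiv1 ^^ Suc j) ([:- y, 1:] * s) =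
      pderiv1 ([:- y, 1:] * (pderiv1 ^^ j) s + smult (of_nat j) ((pderiv1 ^^ (j - 1)) s))"
    by (simp only: funpow.simps comp_apply Suc.IH)
  ultimately show ?case
    by (simp only: funpow.simps comp_apply of_nat_Suc smult_add_left smult_1_left diff_Suc_1 add.assoc)
qed simp

text \<open>The zeros come from derivatives of r exp, hence powers of 1 + D in place of D. By the
  Leibniz rule for a linear factor, the conditions on r turn into those on the quotient.\<close>

lemma nodal_dvd_if_pderiv1_zeros:
  assumes "\<forall>y. \<forall>j<count_list X y. poly ((pderiv1 ^^ j) r) (of_real y) = 0"
  shows "nodal X dvd r"
  using assms
proof (induction X arbitrary: r)
  case (Cons x X)
  have "poly r (of_real x) = 0" using Cons.prems[rule_format, of 0 x] by simp
  then obtain s where s: "r = [:- of_real x, 1:] * s" by (metis dvdE poly_eq_0_iff_dvd)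
  have ev: "poly ((pderiv1 ^^ j) r) z = (z - of_real x) * poly ((pderiv1 ^^ j) s) z
      + of_nat j * poly ((pderiv1 ^^ (j - 1)) s) z" for j z
    unfolding s pderiv1_funpow_linear by (simp add: algebra_simps)
  have "\<forall>y. \<forall>j<count_list X y. poly ((pderiv1 ^^ j) s) (of_real y) = 0"
  proof (intro allI impI)
    fix y j assume j: "j < count_list X y"
    show "poly ((pderiv1 ^^ j) s) (of_real y) = 0"
    proof (cases "y = x")
      case True
      then have "poly ((pderiv1 ^^ Suc j) r) (of_real x) = 0" using Cons.prems[rule_format, of "Suc j" x] j by simp
      moreover have "(of_nat (Suc j) :: complex) \<noteq> 0" by (simp only: of_nat_eq_0_iff)
      ultimately show ?thesis using ev[of "Suc j" "of_real x"] True by simp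
    next
      case False
      show ?thesis using j
      proof (induction j rule: less_induct)
        case (less j)
        have nz: "of_real y - of_real x \<noteq> (0::complex)" using False by simp
        have "poly ((pderiv1 ^^ j) r) (of_real y) = 0" using Cons.prems[rule_format, of j y] less.prems False by simp
        moreover have "of_nat j * poly ((pderiv1 ^^ (j - 1)) s) (of_real y) = 0"
          using less.IH[of "j - 1"] less.prems by (cases j) auto
        ultimately have "(of_real y - of_real x) * poly ((pderiv1 ^^ j) s) (of_real y) = 0"
          using ev[of j "of_real y"] by (simp only: add_0_right)
        then show ?case using nz by (simp only: mult_eq_0_iff) simp
      qed
    qed
  qed
  then have "nodal X dvd s" by (rule Cons.IH)
  then show ?case unfolding s nodal_Cons by (rule mult_dvd_mono[OF dvd_refl])
qed simp

lemma zero_derivatives_of_power_factor: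
  assumes der: "\<forall>j z. (h j has_field_derivative h (Suc j) z) (at z)"
    and "G holomorphic_on UNIV" "\<forall>z. h (0::nat) z = (z - y) ^ m * G z"
  shows "\<forall>j<m. h j y = (0::complex)"
  using assms
proof (induction m arbitrary: h G)
  case (Suc m)
  have dG: "(G has_field_derivative deriv G z) (at z)" for z
    using holomorphic_derivI[OF Suc.prems(2)] by auto
  let ?G = "\<lambda>z. of_nat (Suc m) * G z + (z - y) * deriv G z"
  have h1: "h (Suc 0) z = (z - y) ^ m * ?G z" for z
  proof (rule DERIV_unique)
    show "(h 0 has_field_derivative h (Suc 0) z) (at z)" using Suc.prems(1) by blast
    have "h 0 = (\<lambda>z. (z - y) ^ Suc m * G z)" using Suc.prems(3) by auto
    moreover have "((\<lambda>z. (z - y) ^ Suc m * G z) has_field_derivative (z - y) ^ m * ?G z) (at z)"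
      by (rule derivative_eq_intros dG refl | simp)+ (simp add: algebra_simps)
    ultimately show "(h 0 has_field_derivative (z - y) ^ m * ?G z) (at z)" by simp
  qed
  have "\<forall>j<m. h (Suc j) y = 0"
  proof (rule Suc.IH[of "\<lambda>j. h (Suc j)" ?G])
    show "?G holomorphic_on UNIV"
      by (intro holomorphic_intros Suc.prems(2) holomorphic_deriv) auto
  qed (use Suc.prems h1 in auto)
  moreover have "h 0 y = 0" using Suc.prems(3) by simp
  ultimately show ?case using less_Suc_eq_0_disj by auto
qed simp

lemma mset_split_count: "mset X = mset (replicate (count_list X y) y @ filter (\<lambda>x. x \<noteq> y) X)"
  by (induction X) auto

lemma pderiv_funpow_eq_0:
  fixes p :: "complex poly"
  shows "degree p < n \<Longrightarrow> (pderiv ^^ n) p = 0"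
proof (induction n arbitrary: p)
  case (Suc n)
  show ?case
  proof (cases "degree p = 0")
    case True
    then have "pderiv p = 0" by (simp add: pderiv_eq_0_iff)
    moreover have "(pderiv ^^ n) 0 = (0 :: complex poly)" by (induction n) auto
    ultimately show ?thesis by (simp only: funpow_Suc_right comp_apply)
  next
    case False
    then have "degree (pderiv p) < n" using Suc.prems degree_pderiv[of p] by simp
    then show ?thesis using Suc.IH by (simp only: funpow_Suc_right comp_apply)
  qed
qed simp

text \<open>Rolle's theorem, in the form that the differential operator \<open>(1 + D) ^ (dq + 1)\<close> applied to
  \<open>P\<close> produces a polynomial all of whose zeros lie in the interval of the nodes.\<close>

lemma rolle_interpolant:
  assumes van: "vanishes X (remainder 1 1 P Q)" and X: "set X \<subseteq> {a..b}"
    and real: "\<And>i. coeff P i \<in> \<real>" "\<And>i. coeff Q i \<in> \<real>"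
    and deg: "degree Q \<le> dq" "dq + 1 \<le> length X"
  obtains Y where "length Y = length X - (dq + 1)" "set Y \<subseteq> {a..b}" "nodal Y dvd (pderiv1 ^^ (dq + 1)) P"
proof -
  \<comment> \<open>The j-th derivative of the linearised error. For j > dq the contribution of Q
    disappears and only (1 + D) ^ j P times exp remains.\<close>
  define E where "E j z = poly ((pderiv1 ^^ j) P) z * exp z - poly ((pderiv ^^ j) Q) z" for j z
  define f where "f j x = Re (E j (of_real x))" for j x
  have dE: "(E j has_field_derivative E (Suc j) z) (at z)" for j z
    unfolding E_def by (rule derivative_eq_intros refl | simp)+ (simp add: pderiv1_def algebra_simps)
  have df: "(f j has_real_derivative f (Suc j) x) (at x)" for j x
  proof -
    have "((\<lambda>x. E j (of_real x)) has_vector_derivative E (Suc j) (of_real x)) (at x)"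
      by (rule has_vector_derivative_real_field[OF dE])
    then have "((\<lambda>x. Re (E j (of_real x))) has_vector_derivative Re (E (Suc j) (of_real x))) (at x)"
      by (rule bounded_linear.has_vector_derivative[OF bounded_linear_Re])
    then show ?thesis unfolding f_def[abs_def] by (simp add: has_real_derivative_iff_has_vector_derivative)
  qed
  have realD: "coeff ((pderiv1 ^^ j) P) i \<in> \<real>" for i j
  proof (induction j arbitrary: i)
    case (Suc j)
    then show ?case by (simp add: pderiv1_def coeff_pderiv)
  qed (simp add: real)
  have "mzeros f (sort X)"
    unfolding mzeros_def
  proof (intro allI impI)
    fix y j assume j: "j < count_list (sort X) y"
    then have j': "j < count_list X y" by (simp flip: count_mset)
    have "vanishes (replicate (count_list X y) y @ filter (\<lambda>x. x \<noteq> y) X) (E 0)"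
      using van vanishes_mset_cong[OF mset_split_count[of X y], of "remainder 1 1 P Q"]
      by (simp add: E_def[abs_def] remainder_def[abs_def])
    then have "vanishes (replicate (count_list X y) y) (E 0)" by (rule vanishes_append_left)
    then obtain G where G: "G holomorphic_on UNIV" "\<forall>z. E 0 z = (z - of_real y) ^ count_list X y * G z"
      by (auto simp: vanishes_def poly_nodal map_replicate)
    have "\<forall>j<count_list X y. E j (of_real y) = 0"
      using zero_derivatives_of_power_factor[of E G "of_real y" "count_list X y"] G dE by blast
    then show "f j y = 0" using j' by (simp add: f_def)
  qed
  then obtain Y where Y: "length Y = length X - (dq + 1)" "set Y \<subseteq> {a..b}" "mzeros (\<lambda>j. f (dq + 1 + j)) Y"
    using rolle_mzeros[of f "sort X" a b "dq + 1"] df X deg(2) by auto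
  have "nodal Y dvd (pderiv1 ^^ (dq + 1)) P"
  proof (rule nodal_dvd_if_pderiv1_zeros, intro allI impI)
    fix y j assume j: "j < count_list Y y"
    have "f (dq + 1 + j) y = 0" using Y(3) j unfolding mzeros_def by blast
    moreover have "(pderiv ^^ (dq + 1 + j)) Q = 0"
      by (rule pderiv_funpow_eq_0) (use deg(1) in simp)
    ultimately have "Re (poly ((pderiv1 ^^ (dq + 1 + j)) P) (of_real y)) * exp y = 0"
      by (simp add: f_def E_def exp_of_real del: funpow.simps)
    then have "Re (poly ((pderiv1 ^^ (dq + 1 + j)) P) (of_real y)) = 0" by simp
    moreover have "Im (poly ((pderiv1 ^^ (dq + 1 + j)) P) (of_real y)) = 0"
      by (rule conj_symmetric_real[OF conj_symmetric_poly]) (rule realD)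
    ultimately have "poly ((pderiv1 ^^ (dq + 1 + j)) P) (of_real y) = 0" by (simp add: complex_eq_iff)
    then show "poly ((pderiv1 ^^ j) ((pderiv1 ^^ (dq + 1)) P)) (of_real y) = 0"
      by (metis add.commute comp_apply funpow_add)
  qed
  with Y that show thesis by blast
qed

text \<open>This is the negative binomial series for (1 + D) ^ (- N), finite since D is nilpotent on
  polynomials of degree at most d. The induction on N is Pascal's rule.\<close>

lemma pderiv1_power_inverse:
  assumes "degree p \<le> d"
  shows "p = (\<Sum>j\<le>d. smult ((-1) ^ j * of_nat ((N + j - 1) choose j)) ((pderiv ^^ j) ((pderiv1 ^^ N) p)))"
proof (induction N)
  case 0
  \<comment> \<open>For N = 0 the truncated \<open>0 + j - 1\<close> makes the binomial coefficient
    1 at j = 0 and 0 elsewhere.\<close>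
  have "(\<Sum>j\<le>d. smult ((-1) ^ j * of_nat ((0 + j - 1) choose j)) ((pderiv ^^ j) p)) = (\<Sum>j\<le>d. if j = 0 then p else 0)"
    by (rule sum.cong) (auto simp: binomial_eq_0)
  then show ?case by simp
next
  case (Suc N)
  let ?q = "(pderiv1 ^^ N) p" and ?D = "\<lambda>j. (pderiv ^^ j) ((pderiv1 ^^ N) p)"
  have lin: "(pderiv ^^ j) (pderiv1 q) = (pderiv ^^ j) q + (pderiv ^^ Suc j) q" for j q
    by (induction j) (auto simp: pderiv1_def pderiv_add)
  have degN: "degree ((pderiv1 ^^ N) p) \<le> d"
  proof (induction N)
    case (Suc N)
    then show ?case
      by (auto simp: pderiv1_def degree_pderiv intro!: degree_add_le)
  qed (simp add: assms)
  then have top: "?D (Suc d) = 0" by (intro pderiv_funpow_eq_0) simp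
  let ?c = "\<lambda>j. (-1) ^ j * of_nat ((N + j) choose j) :: complex"
  have "(\<Sum>j\<le>d. smult ((-1) ^ j * of_nat ((Suc N + j - 1) choose j)) ((pderiv ^^ j) ((pderiv1 ^^ Suc N) p)))
     = (\<Sum>j\<le>d. smult (?c j) (?D j)) + (\<Sum>j\<le>d. smult (?c j) (?D (Suc j)))"
    by (simp only: funpow.simps(2)[of N] comp_apply lin smult_add_right sum.distrib add_Suc diff_Suc_1)
  also have "(\<Sum>j\<le>d. smult (?c j) (?D (Suc j))) = (\<Sum>j<d. smult (?c j) (?D (Suc j)))"
    using top by (simp add: lessThan_Suc_atMost[symmetric])
  also have "\<dots> = (\<Sum>j=1..d. smult (?c (j - 1)) (?D j))"
    by (rule sum.reindex_bij_witness[of _ "\<lambda>j. j - 1" Suc]) auto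
  also have "(\<Sum>j\<le>d. smult (?c j) (?D j)) = ?D 0 + (\<Sum>j=1..d. smult (?c j) (?D j))"
    by (simp add: atMost_atLeast0 sum.atLeast_Suc_atMost)
  also have "\<dots> + (\<Sum>j=1..d. smult (?c (j - 1)) (?D j)) = ?D 0 + (\<Sum>j=1..d. smult (?c j + ?c (j - 1)) (?D j))"
    by (simp add: sum.distrib smult_add_left)
  also have "(\<Sum>j=1..d. smult (?c j + ?c (j - 1)) (?D j)) = (\<Sum>j=1..d. smult ((-1) ^ j * of_nat ((N + j - 1) choose j)) (?D j))"
  proof (rule sum.cong)
    fix j assume "j \<in> {1..d}"
    then obtain i where i: "j = Suc i" by (cases j) auto
    show "smult (?c j + ?c (j - 1)) (?D j) = smult ((-1) ^ j * of_nat ((N + j - 1) choose j)) (?D j)"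
      unfolding i by (simp add: algebra_simps)
  qed simp
  also have "?D 0 + \<dots> = (\<Sum>j\<le>d. smult ((-1) ^ j * of_nat ((N + j - 1) choose j)) (?D j))"
    by (simp add: atMost_atLeast0 sum.atLeast_Suc_atMost)
  also have "\<dots> = p" by (rule Suc.IH[symmetric])
  finally show ?case by simp
qed

lemma pderiv_funpow_linear:
  fixes s :: "complex poly"
  shows "(pderiv ^^ j) ([:- y, 1:] * s) = [:- y, 1:] * (pderiv ^^ j) s + smult (of_nat j) ((pderiv ^^ (j - 1)) s)"
proof (induction j)
  case (Suc j)
  have "pderiv ([:- y, 1:] * t) = [:- y, 1:] * pderiv t + t" for t :: "complex poly"
    unfolding pderiv_mult by (simp add: pderiv_pCons algebra_simps)
  moreover have "smult (of_nat j) (pderiv ((pderiv ^^ (j - 1)) s)) = smult (of_nat j) ((pderiv ^^ j) s)"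
    by (cases j) simp_all
  moreover have "(pderiv ^^ Suc j) ([:- y, 1:] * s) =
      pderiv ([:- y, 1:] * (pderiv ^^ j) s + smult (of_nat j) ((pderiv ^^ (j - 1)) s))"
    by (simp only: funpow.simps comp_apply Suc.IH)
  ultimately show ?case
    by (simp only: funpow.simps comp_apply of_nat_Suc smult_add_left smult_1_left diff_Suc_1 add.assoc
        pderiv_add pderiv_smult)
qed simp

lemma poly_pderiv_funpow_nodal_Cons:
  "poly ((pderiv ^^ j) (nodal (x # X))) z = (z - of_real x) * poly ((pderiv ^^ j) (nodal X)) z
     + of_nat j * poly ((pderiv ^^ (j - 1)) (nodal X)) z"
  unfolding nodal_Cons pderiv_funpow_linear by (simp add: algebra_simps)

text \<open>The bound is the j-th derivative of \<rho> ^ d, with d the number of nodes: each term of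
  the differentiated product keeps d - j factors of modulus at most \<rho>.\<close>

lemma nodal_derivative_bound:
  assumes "\<forall>x\<in>set X. norm (z - of_real x) \<le> \<rho>" "j \<le> length X"
  shows "norm (poly ((pderiv ^^ j) (nodal X)) z) \<le> fact (length X) / fact (length X - j) * \<rho> ^ (length X - j)"
  using assms
proof (induction X arbitrary: j)
  case (Cons x X)
  let ?d = "length X" and ?s = "\<lambda>j. poly ((pderiv ^^ j) (nodal X)) z"
  have \<rho>: "\<rho> \<ge> 0" using Cons.prems(1) norm_ge_zero by (metis list.set_intros(1) order_trans)
  have zx: "norm (z - of_real x) \<le> \<rho>" using Cons.prems(1) by simp
  have IH: "norm (?s j) \<le> fact ?d / fact (?d - j) * \<rho> ^ (?d - j)" if "j \<le> ?d" for j
    using Cons that by simp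
  show ?case
  proof (cases j)
    case 0
    have "norm ((z - of_real x) * ?s 0) \<le> \<rho> * \<rho> ^ ?d"
      unfolding norm_mult using zx IH[of 0] \<rho> by (intro mult_mono) auto
    then show ?thesis using 0 by (simp add: poly_nodal_Cons)
  next
    case (Suc i)
    have i: "i \<le> ?d" using Suc Cons.prems by simp
    have 2: "norm (of_nat j * ?s i) \<le> real j * (fact ?d / fact (?d - i) * \<rho> ^ (?d - i))"
      unfolding norm_mult using IH[OF i] by (intro mult_mono) auto
    have 1: "norm ((z - of_real x) * ?s j) \<le> real (?d - i) * (fact ?d / fact (?d - i) * \<rho> ^ (?d - i))"
    proof (cases "j \<le> ?d")
      case True
      then have e: "?d - i = Suc (?d - j)" using Suc by simp
      have "norm ((z - of_real x) * ?s j) \<le> \<rho> * (fact ?d / fact (?d - j) * \<rho> ^ (?d - j))"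
        unfolding norm_mult using zx IH[OF True] \<rho> by (intro mult_mono) auto
      also have "\<dots> = real (?d - i) * (fact ?d / fact (?d - i) * \<rho> ^ (?d - i))"
      proof -
        have "fact (Suc n) = real (Suc n) * fact n" for n by simp
        then show ?thesis
          unfolding e by (simp only: power_Suc) (simp add: divide_simps del: of_nat_Suc)
      qed
      finally show ?thesis .
    next
      case False
      then have "?s j = 0" by (subst pderiv_funpow_eq_0) auto
      then show ?thesis using \<rho> by simp
    qed
    have "norm (poly ((pderiv ^^ j) (nodal (x # X))) z) \<le> norm ((z - of_real x) * ?s j) + norm (of_nat j * ?s i)"
      unfolding poly_pderiv_funpow_nodal_Cons using Suc norm_triangle_ineq by simp
    also have "\<dots> \<le> (real (?d - i) + real j) * (fact ?d / fact (?d - i) * \<rho> ^ (?d - i))"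
      using 1 2 by (simp only: distrib_right)
    also have "real (?d - i) + real j = real (Suc ?d)" using i Suc by simp
    also have "real (Suc ?d) * (fact ?d / fact (?d - i) * \<rho> ^ (?d - i)) = fact (Suc ?d) / fact (?d - i) * \<rho> ^ (?d - i)"
      by simp
    finally show ?thesis using Suc by simp
  qed
qed simp

text \<open>To the left of all zeros the signs of the derivatives alternate. They match the
  alternating coefficients of the inverse operator, so that nothing cancels at the left
  endpoint.\<close>

lemma nodal_derivative_sign:
  assumes "\<forall>x\<in>set X. a \<le> x"
  shows "(-1) ^ (length X + j) * Re (poly ((pderiv ^^ j) (nodal X)) (of_real a)) \<ge> 0
    \<and> Im (poly ((pderiv ^^ j) (nodal X)) (of_real a)) = 0"
  using assms
proof (induction X arbitrary: j)
  case Nil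
  have "(pderiv ^^ j) 1 = (0 :: complex poly)" if "j > 0" using that by (intro pderiv_funpow_eq_0) simp
  then show ?case by (cases "j = 0") auto
next
  case (Cons x X)
  let ?s = "\<lambda>j. poly ((pderiv ^^ j) (nodal X)) (of_real a)" and ?d = "length X"
  have IH: "(-1) ^ (?d + j) * Re (?s j) \<ge> 0" "Im (?s j) = 0" for j using Cons by auto
  have "(-1) ^ (length (x # X) + j) * Re (poly ((pderiv ^^ j) (nodal (x # X))) (of_real a))
    = (x - a) * ((-1) ^ (?d + j) * Re (?s j)) + real j * ((-1) ^ (Suc ?d + j) * Re (?s (j - 1)))"
    unfolding poly_pderiv_funpow_nodal_Cons by (simp add: algebra_simps)
  moreover have "(x - a) * ((-1) ^ (?d + j) * Re (?s j)) \<ge> 0"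
    using IH(1)[of j] Cons.prems by (intro mult_nonneg_nonneg[of "x - a"]) simp_all
  moreover have "real j * ((-1) ^ (Suc ?d + j) * Re (?s (j - 1))) \<ge> 0"
    using IH(1)[of "j - 1"] by (cases j) auto
  ultimately show ?case unfolding poly_pderiv_funpow_nodal_Cons using IH(2) by simp
qed

lemma nodal_dvd_imp_eq:
  assumes "nodal Y dvd r" "degree r \<le> length Y"
  shows "r = smult (coeff r (length Y)) (nodal Y)"
proof -
  obtain g where g: "r = nodal Y * g" using assms(1) by (auto simp: dvd_def)
  have "degree g = 0"
  proof (cases "g = 0")
    case False
    then show ?thesis using assms(2) by (simp add: g degree_mult_eq)
  qed simp
  then obtain c where c: "g = [:c:]" by (rule degree_eq_zeroE)
  then have "r = smult c (nodal Y)" using g by (simp add: mult.commute)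
  then show ?thesis by simp
qed

lemma pderiv1_funpow_degree:
  assumes "degree p \<le> d"
  shows "degree ((pderiv1 ^^ N) p) \<le> d \<and> coeff ((pderiv1 ^^ N) p) d = coeff p d"
proof (induction N)
  case (Suc N)
  let ?q = "(pderiv1 ^^ N) p"
  have "coeff ?q (Suc d) = 0" using Suc by (simp add: coeff_eq_0)
  moreover have "degree (pderiv1 ?q) \<le> d"
    unfolding pderiv1_def[of ?q] using Suc by (intro degree_add_le) (auto simp: degree_pderiv)
  moreover have "coeff (pderiv1 ?q) d = coeff p d"
    using Suc calculation(1) by (simp add: pderiv1_def[of ?q] coeff_pderiv)
  ultimately show ?case by simp
qed (simp add: assms)

lemma exp_partial_sum_le:
  fixes x :: real
  assumes "x \<ge> 0"
  shows "(\<Sum>i\<le>n. x ^ i / fact i) \<le> exp x"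
proof -
  have "(\<lambda>i. x ^ i / fact i) sums exp x"
    using exp_converges[of x] by (simp add: scaleR_conv_of_real divide_inverse mult.commute)
  then show ?thesis using assms by (intro sum_le_suminf[of "\<lambda>i. x ^ i / fact i" "{..n}", THEN order_trans]) (auto simp: sums_iff)
qed

lemma exp_weighted_partial_sum_le:
  fixes x :: real
  assumes "x \<ge> 0" "h \<ge> 0"
  shows "(\<Sum>i\<le>n. (h + real i) * (x ^ i / fact i)) \<le> (h + x) * exp x"
proof -
  have "(\<Sum>i\<le>n. real i * (x ^ i / fact i)) \<le> x * exp x"
  proof (cases n)
    case (Suc m)
    have "(\<Sum>i\<le>n. real i * (x ^ i / fact i)) = (\<Sum>i\<le>m. real (Suc i) * (x ^ Suc i / fact (Suc i)))"
      unfolding Suc by (subst sum.atMost_Suc_shift) simp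
    also have "\<dots> = x * (\<Sum>i\<le>m. x ^ i / fact i)"
      unfolding sum_distrib_left by (rule sum.cong) (auto simp: divide_simps simp del: of_nat_Suc)
    also have "\<dots> \<le> x * exp x" using exp_partial_sum_le[OF assms(1)] assms(1) by (intro mult_left_mono) auto
    finally show ?thesis .
  qed (use assms in simp)
  moreover have "h * (\<Sum>i\<le>n. x ^ i / fact i) \<le> h * exp x"
    using exp_partial_sum_le[OF assms(1)] assms(2) by (intro mult_left_mono) auto
  moreover have "(\<Sum>i\<le>n. (h + real i) * (x ^ i / fact i)) =
      h * (\<Sum>i\<le>n. x ^ i / fact i) + (\<Sum>i\<le>n. real i * (x ^ i / fact i))"
    by (simp only: distrib_right sum.distrib sum_distrib_left)
  ultimately show ?thesis by (simp only: distrib_right)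
qed

lemma pderiv_sum: "pderiv (sum f I) = (\<Sum>i\<in>I. pderiv (f i))"
  by (induction I rule: infinite_finite_induct) (simp_all add: pderiv_add)

text \<open>The operator \<open>(1 + D) ^ (m + 1)\<close> inverted on a monic polynomial with all zeros in a fixed interval.
  The second estimate says that, up to \<open>O(1/m)\<close>, the result solves \<open>2 p' + p = 0\<close>.\<close>

context
  fixes Y :: "real list" and m :: nat and p :: "complex poly" and d :: nat
  defines "d \<equiv> length Y"
  assumes p: "p = (\<Sum>j\<le>d. smult ((-1) ^ j * of_nat ((m + j) choose j)) ((pderiv ^^ j) (nodal Y)))"
    and m: "m \<ge> 1"
begin

text \<open>The term j = d, in which the nodal polynomial has become the constant
  \<open>fact d\<close>, has size \<open>fact (m + d) / fact m\<close>. The other terms are compared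
  with it, and the quotients \<open>\<rho> ^ (d - j) / fact (d - j)\<close> add up to at most exp
  \<rho>.\<close>

lemma binomial_fact_le:
  assumes "j \<le> d"
  shows "real ((m + j) choose j) * (fact d / fact (d - j) * \<rho> ^ (d - j)) \<le> fact (m + d) / fact m * (\<bar>\<rho>\<bar> ^ (d - j) / fact (d - j))"
proof -
  have "(m + j) choose j = (m + j) choose m" using binomial_symmetric[of j "m + j"] by simp
  also have "\<dots> \<le> (m + d) choose m" using assms by (intro binomial_right_mono) simp
  also have "\<dots> = (m + d) choose d" using binomial_symmetric[of d "m + d"] by simp
  finally have "real ((m + j) choose j) \<le> real ((m + d) choose d)" by simp
  also have "\<dots> = fact (m + d) / (fact d * fact m)" using binomial_fact[of d "m + d", where 'a = real] by simp
  finally have 1: "real ((m + j) choose j) * fact d \<le> fact (m + d) / fact m" by (simp add: field_simps)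
  have "real ((m + j) choose j) * (fact d / fact (d - j) * \<rho> ^ (d - j)) = (real ((m + j) choose j) * fact d) * (\<rho> ^ (d - j) / fact (d - j))"
    by simp
  also have "\<dots> \<le> (real ((m + j) choose j) * fact d) * (\<bar>\<rho>\<bar> ^ (d - j) / fact (d - j))"
    using abs_ge_self[of "\<rho> ^ (d - j)"] by (intro mult_left_mono divide_right_mono) (auto simp: power_abs)
  also have "\<dots> \<le> fact (m + d) / fact m * (\<bar>\<rho>\<bar> ^ (d - j) / fact (d - j))"
    by (intro mult_right_mono 1) auto
  finally show ?thesis .
qed

text \<open>In (1 + 2 D) (1 + D) ^ (- m - 1) the coefficient of D ^ j is that of (1 + D) ^ (- m - 1)
  times (m - j) / (m + j). The dominant terms have j near d, and d is near m; this is the gain of 1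
  / m.\<close>

lemma inverse_operator_ode:
  assumes Y: "\<forall>x\<in>set Y. norm (z - of_real x) \<le> \<rho>" and \<rho>: "\<rho> \<ge> 0" and h: "d \<le> m + h" "m \<le> d + h"
  shows "norm (2 * poly (pderiv p) z + poly p z) \<le> fact (m + d) / fact m * ((real h + \<rho>) * exp \<rho> / m)"
proof -
  let ?s = "\<lambda>j. poly ((pderiv ^^ j) (nodal Y)) z" and ?K = "fact (m + d) / fact m :: real"
  let ?c = "\<lambda>j. (-1) ^ j * of_nat ((m + j) choose j) :: complex"
  have top: "?s (Suc d) = 0" by (subst pderiv_funpow_eq_0) (auto simp: d_def)
  have "poly (pderiv p) z = (\<Sum>j\<le>d. ?c j * ?s (Suc j))"
    unfolding p by (simp add: pderiv_sum pderiv_smult poly_sum)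
  also have "\<dots> = (\<Sum>j<d. ?c j * ?s (Suc j))"
    using top by (simp add: lessThan_Suc_atMost[symmetric])
  also have "\<dots> = (\<Sum>j=1..d. ?c (j - 1) * ?s j)"
    by (rule sum.reindex_bij_witness[of _ "\<lambda>j. j - 1" Suc]) auto
  finally have 1: "poly (pderiv p) z = (\<Sum>j=1..d. ?c (j - 1) * ?s j)" .
  have 2: "poly p z = ?s 0 + (\<Sum>j=1..d. ?c j * ?s j)"
    unfolding p by (simp add: poly_sum atMost_atLeast0 sum.atLeast_Suc_atMost)
  have "2 * poly (pderiv p) z + poly p z = ?s 0 + (\<Sum>j=1..d. (2 * ?c (j - 1) + ?c j) * ?s j)"
    unfolding 1 2 by (simp only: sum_distrib_left sum.distrib distrib_right mult.assoc add_ac)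
  also have "(\<Sum>j=1..d. (2 * ?c (j - 1) + ?c j) * ?s j) = (\<Sum>j=1..d. ?c j * of_real ((real m - real j) / (m + j)) * ?s j)"
  proof (rule sum.cong)
    fix j assume "j \<in> {1..d}"
    then obtain i where i: "j = Suc i" by (cases j) auto
    have "real (Suc i) * real ((m + Suc i) choose (Suc i)) = real (m + Suc i) * real ((m + i) choose i)"
      using Suc_times_binomial_eq[of "m + i" i] by (metis add_Suc_right mult.commute of_nat_mult)
    then have "real ((m + i) choose i) = real ((m + Suc i) choose Suc i) * real (Suc i) / real (m + Suc i)"
      by (simp add: field_simps)
    then have r: "real ((m + Suc i) choose (Suc i)) - 2 * real ((m + i) choose i) =
        real ((m + Suc i) choose Suc i) * ((real m - real (Suc i)) / real (m + Suc i))"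
      by (simp add: divide_simps del: binomial_Suc_Suc) (simp add: algebra_simps del: binomial_Suc_Suc)
    have "2 * ?c (j - 1) + ?c j = (-1) ^ j * of_real (real ((m + Suc i) choose (Suc i)) - 2 * real ((m + i) choose i))"
      unfolding i by (simp add: algebra_simps del: binomial_Suc_Suc)
    also have "\<dots> = ?c j * of_real ((real m - real j) / (m + j))"
      unfolding r i by (simp del: binomial_Suc_Suc)
    finally show "(2 * ?c (j - 1) + ?c j) * ?s j = ?c j * of_real ((real m - real j) / (m + j)) * ?s j" by simp
  qed simp
  also have "?s 0 + \<dots> = (\<Sum>j\<le>d. ?c j * of_real ((real m - real j) / (m + j)) * ?s j)"
    using m by (simp add: atMost_atLeast0 sum.atLeast_Suc_atMost)
  finally have eq: "2 * poly (pderiv p) z + poly p z = \<dots>" .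
  have "norm (2 * poly (pderiv p) z + poly p z) \<le> (\<Sum>j\<le>d. ?K / m * ((real h + real (d - j)) * (\<rho> ^ (d - j) / fact (d - j))))"
    unfolding eq
  proof (rule sum_norm_le)
    fix j assume "j \<in> {..d}"
    then have j: "j \<le> d" by simp
    have s: "norm (?s j) \<le> fact d / fact (d - j) * \<rho> ^ (d - j)"
      using nodal_derivative_bound[OF Y] j by (simp add: d_def)
    have frac: "\<bar>(real m - real j) / (m + j)\<bar> \<le> (real h + real (d - j)) / m"
      unfolding abs_divide using h j m by (intro frac_le) (auto simp: abs_le_iff of_nat_diff)
    have "norm (?c j * of_real ((real m - real j) / (m + j)) * ?s j) =
        \<bar>(real m - real j) / (m + j)\<bar> * (real ((m + j) choose j) * norm (?s j))"
      by (simp only: norm_mult norm_power norm_of_real norm_minus_cancel norm_one norm_of_nat power_one mult_1_left mult_ac)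
    also have "\<dots> \<le> ((real h + real (d - j)) / m) * (real ((m + j) choose j) * (fact d / fact (d - j) * \<rho> ^ (d - j)))"
      using frac s by (intro mult_mono) auto
    also have "\<dots> \<le> ((real h + real (d - j)) / m) * (?K * (\<rho> ^ (d - j) / fact (d - j)))"
      using binomial_fact_le[OF j, of \<rho>] \<rho> by (intro mult_left_mono) auto
    finally show "norm (?c j * of_real ((real m - real j) / (m + j)) * ?s j) \<le> ?K / m * ((real h + real (d - j)) * (\<rho> ^ (d - j) / fact (d - j)))"
      by (simp add: mult_ac)
  qed
  also have "\<dots> = ?K / m * (\<Sum>j\<le>d. (real h + real (d - j)) * (\<rho> ^ (d - j) / fact (d - j)))"
    by (simp only: sum_distrib_left)
  also have "(\<Sum>j\<le>d. (real h + real (d - j)) * (\<rho> ^ (d - j) / fact (d - j))) = (\<Sum>i\<le>d. (real h + real i) * (\<rho> ^ i / fact i))"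
    by (rule sum.reindex_bij_witness[of _ "\<lambda>j. d - j" "\<lambda>j. d - j"]) auto
  also have "?K / m * \<dots> \<le> ?K / m * ((real h + \<rho>) * exp \<rho>)"
    by (intro mult_left_mono exp_weighted_partial_sum_le \<rho>) auto
  finally show ?thesis by simp
qed

lemma inverse_operator_upper:
  assumes Y: "\<forall>x\<in>set Y. norm (z - of_real x) \<le> \<rho>" and \<rho>: "\<rho> \<ge> 0"
  shows "norm (poly p z) \<le> fact (m + d) / fact m * exp \<rho>"
proof -
  let ?s = "\<lambda>j. poly ((pderiv ^^ j) (nodal Y)) z" and ?K = "fact (m + d) / fact m :: real"
  have "poly p z = (\<Sum>j\<le>d. (-1) ^ j * of_nat ((m + j) choose j) * ?s j)" unfolding p by (simp add: poly_sum)
  also have "norm \<dots> \<le> (\<Sum>j\<le>d. ?K * (\<rho> ^ (d - j) / fact (d - j)))"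
  proof (rule sum_norm_le)
    fix j assume "j \<in> {..d}"
    then have j: "j \<le> d" by simp
    have s: "norm (?s j) \<le> fact d / fact (d - j) * \<rho> ^ (d - j)"
      using nodal_derivative_bound[OF Y] j by (simp add: d_def)
    have "norm ((-1) ^ j * of_nat ((m + j) choose j) * ?s j) = real ((m + j) choose j) * norm (?s j)"
      by (simp add: norm_mult norm_power)
    also have "\<dots> \<le> real ((m + j) choose j) * (fact d / fact (d - j) * \<rho> ^ (d - j))"
      using s by (intro mult_left_mono) auto
    also have "\<dots> \<le> ?K * (\<rho> ^ (d - j) / fact (d - j))" using binomial_fact_le[OF j, of \<rho>] \<rho> by simp
    finally show "norm ((-1) ^ j * of_nat ((m + j) choose j) * ?s j) \<le> ?K * (\<rho> ^ (d - j) / fact (d - j))" .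
  qed
  also have "\<dots> = ?K * (\<Sum>j\<le>d. \<rho> ^ (d - j) / fact (d - j))" by (simp only: sum_distrib_left)
  also have "(\<Sum>j\<le>d. \<rho> ^ (d - j) / fact (d - j)) = (\<Sum>i\<le>d. \<rho> ^ i / fact i)"
    by (rule sum.reindex_bij_witness[of _ "\<lambda>j. d - j" "\<lambda>j. d - j"]) auto
  also have "?K * \<dots> \<le> ?K * exp \<rho>" by (intro mult_left_mono exp_partial_sum_le \<rho>) auto
  finally show ?thesis .
qed

text \<open>To the left of all zeros the terms of the sum have a common sign, so the term j = d is
  already a lower bound.\<close>

lemma inverse_operator_lower:
  assumes "\<forall>x\<in>set Y. a \<le> x"
  shows "(-1) ^ d * Re (poly p (of_real a)) \<ge> fact (m + d) / fact m" "Im (poly p (of_real a)) = 0"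
proof -
  let ?s = "\<lambda>j. poly ((pderiv ^^ j) (nodal Y)) (of_real a)"
  have S: "(-1) ^ (d + j) * Re (?s j) \<ge> 0" "Im (?s j) = 0" for j
    using nodal_derivative_sign[OF assms] by (auto simp: d_def)
  have ev: "poly p (of_real a) = (\<Sum>j\<le>d. of_real ((-1) ^ j * real ((m + j) choose j)) * ?s j)"
    unfolding p by (simp add: poly_sum)
  show "Im (poly p (of_real a)) = 0" unfolding ev by (simp add: S Im_sum)
  have coeffd: "?s d = fact d"
  proof -
    have "(pderiv ^^ j) p = [:of_nat (fact j) * coeff p j:]" if "degree p \<le> j" for p :: "complex poly" and j
      using that
    proof (induction j arbitrary: p)
      case 0
      then obtain c where "p = [:c:]" by (auto elim: degree_eq_zeroE)
      then show ?case by simp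
    next
      case (Suc j)
      then have "degree (pderiv p) \<le> j" using degree_pderiv[of p] by simp
      then show ?case using Suc.IH[of "pderiv p"] by (simp add: funpow_Suc_right coeff_pderiv algebra_simps del: funpow.simps(2))
    qed
    from this[of "nodal Y" d] show ?thesis by (simp add: d_def)
  qed
  have "(-1) ^ d * Re (poly p (of_real a)) = (\<Sum>j\<le>d. real ((m + j) choose j) * ((-1) ^ (d + j) * Re (?s j)))"
    unfolding ev by (simp add: Re_sum sum_distrib_left power_add mult_ac)
  also have "\<dots> \<ge> (\<Sum>j\<in>{d}. real ((m + j) choose j) * ((-1) ^ (d + j) * Re (?s j)))"
    by (rule sum_mono2) (use S in auto)
  finally have "(\<Sum>j\<in>{d}. real ((m + j) choose j) * ((-1) ^ (d + j) * Re (?s j))) \<le> (-1) ^ d * Re (poly p (of_real a))" .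
  moreover have "Re (?s d) = fact d" unfolding coeffd by (metis Re_complex_of_real of_real_fact)
  moreover have "(-1) ^ (d + d) = (1 :: real)" by (simp flip: mult_2)
  ultimately have "real ((m + d) choose d) * fact d \<le> (-1) ^ d * Re (poly p (of_real a))"
    by simp
  moreover have "real ((m + d) choose d) * fact d = fact (m + d) / fact m"
    using binomial_fact[of d "m + d", where 'a = real] by (simp add: divide_simps)
  ultimately show "(-1) ^ d * Re (poly p (of_real a)) \<ge> fact (m + d) / fact m" by simp
qed

end

text \<open>P exp (z / 2) has a derivative of size O(K / dq) and is nearly constant on the disc
  compared with K. The value of P at a is real, of sign (-1) ^ dp and of modulus between K and K exp
  (2 R); it defines y.\<close>

lemma exp_interpolant_asymptotics:
  assumes van: "vanishes X (remainder 1 1 P Q)" and X: "set X \<subseteq> {a..b}"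
    and real: "\<And>i. coeff P i \<in> \<real>" "\<And>i. coeff Q i \<in> \<real>"
    and deg: "degree P \<le> dp" "degree Q \<le> dq" "length X = dp + dq + 1"
    and lead: "coeff P dp = 1" and dq: "dq \<ge> 1" and h: "dp \<le> dq + h" "dq \<le> dp + h"
    and R: "\<bar>a\<bar> \<le> R" "\<bar>b\<bar> \<le> R"
  defines "K \<equiv> fact (dq + dp) / fact dq"
  obtains y where "1 \<le> y" "y \<le> exp (2 * R)"
    "\<And>z. norm z \<le> R \<Longrightarrow> norm ((-1) ^ dp / of_real K * poly P z - of_real y * exp (- (z - of_real a) / 2))
       \<le> (real h + 2 * R) * exp (2 * R) * exp R * R / dq"
proof -
  have K: "K > 0" by (simp add: K_def)
  have R0: "R \<ge> 0" using R by linarith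
  let ?r = "(pderiv1 ^^ (dq + 1)) P"
  obtain Y where Y: "length Y = dp" "set Y \<subseteq> {a..b}" "nodal Y dvd ?r"
    using rolle_interpolant[OF van X real deg(2)] deg(3) by auto
  have r: "?r = nodal Y"
    using nodal_dvd_imp_eq[OF Y(3)] pderiv1_funpow_degree[OF deg(1), of "dq + 1"] Y(1) lead
    by (simp del: funpow.simps)
  have P: "P = (\<Sum>j\<le>length Y. smult ((-1) ^ j * of_nat ((dq + j) choose j)) ((pderiv ^^ j) (nodal Y)))"
    using pderiv1_power_inverse[OF deg(1), of "dq + 1"] unfolding r Y(1) by simp
  have ab: "\<forall>x\<in>set Y. norm (z - of_real x) \<le> 2 * R" if "norm z \<le> R" for z :: complex
  proof
    fix x assume "x \<in> set Y"
    then have "\<bar>x\<bar> \<le> R" using Y(2) R by fastforce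
    then show "norm (z - of_real x) \<le> 2 * R"
      using that norm_triangle_ineq4[of z "of_real x"] by (simp only: norm_of_real)
  qed
  define y where "y = (-1) ^ dp * Re (poly P (of_real a)) / K"
  have lo: "(-1) ^ dp * Re (poly P (of_real a)) \<ge> K" "Im (poly P (of_real a)) = 0"
    using inverse_operator_lower[OF P dq, of a] Y(1,2) by (auto simp: K_def subset_iff)
  have sq: "(-1) ^ dp * ((-1) ^ dp * x) = x" for x :: real
    by (simp flip: power_add mult_2 mult.assoc)
  have "(-1) ^ dp * K * y = Re (poly P (of_real a))"
    using K sq by (simp add: y_def)
  then have Pa: "poly P (of_real a) = of_real ((-1) ^ dp * K * y)"
    using lo(2) by (simp add: complex_eq_iff)
  have na: "norm (of_real a :: complex) \<le> R" using R by simp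
  show thesis
  proof
    show y1: "1 \<le> y" using K lo(1) by (simp add: y_def)
    then have "norm (poly P (of_real a)) = K * y" using K unfolding Pa by (simp only: norm_of_real) (simp add: abs_mult)
    then have "K * y \<le> K * exp (2 * R)"
      using inverse_operator_upper[OF P dq ab[OF na]] R0 Y(1) by (simp add: K_def)
    then show "y \<le> exp (2 * R)" using K by simp
    fix z :: complex assume z: "norm z \<le> R"
    define \<psi> where "\<psi> u = poly P u * exp (u / 2)" for u
    define C where "C = K * ((real h + 2 * R) * exp (2 * R) / dq) / 2 * exp (R / 2)"
    have "norm (\<psi> z - \<psi> (of_real a)) \<le> C * norm (z - of_real a)"
    proof (rule field_differentiable_bound)
      show "convex (cball 0 R :: complex set)" by simp
      fix u :: complex assume "u \<in> cball 0 R"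
      then have u: "norm u \<le> R" by simp
      show "(\<psi> has_field_derivative (2 * poly (pderiv P) u + poly P u) / 2 * exp (u / 2)) (at u within cball 0 R)"
        unfolding \<psi>_def[abs_def] by (rule derivative_eq_intros refl | simp)+ (simp add: algebra_simps)
      have "norm (2 * poly (pderiv P) u + poly P u) \<le> K * ((real h + 2 * R) * exp (2 * R) / dq)"
        using inverse_operator_ode[OF P dq ab[OF u], of h] R0 Y(1) h by (simp add: K_def)
      moreover have "norm (exp (u / 2)) \<le> exp (R / 2)"
        using u complex_Re_le_cmod[of u] by (simp add: norm_exp_eq_Re)
      ultimately show "norm ((2 * poly (pderiv P) u + poly P u) / 2 * exp (u / 2)) \<le> C"
        unfolding C_def norm_mult norm_divide by (intro mult_mono divide_right_mono) (use R0 K in auto)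
    qed (use z na in auto)
    also have "\<dots> \<le> C * (2 * R)"
    proof (rule mult_left_mono)
      show "norm (z - of_real a) \<le> 2 * R" using norm_triangle_ineq4[of z "of_real a"] z na by linarith
      show "C \<ge> 0" using R0 K by (simp add: C_def)
    qed
    finally have b: "norm (\<psi> z - \<psi> (of_real a)) \<le> C * (2 * R)" .
    let ?t = "(-1) ^ dp / of_real K :: complex"
    have "?t * of_real ((-1) ^ dp * K * y) = of_real y"
      using K sq[of 1] by (simp add: field_simps flip: power_add mult_2)
    then have "?t * \<psi> (of_real a) = of_real y * exp (of_real a / 2)"
      unfolding \<psi>_def Pa by (metis mult.assoc)
    then have "?t * \<psi> (of_real a) * exp (- (z / 2)) = of_real y * (exp (of_real a / 2) * exp (- (z / 2)))"
      by (simp add: mult.assoc)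
    also have "exp (of_real a / 2) * exp (- (z / 2)) = exp (- (z - of_real a) / 2)"
      by (simp add: exp_add[symmetric] diff_divide_distrib)
    finally have 1: "?t * \<psi> (of_real a) * exp (- (z / 2)) = of_real y * exp (- (z - of_real a) / 2)" .
    have "exp (z / 2) * exp (- (z / 2)) = 1" by (simp flip: exp_add)
    then have 2: "?t * \<psi> z * exp (- (z / 2)) = ?t * poly P z"
      unfolding \<psi>_def by (metis mult.assoc mult.right_neutral)
    have "?t * poly P z - of_real y * exp (- (z - of_real a) / 2) = ?t * exp (- (z / 2)) * (\<psi> z - \<psi> (of_real a))"
    proof -
      have "t * u * e - t * v * e = t * e * (u - v)" for t u v e :: complex by (simp add: algebra_simps)
      then show ?thesis unfolding 1[symmetric] 2[symmetric] .
    qed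
    then have "norm (?t * poly P z - of_real y * exp (- (z - of_real a) / 2)) =
        1 / K * norm (exp (- (z / 2))) * norm (\<psi> z - \<psi> (of_real a))"
      using K by (simp add: norm_mult norm_divide norm_power)
    also have "\<dots> \<le> 1 / K * exp (R / 2) * (C * (2 * R))"
    proof -
      have "norm (exp (- (z / 2))) \<le> exp (R / 2)"
        using z abs_Re_le_cmod[of z] by (simp add: norm_exp_eq_Re)
      then show ?thesis using b K by (intro mult_mono mult_left_mono) auto
    qed
    also have "\<dots> = (real h + 2 * R) * exp (2 * R) * (exp (R / 2) * exp (R / 2)) * R / dq"
      using K by (simp add: C_def)
    also have "exp (R / 2) * exp (R / 2) = exp R" by (simp flip: exp_add)
    finally show "norm ((-1) ^ dp / of_real K * poly P z - of_real y * exp (- (z - of_real a) / 2))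
       \<le> (real h + 2 * R) * exp (2 * R) * exp R * R / dq" .
  qed
qed

subsection \<open>Convergence of rational interpolants\<close>

definition reflect :: "complex poly \<Rightarrow> complex poly" where
  "reflect p = pcompose p [:0, -1:]"

lemma poly_reflect [simp]: "poly (reflect p) z = poly p (- z)"
  by (simp add: reflect_def poly_pcompose)

lemma coeff_reflect: "coeff (reflect p) i = (-1) ^ i * coeff p i"
  by (simp add: reflect_def coeff_pcompose_linear[of p "-1"])

lemma degree_reflect [simp]: "degree (reflect p) = degree p"
  by (simp add: reflect_def degree_pcompose)

lemma reflect_eq_0_iff [simp]: "reflect p = 0 \<longleftrightarrow> p = 0"
  by (metis coeff_reflect mult_eq_0_iff poly_eq_iff coeff_0 power_eq_0_iff neg_equal_0_iff_equal zero_neq_one)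

lemma poly_nodal_uminus: "poly (nodal (map uminus X)) z = (-1) ^ length X * poly (nodal X) (- z)"
  by (induction X) (auto simp: poly_nodal_Cons algebra_simps)

lemma vanishes_uminus:
  assumes "vanishes X h"
  shows "vanishes (map uminus X) (\<lambda>z. h (- z))"
proof -
  obtain g where g: "g holomorphic_on UNIV" "\<And>z. h z = poly (nodal X) z * g z"
    using assms by (auto simp: vanishes_def)
  have "(g \<circ> uminus) holomorphic_on UNIV"
    by (rule holomorphic_on_compose) (auto intro!: holomorphic_intros holomorphic_on_subset[OF g(1)])
  then show ?thesis unfolding vanishes_def
    by (intro exI[of _ "\<lambda>z. (-1) ^ length X * g (- z)"])
       (auto simp: g(2) poly_nodal_uminus o_def intro!: holomorphic_intros simp flip: power_mult_distrib mult.assoc)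
qed

lemma edrei_poly_uminus: "poly (edrei_poly (\<lambda>i. - \<alpha> i) k) z = poly (edrei_poly \<alpha> k) (- z)"
  by (simp add: poly_edrei_poly)

text \<open>The reflection turns F (z) into 1 / F (- z). Thus estimates for P carry over to Q, and
  statements about numerator factors to denominator factors.\<close>

lemma vanishes_remainder_reflect:
  assumes "vanishes X (remainder (edrei_poly \<alpha> k) (edrei_poly (\<lambda>i. - \<beta> i) l) P Q)"
  shows "vanishes (map uminus X) (remainder (edrei_poly \<beta> l) (edrei_poly (\<lambda>i. - \<alpha> i) k) (reflect Q) (reflect P))"
proof -
  have "vanishes (map uminus X) (\<lambda>z. (- exp z) * remainder (edrei_poly \<alpha> k) (edrei_poly (\<lambda>i. - \<beta> i) l) P Q (- z))"
    by (intro vanishes_mult vanishes_uminus assms holomorphic_intros)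
  then show ?thesis
  proof (rule vanishes_cong)
    fix z :: complex
    have "exp z * exp (- z) = 1" by (simp flip: exp_add)
    then show "(- exp z) * remainder (edrei_poly \<alpha> k) (edrei_poly (\<lambda>i. - \<beta> i) l) P Q (- z) =
        remainder (edrei_poly \<beta> l) (edrei_poly (\<lambda>i. - \<alpha> i) k) (reflect Q) (reflect P) z"
      by (simp add: remainder_def edrei_poly_uminus algebra_simps)
  qed
qed

lemma admissible_reflect:
  "admissible k l \<alpha> \<beta> S \<Longrightarrow> admissible l k \<beta> \<alpha> (uminus ` S)"
proof -
  have "0 < 1 + u \<longleftrightarrow> - 1 < u" for u :: real by auto
  then show "admissible k l \<alpha> \<beta> S \<Longrightarrow> admissible l k \<beta> \<alpha> (uminus ` S)"
    unfolding admissible_def by simp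
qed

text \<open>The second estimate is the first one for the reflected pair, with - b as left endpoint.
  The constants y and y' are obtained independently of each other.\<close>

lemma exp_pair_asymptotics:
  assumes van: "vanishes X (remainder 1 1 P Q)" and X: "set X \<subseteq> {a..b}"
    and real: "\<And>i. coeff P i \<in> \<real>" "\<And>i. coeff Q i \<in> \<real>"
    and deg: "degree P \<le> dp" "degree Q \<le> dq" "length X = dp + dq + 1"
    and lead: "coeff P dp \<noteq> 0" "coeff Q dq \<noteq> 0"
    and d: "dp \<ge> 1" "dq \<ge> 1" and h: "dp \<le> dq + h" "dq \<le> dp + h"
    and R: "\<bar>a\<bar> \<le> R" "\<bar>b\<bar> \<le> R"
  defines "D \<equiv> (real h + 2 * R) * exp (2 * R) * exp R * R"
  obtains y y' where "1 \<le> y" "y \<le> exp (2 * R)" "1 \<le> y'" "y' \<le> exp (2 * R)"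
    "\<And>z. norm z \<le> R \<Longrightarrow> norm ((-1) ^ dp * of_real (fact dq / fact (dp + dq)) / coeff P dp * poly P z
       - of_real y * exp (- (z - of_real a) / 2)) \<le> D / dq"
    "\<And>z. norm z \<le> R \<Longrightarrow> norm (of_real (fact dp / fact (dp + dq)) / coeff Q dq * poly Q z
       - of_real y' * exp ((z - of_real b) / 2)) \<le> D / dp"
proof -
  define c where "c = 1 / coeff P dp"
  have c: "c \<in> \<real>" "c \<noteq> 0" using lead real by (auto simp: c_def)
  have van1: "vanishes X (remainder 1 1 (smult c P) (smult c Q))" by (rule vanishes_remainder_smult[OF van])
  have real1: "coeff (smult c P) i \<in> \<real>" "coeff (smult c Q) i \<in> \<real>" for i
    using c real by (auto intro: Reals_mult)
  have deg1: "degree (smult c P) \<le> dp" "degree (smult c Q) \<le> dq" using deg c by auto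
  have lead1: "coeff (smult c P) dp = 1" using lead by (simp add: c_def)
  obtain y where y: "1 \<le> y" "y \<le> exp (2 * R)"
    "\<And>z. norm z \<le> R \<Longrightarrow> norm ((-1) ^ dp / of_real (fact (dq + dp) / fact dq) * poly (smult c P) z
       - of_real y * exp (- (z - of_real a) / 2)) \<le> D / dq"
    using exp_interpolant_asymptotics[OF van1 X real1 deg1 deg(3) lead1 d(2) h R] unfolding D_def by blast
  \<comment> \<open>The sign makes the reflected Q monic, as reflection multiplies the coefficient
    of degree dq by (-1) ^ dq.\<close>
  define c' where "c' = (-1) ^ dq / coeff Q dq"
  have c': "c' \<in> \<real>" "c' \<noteq> 0" using lead real by (auto simp: c'_def)
  have van2: "vanishes (map uminus X) (remainder 1 1 (smult c' (reflect Q)) (smult c' (reflect P)))"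
    by (rule vanishes_remainder_smult) (use vanishes_remainder_reflect[of X "\<lambda>_. 0" 0 "\<lambda>_. 0" 0 P Q] van in simp)
  have X2: "set (map uminus X) \<subseteq> {- b..- a}" using X by auto
  have real2: "coeff (smult c' (reflect Q)) i \<in> \<real>" "coeff (smult c' (reflect P)) i \<in> \<real>" for i
    using c' real by (auto simp: coeff_reflect intro!: Reals_mult Reals_power)
  have deg2: "degree (smult c' (reflect Q)) \<le> dq" "degree (smult c' (reflect P)) \<le> dp" using deg c' by auto
  have len2: "length (map uminus X) = dq + dp + 1" using deg(3) by simp
  have lead2: "coeff (smult c' (reflect Q)) dq = 1"
    using lead by (simp add: c'_def coeff_reflect flip: power_add mult_2)
  have R2: "\<bar>- b\<bar> \<le> R" "\<bar>- a\<bar> \<le> R" using R by auto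
  obtain y' where y': "1 \<le> y'" "y' \<le> exp (2 * R)"
    "\<And>z. norm z \<le> R \<Longrightarrow> norm ((-1) ^ dq / of_real (fact (dp + dq) / fact dp) * poly (smult c' (reflect Q)) z
       - of_real y' * exp (- (z - of_real (- b)) / 2)) \<le> D / dp"
    using exp_interpolant_asymptotics[OF van2 X2 real2 deg2 len2 lead2 d(1) h(2,1) R2] unfolding D_def by blast
  show thesis
  proof
    fix z :: complex assume z: "norm z \<le> R"
    show "norm ((-1) ^ dp * of_real (fact dq / fact (dp + dq)) / coeff P dp * poly P z
       - of_real y * exp (- (z - of_real a) / 2)) \<le> D / dq"
      using y(3)[OF z] by (simp add: c_def add.commute)
    have s: "(-1) ^ dq * (-1) ^ dq = (1 :: complex)" by (simp flip: power_add mult_2)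
    have "(-1) ^ dq / of_real (fact (dp + dq) / fact dp) * poly (smult c' (reflect Q)) (- z) =
        ((-1) ^ dq * (-1) ^ dq) * of_real (fact dp / fact (dp + dq)) / coeff Q dq * poly Q z"
      by (simp add: c'_def)
    moreover have "- (- z - of_real (- b)) / 2 = (z - of_real b) / 2" by simp
    ultimately show "norm (of_real (fact dp / fact (dp + dq)) / coeff Q dq * poly Q z
       - of_real y' * exp ((z - of_real b) / 2)) \<le> D / dp"
      using y'(3)[of "- z"] z unfolding s by simp
  qed (use y y' in auto)
qed

section \<open>Uniform convergence of both components\<close>

text \<open>Rolle's theorem and the signs require real coefficients, while convergence is stated for
  complex pairs. A real interpolant exists, and by uniqueness the given pair is a multiple of
  it.\<close>

lemma real_interpolant:
  assumes adm: "admissible k l \<alpha> \<beta> (set X)"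
    and van: "vanishes X (remainder (edrei_poly \<alpha> k) (edrei_poly (\<lambda>i. - \<beta> i) l) P Q)"
    and deg: "degree P \<le> dp" "degree Q \<le> dq" "length X = dp + dq + 1"
    and nz: "P \<noteq> 0 \<or> Q \<noteq> 0" and d: "dp \<ge> 1" "dq \<ge> 1"
  obtains s p q where "\<And>i. coeff p i \<in> \<real>" "\<And>i. coeff q i \<in> \<real>" "degree p \<le> dp" "degree q \<le> dq"
    "vanishes X (remainder (edrei_poly \<alpha> k) (edrei_poly (\<lambda>i. - \<beta> i) l) p q)"
    "coeff p dp \<noteq> 0" "coeff q dq \<noteq> 0" "P = smult s p" "Q = smult s q" "s \<noteq> 0"
proof -
  have len: "length X \<le> dp + dq + 1" "dp + dq + 1 \<le> length X" using deg by auto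
  obtain p q where pq: "\<And>i. coeff p i \<in> \<real>" "\<And>i. coeff q i \<in> \<real>" "degree p \<le> dp" "degree q \<le> dq"
    "p \<noteq> 0 \<or> q \<noteq> 0" "vanishes X (remainder (edrei_poly \<alpha> k) (edrei_poly (\<lambda>i. - \<beta> i) l) p q)"
    using interpolant_exists[OF edrei_poly_real edrei_poly_real len(1)] by metis
  obtain s where s: "P = smult s p" "Q = smult s q"
    using interpolant_proportional[OF adm pq(6) van pq(3,4) deg(1,2) len(2) pq(5) d] by metis
  have "coeff p dp \<noteq> 0" "coeff q dq \<noteq> 0"
    using interpolant_degree_exact[OF adm pq(6,3,4) len(2) pq(5) d] by auto
  moreover have "s \<noteq> 0" using s nz by auto
  ultimately show thesis using that pq s by blast
qed

text \<open>Both components of the interpolant are approximated with the same normalisation \<open>c\<close>. The slack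
  \<open>h\<close> between the degrees is needed in the induction on the number of linear factors, since
  peeling off a factor uses interpolants with neighbouring degrees.\<close>

definition interp_close ::
  "nat \<Rightarrow> nat \<Rightarrow> (nat \<Rightarrow> real) \<Rightarrow> (nat \<Rightarrow> real) \<Rightarrow> real \<Rightarrow> real \<Rightarrow> nat \<Rightarrow> real \<Rightarrow> real \<Rightarrow> nat \<Rightarrow> bool" where
  "interp_close k l \<alpha> \<beta> a b h R \<epsilon> M \<longleftrightarrow> (\<forall>dp dq X P Q.
     dp \<le> dq + h \<and> dq \<le> dp + h \<and> M \<le> dp + dq \<and> set X \<subseteq> {a..b} \<and> length X = dp + dq + 1 \<and>
     degree P \<le> dp \<and> degree Q \<le> dq \<and> (P \<noteq> 0 \<or> Q \<noteq> 0) \<and>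
     vanishes X (remainder (edrei_poly \<alpha> k) (edrei_poly (\<lambda>i. - \<beta> i) l) P Q) \<longrightarrow>
     (\<exists>c. \<forall>z. norm z \<le> R \<longrightarrow>
        norm (c * poly P z - exp (- z / 2) * poly (edrei_poly (\<lambda>i. - \<beta> i) l) z) \<le> \<epsilon> \<and>
        norm (c * poly Q z - exp (z / 2) * poly (edrei_poly \<alpha> k) z) \<le> \<epsilon>))"

definition interp_converges :: "nat \<Rightarrow> nat \<Rightarrow> (nat \<Rightarrow> real) \<Rightarrow> (nat \<Rightarrow> real) \<Rightarrow> real \<Rightarrow> real \<Rightarrow> bool" where
  "interp_converges k l \<alpha> \<beta> a b \<longleftrightarrow> (\<forall>h R \<epsilon>. \<epsilon> > 0 \<longrightarrow> (\<exists>M. interp_close k l \<alpha> \<beta> a b h R \<epsilon> M))"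

lemma interp_converges_reflect:
  assumes "interp_converges k l \<alpha> \<beta> a b"
  shows "interp_converges l k \<beta> \<alpha> (- b) (- a)"
  unfolding interp_converges_def
proof (intro allI impI)
  fix h and R \<epsilon> :: real assume "\<epsilon> > 0"
  then obtain M where M: "interp_close k l \<alpha> \<beta> a b h R \<epsilon> M"
    using assms unfolding interp_converges_def by blast
  show "\<exists>M. interp_close l k \<beta> \<alpha> (- b) (- a) h R \<epsilon> M"
    unfolding interp_close_def
  proof (intro exI[of _ M] allI impI)
    fix dp dq X P Q
    assume A: "dp \<le> dq + h \<and> dq \<le> dp + h \<and> M \<le> dp + dq \<and> set X \<subseteq> {- b..- a} \<and> length X = dp + dq + 1 \<and>
     degree P \<le> dp \<and> degree Q \<le> dq \<and> (P \<noteq> 0 \<or> Q \<noteq> 0) \<and>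
     vanishes X (remainder (edrei_poly \<beta> l) (edrei_poly (\<lambda>i. - \<alpha> i) k) P Q)"
    then have "vanishes (map uminus X) (remainder (edrei_poly \<alpha> k) (edrei_poly (\<lambda>i. - \<beta> i) l) (reflect Q) (reflect P))"
      by (intro vanishes_remainder_reflect) blast
    moreover have "set (map uminus X) \<subseteq> {a..b}" using A by force
    ultimately obtain c where c: "\<And>z. norm z \<le> R \<Longrightarrow>
        norm (c * poly (reflect Q) z - exp (- z / 2) * poly (edrei_poly (\<lambda>i. - \<beta> i) l) z) \<le> \<epsilon> \<and>
        norm (c * poly (reflect P) z - exp (z / 2) * poly (edrei_poly \<alpha> k) z) \<le> \<epsilon>"
      using M[unfolded interp_close_def, rule_format, of dq dp "map uminus X" "reflect Q" "reflect P"] A by auto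
    show "\<exists>c. \<forall>z. norm z \<le> R \<longrightarrow>
        norm (c * poly P z - exp (- z / 2) * poly (edrei_poly (\<lambda>i. - \<alpha> i) k) z) \<le> \<epsilon> \<and>
        norm (c * poly Q z - exp (z / 2) * poly (edrei_poly \<beta> l) z) \<le> \<epsilon>"
    proof (intro exI[of _ c] allI impI)
      fix z :: complex assume "norm z \<le> R"
      then show "norm (c * poly P z - exp (- z / 2) * poly (edrei_poly (\<lambda>i. - \<alpha> i) k) z) \<le> \<epsilon> \<and>
        norm (c * poly Q z - exp (z / 2) * poly (edrei_poly \<beta> l) z) \<le> \<epsilon>"
        using c[of "- z"] by (simp add: edrei_poly_uminus)
    qed
  qed
qed

text \<open>Perturbed form of \<open>(x - \<zeta>) H + (z - x) H = (z - \<zeta>) H\<close>: the condition at \<open>\<zeta>\<close> determines the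
  combination of two approximants up to a factor.\<close>

lemma combine_approximants:
  fixes H G p1 q1 p3 q3 :: "complex \<Rightarrow> complex"
  assumes zero: "\<sigma> * p1 \<zeta> + (\<zeta> - x) * p3 \<zeta> = 0"
    and bounds: "\<And>z. norm z \<le> R \<Longrightarrow> norm (p1 z - H z) \<le> \<delta>" "\<And>z. norm z \<le> R \<Longrightarrow> norm (p3 z - H z) \<le> \<delta>"
      "\<And>z. norm z \<le> R \<Longrightarrow> norm (q1 z - G z) \<le> \<delta>" "\<And>z. norm z \<le> R \<Longrightarrow> norm (q3 z - G z) \<le> \<delta>"
      "\<And>z. norm z \<le> R \<Longrightarrow> norm (H z) \<le> N" "\<And>z. norm z \<le> R \<Longrightarrow> norm (G z) \<le> N"
    and \<zeta>: "norm \<zeta> \<le> R" "norm x \<le> R" and \<eta>: "\<eta> > 0" "norm (H \<zeta>) \<ge> \<eta>" "\<delta> \<le> \<eta> / 2"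
    and z: "norm z \<le> R"
  shows "norm (\<sigma> * p1 z + (z - x) * p3 z - (z - \<zeta>) * H z) \<le> \<delta> * (8 * R + 8 * R * N / \<eta>)"
    "norm (\<sigma> * q1 z + (z - x) * q3 z - (z - \<zeta>) * G z) \<le> \<delta> * (8 * R + 8 * R * N / \<eta>)"
proof -
  have \<delta>: "\<delta> \<ge> 0" using bounds(1)[OF z] norm_ge_zero order_trans by blast
  have R: "R \<ge> 0" using z norm_ge_zero order_trans by blast
  have p1: "norm (p1 \<zeta>) \<ge> \<eta> / 2"
    using bounds(1)[OF \<zeta>(1)] \<eta> norm_triangle_ineq2[of "H \<zeta>" "p1 \<zeta>"] by (simp add: norm_minus_commute)
  then have nz: "p1 \<zeta> \<noteq> 0" using \<eta>(1) by auto
  \<comment> \<open>The exact identity would have \<sigma> = x - \<zeta>; the condition at \<zeta>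
    forces this up to an error proportional to \<delta>.\<close>
  have "(\<sigma> - (x - \<zeta>)) * p1 \<zeta> = (\<zeta> - x) * (p1 \<zeta> - p3 \<zeta>)"
    using zero by (simp add: algebra_simps)
  then have "norm (\<sigma> - (x - \<zeta>)) * norm (p1 \<zeta>) = norm (\<zeta> - x) * norm (p1 \<zeta> - p3 \<zeta>)"
    by (simp flip: norm_mult)
  moreover have "norm (\<zeta> - x) \<le> 2 * R" using norm_triangle_ineq4[of \<zeta> x] \<zeta> by simp
  moreover have "norm (p1 \<zeta> - p3 \<zeta>) \<le> 2 * \<delta>"
    using bounds(1)[OF \<zeta>(1)] bounds(2)[OF \<zeta>(1)] norm_triangle_ineq4[of "p1 \<zeta> - H \<zeta>" "p3 \<zeta> - H \<zeta>"] by simp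
  ultimately have "norm (\<sigma> - (x - \<zeta>)) * norm (p1 \<zeta>) \<le> (2 * R) * (2 * \<delta>)"
    using R mult_mono[of "norm (\<zeta> - x)" "2 * R" "norm (p1 \<zeta> - p3 \<zeta>)" "2 * \<delta>"] by simp
  moreover have "norm (\<sigma> - (x - \<zeta>)) * (\<eta> / 2) \<le> norm (\<sigma> - (x - \<zeta>)) * norm (p1 \<zeta>)"
    using p1 by (intro mult_left_mono) auto
  ultimately have dev: "norm (\<sigma> - (x - \<zeta>)) \<le> 8 * R * \<delta> / \<eta>"
    using \<eta>(1) by (simp add: field_simps)
  have "8 * R * \<delta> / \<eta> \<le> 4 * R"
    using \<eta> R mult_left_mono[OF \<eta>(3), of "8 * R"] by (simp add: field_simps)
  moreover have "norm (x - \<zeta>) \<le> 2 * R" using norm_triangle_ineq4[of x \<zeta>] \<zeta> by simp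
  ultimately have \<sigma>: "norm \<sigma> \<le> 6 * R"
    using dev norm_triangle_sub[of \<sigma> "x - \<zeta>"] by linarith
  have zx: "norm (z - x) \<le> 2 * R" using norm_triangle_ineq4[of z x] z \<zeta> by simp
  have gen: "norm (\<sigma> * u + (z - x) * v - (z - \<zeta>) * J) \<le> \<delta> * (8 * R + 8 * R * N / \<eta>)"
    if "norm (u - J) \<le> \<delta>" "norm (v - J) \<le> \<delta>" "norm J \<le> N" for u v J
  proof -
    have "\<sigma> * u + (z - x) * v - (z - \<zeta>) * J = \<sigma> * (u - J) + (\<sigma> - (x - \<zeta>)) * J + (z - x) * (v - J)"
      by (simp add: algebra_simps)
    also have "norm \<dots> \<le> norm \<sigma> * norm (u - J) + norm (\<sigma> - (x - \<zeta>)) * norm J + norm (z - x) * norm (v - J)"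
      by (intro order_trans[OF norm_triangle_ineq] add_mono) (auto simp: norm_mult)
    also have "\<dots> \<le> (6 * R) * \<delta> + (8 * R * \<delta> / \<eta>) * N + (2 * R) * \<delta>"
      using \<sigma> dev zx that \<delta> R \<eta>(1) by (intro add_mono mult_mono) auto
    also have "\<dots> = \<delta> * (8 * R + 8 * R * N / \<eta>)" by (simp add: algebra_simps)
    finally show ?thesis .
  qed
  show "norm (\<sigma> * p1 z + (z - x) * p3 z - (z - \<zeta>) * H z) \<le> \<delta> * (8 * R + 8 * R * N / \<eta>)"
    "norm (\<sigma> * q1 z + (z - x) * q3 z - (z - \<zeta>) * G z) \<le> \<delta> * (8 * R + 8 * R * N / \<eta>)"
    using gen bounds z by blast+
qed

lemma entire_bounded_on_cball:
  fixes R :: real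
  assumes "f holomorphic_on UNIV"
  obtains N where "\<And>z. norm z \<le> R \<Longrightarrow> norm (f z) \<le> N"
proof -
  have "bounded (f ` cball 0 R)"
    by (intro compact_imp_bounded compact_continuous_image compact_cball)
       (rule continuous_on_subset[OF entire_imp_continuous[OF assms]], simp)
  then show thesis using that by (force simp: bounded_iff)
qed

text \<open>The asymptotics give P and Q only up to separate factors u and u'. At one node P exp =
  Q, and comparison with the limits exp (- z / 2) and exp (z / 2) there shows that u / u' is close
  to 1, so u serves for both.\<close>

lemma interp_converges_exp:
  assumes "a \<le> b"
  shows "interp_converges 0 0 \<alpha> \<beta> a b"
  unfolding interp_converges_def
proof (intro allI impI)
  fix h and R0 \<epsilon> :: real assume \<epsilon>: "\<epsilon> > 0"
  define R where "R = max (max \<bar>a\<bar> \<bar>b\<bar>) (max R0 1)"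
  have R: "\<bar>a\<bar> \<le> R" "\<bar>b\<bar> \<le> R" "R0 \<le> R" "R \<ge> 1" by (auto simp: R_def)
  define D where "D = (real h + 2 * R) * exp (2 * R) * exp R * R"
  have D: "D \<ge> 0" using R by (simp add: D_def)
  \<comment> \<open>The factor 9 is for the final estimate \<eta> + 8 \<eta> exp (2 R) \<le> 9
    \<eta> exp (3 R); \<eta> \<le> 1 / 2 keeps Q away from zero at the chosen node.\<close>
  define \<eta> where "\<eta> = min (1 / 2) (\<epsilon> / (9 * exp (3 * R)))"
  have \<eta>: "0 < \<eta>" "\<eta> \<le> 1 / 2" "\<eta> * (9 * exp (3 * R)) \<le> \<epsilon>" using \<epsilon> by (auto simp: \<eta>_def field_simps min_def)
  \<comment> \<open>The degrees differ by at most h, so a large sum makes each of them large: D / dp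
    and D / dq are then at most \<eta> exp (- 2 R).\<close>
  define M where "M = h + 2 + 2 * nat \<lceil>D * exp (2 * R) / \<eta>\<rceil>"
  show "\<exists>M. interp_close 0 0 \<alpha> \<beta> a b h R0 \<epsilon> M"
    unfolding interp_close_def
  proof (intro exI[of _ M] allI impI)
    fix dp dq X P Q
    assume A: "dp \<le> dq + h \<and> dq \<le> dp + h \<and> M \<le> dp + dq \<and> set X \<subseteq> {a..b} \<and> length X = dp + dq + 1 \<and>
     degree P \<le> dp \<and> degree Q \<le> dq \<and> (P \<noteq> 0 \<or> Q \<noteq> 0) \<and>
     vanishes X (remainder (edrei_poly \<alpha> 0) (edrei_poly (\<lambda>i. - \<beta> i) 0) P Q)"
    have adm: "admissible 0 0 \<alpha> \<beta> (set X)" by (simp add: admissible_def)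
    have "2 * dq \<ge> 2 + 2 * nat \<lceil>D * exp (2 * R) / \<eta>\<rceil>" "2 * dp \<ge> 2 + 2 * nat \<lceil>D * exp (2 * R) / \<eta>\<rceil>"
      using A by (auto simp: M_def)
    then have d: "dp \<ge> 1" "dq \<ge> 1" "D * exp (2 * R) / \<eta> \<le> dp" "D * exp (2 * R) / \<eta> \<le> dq"
      by linarith+
    obtain s p q where pq: "\<And>i. coeff p i \<in> \<real>" "\<And>i. coeff q i \<in> \<real>" "degree p \<le> dp" "degree q \<le> dq"
      "vanishes X (remainder (edrei_poly \<alpha> 0) (edrei_poly (\<lambda>i. - \<beta> i) 0) p q)"
      and lead: "coeff p dp \<noteq> 0" "coeff q dq \<noteq> 0" and s: "P = smult s p" "Q = smult s q" and s0: "s \<noteq> 0"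
      using real_interpolant[OF adm, of P Q dp dq] A d by blast
    have X: "set X \<subseteq> {a..b}" "length X = dp + dq + 1" "dp \<le> dq + h" "dq \<le> dp + h" using A by auto
    obtain y y' where y: "1 \<le> y" "y \<le> exp (2 * R)" "1 \<le> y'" "y' \<le> exp (2 * R)"
      "\<And>z. norm z \<le> R \<Longrightarrow> norm ((-1) ^ dp * of_real (fact dq / fact (dp + dq)) / coeff p dp * poly p z
         - of_real y * exp (- (z - of_real a) / 2)) \<le> D / dq"
      "\<And>z. norm z \<le> R \<Longrightarrow> norm (of_real (fact dp / fact (dp + dq)) / coeff q dq * poly q z
         - of_real y' * exp ((z - of_real b) / 2)) \<le> D / dp"
      using exp_pair_asymptotics[of X p q a b dp dq h R] pq X d lead R
      unfolding D_def edrei_poly_0 by blast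
    have Dd: "D / dp \<le> \<eta> * exp (- 2 * R)" "D / dq \<le> \<eta> * exp (- 2 * R)"
      using d \<eta>(1) by (auto simp: field_simps exp_minus)
    \<comment> \<open>Dividing by the constant made up of y and the shift by c leaves the pure
      exponential. This constant has modulus at least exp (- R).\<close>
    have scale: "\<exists>u. \<forall>z. norm z \<le> R \<longrightarrow> norm (u * g z - exp (r * z / 2)) \<le> \<eta> * exp (- R)"
      if g: "\<And>z. norm z \<le> R \<Longrightarrow> norm (v * g z - of_real y * exp (r * (z - of_real c) / 2)) \<le> \<eta> * exp (- 2 * R)"
        and y: "1 \<le> y" and c: "\<bar>c\<bar> \<le> R" and r: "r = 1 \<or> r = -1" for g :: "complex \<Rightarrow> complex" and v r :: complex and y c :: real
    proof -
      let ?w = "of_real y * exp (- (r * of_real c / 2))"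
      have w: "norm ?w \<ge> exp (- R)"
      proof -
        have "exp (- R) \<le> exp (Re (- (r * of_real c / 2)))" using c r R by auto
        also have "\<dots> \<le> y * exp (Re (- (r * of_real c / 2)))" using y by simp
        finally show ?thesis using y by (simp add: norm_mult norm_exp_eq_Re)
      qed
      have w0: "?w \<noteq> 0" using y by simp
      show ?thesis
      proof (intro exI[of _ "v / ?w"] allI impI)
        fix z :: complex assume z: "norm z \<le> R"
        have "exp (r * (z - of_real c) / 2) = exp (r * z / 2) * exp (- (r * of_real c / 2))"
          by (simp add: exp_add[symmetric] algebra_simps diff_divide_distrib)
        then have "(v / ?w) * g z - exp (r * z / 2) = (v * g z - of_real y * exp (r * (z - of_real c) / 2)) / ?w"
          using w0 by (simp add: divide_simps)
        then have "norm ((v / ?w) * g z - exp (r * z / 2)) = norm (v * g z - of_real y * exp (r * (z - of_real c) / 2)) / norm ?w"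
          by (simp only: norm_divide)
        also have "\<dots> \<le> (\<eta> * exp (- 2 * R)) / exp (- R)"
          using g[OF z] w \<eta>(1) by (intro frac_le) auto
        also have "\<dots> = \<eta> * exp (- R)" by (simp add: exp_diff[symmetric] flip: times_divide_eq_right)
        finally show "norm ((v / ?w) * g z - exp (r * z / 2)) \<le> \<eta> * exp (- R)" .
      qed
    qed
    obtain u where u: "\<And>z. norm z \<le> R \<Longrightarrow> norm (u * poly p z - exp (- z / 2)) \<le> \<eta> * exp (- R)"
      using scale[of "(-1) ^ dp * of_real (fact dq / fact (dp + dq)) / coeff p dp" "poly p" y "-1" a]
        order_trans[OF y(5) Dd(2)] y(1) R by auto
    obtain u' where u': "\<And>z. norm z \<le> R \<Longrightarrow> norm (u' * poly q z - exp (z / 2)) \<le> \<eta> * exp (- R)"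
      using scale[of "of_real (fact dp / fact (dp + dq)) / coeff q dq" "poly q" y' 1 b]
        order_trans[OF y(6) Dd(1)] y(3) R by auto
    obtain x where x: "x \<in> set X" using X(2) by (cases X) auto
    have xR: "norm (of_real x :: complex) \<le> R" using x X(1) R by (auto simp: subset_iff)
    let ?x = "complex_of_real x"
    have pqx: "poly p ?x * exp ?x = poly q ?x"
      using vanishes_at[OF pq(5) x] by (simp add: remainder_def)
    have ex: "norm (exp (?x / 2)) \<ge> exp (- R)" "norm (exp ?x) \<le> exp R"
      using xR by (auto simp: norm_exp_eq_Re)
    have eR: "exp (- R) \<le> 1" using R by simp
    have qx: "norm (u' * poly q ?x) \<ge> exp (- R) / 2"
    proof -
      have "norm (u' * poly q ?x) \<ge> exp (- R) - \<eta> * exp (- R)"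
        using u'[OF xR] ex norm_triangle_ineq3[of "u' * poly q ?x" "exp (?x / 2)"] by linarith
      moreover have "\<eta> * exp (- R) \<le> (1 / 2) * exp (- R)" using \<eta> by (intro mult_right_mono) auto
      ultimately show ?thesis by linarith
    qed
    then have nz: "u' * poly q ?x \<noteq> 0" by (metis exp_gt_zero half_gt_zero norm_zero not_less)
    define \<theta> where "\<theta> = u / u'"
    have "\<theta> * (u' * poly q ?x) = u * poly p ?x * exp ?x"
      using nz pqx by (simp add: \<theta>_def mult_ac)
    then have "(\<theta> - 1) * (u' * poly q ?x) = (u * poly p ?x - exp (- ?x / 2)) * exp ?x - (u' * poly q ?x - exp (?x / 2))"
    proof -
      have "exp (- ?x / 2) * exp ?x = exp (?x / 2)" by (simp flip: exp_add)
      with \<open>\<theta> * _ = _\<close> show ?thesis by (simp add: algebra_simps)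
    qed
    then have "norm (\<theta> - 1) * norm (u' * poly q ?x) \<le> (\<eta> * exp (- R)) * exp R + \<eta> * exp (- R)"
    proof -
      have "norm ((\<theta> - 1) * (u' * poly q ?x)) \<le> norm (u * poly p ?x - exp (- ?x / 2)) * norm (exp ?x) + norm (u' * poly q ?x - exp (?x / 2))"
        unfolding \<open>(\<theta> - 1) * _ = _\<close> by (rule order_trans[OF norm_triangle_ineq4]) (simp only: norm_mult order_refl)
      also have "\<dots> \<le> (\<eta> * exp (- R)) * exp R + \<eta> * exp (- R)"
        using \<eta>(1) by (intro add_mono mult_mono u[OF xR] ex(2) u'[OF xR]) auto
      finally show ?thesis by (simp only: norm_mult)
    qed
    also have "\<dots> \<le> 2 * \<eta>"
    proof -
      have "(\<eta> * exp (- R)) * exp R = \<eta>" by (simp add: exp_minus)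
      moreover have "\<eta> * exp (- R) \<le> \<eta> * 1" using \<eta>(1) eR by (intro mult_left_mono) auto
      ultimately show ?thesis by linarith
    qed
    finally have "norm (\<theta> - 1) * (exp (- R) / 2) \<le> 2 * \<eta>"
      using mult_left_mono[OF qx, of "norm (\<theta> - 1)"] by simp
    then have \<theta>: "norm (\<theta> - 1) \<le> 4 * \<eta> * exp R" by (simp add: exp_minus field_simps)
    have u'nz: "u' \<noteq> 0" using nz by auto
    show "\<exists>c. \<forall>z. norm z \<le> R0 \<longrightarrow>
        norm (c * poly P z - exp (- z / 2) * poly (edrei_poly (\<lambda>i. - \<beta> i) 0) z) \<le> \<epsilon> \<and>
        norm (c * poly Q z - exp (z / 2) * poly (edrei_poly \<alpha> 0) z) \<le> \<epsilon>"
    proof (intro exI[of _ "u / s"] allI impI)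
      fix z :: complex assume "norm z \<le> R0"
      then have z: "norm z \<le> R" using R by linarith
      have e3: "exp (3 * R) \<ge> exp R * exp R" "exp R \<ge> 1" "exp (3 * R) \<ge> 1"
        using R by (auto simp flip: exp_add)
      have small: "\<eta> * exp (- R) \<le> \<eta>" using \<eta>(1) eR by (simp add: mult_left_le)
      have \<eta>e: "8 * \<eta> \<le> \<epsilon>"
      proof -
        have "\<eta> * 9 \<le> \<eta> * (9 * exp (3 * R))" using \<eta>(1) e3 by (intro mult_left_mono) auto
        then show ?thesis using \<eta>(1,3) by linarith
      qed
      have ez: "norm (exp (z / 2)) \<le> exp R"
        using z abs_Re_le_cmod[of z] R by (simp add: norm_exp_eq_Re)
      have "\<theta> * (u' * poly q z) = u * poly q z" using u'nz by (simp add: \<theta>_def)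
      then have eq: "u * poly q z - exp (z / 2) = (u' * poly q z - exp (z / 2)) + (\<theta> - 1) * (u' * poly q z)"
        by (simp only: left_diff_distrib mult_1_left) simp
      have "norm (u' * poly q z) \<le> exp R + \<eta> * exp (- R)"
        using u'[OF z] ez norm_triangle_ineq2[of "u' * poly q z" "exp (z / 2)"] by linarith
      then have "norm (u' * poly q z) \<le> 2 * exp R"
        using small \<eta>(2) e3 by linarith
      then have "norm ((\<theta> - 1) * (u' * poly q z)) \<le> (4 * \<eta> * exp R) * (2 * exp R)"
        unfolding norm_mult[of "\<theta> - 1"] using \<theta> \<eta>(1) by (intro mult_mono) auto
      moreover have "(4 * \<eta> * exp R) * (2 * exp R) = 8 * \<eta> * (exp R * exp R)" by simp
      ultimately have "norm (u * poly q z - exp (z / 2)) \<le> \<eta> + 8 * \<eta> * (exp R * exp R)"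
        using u'[OF z] small norm_triangle_ineq[of "u' * poly q z - exp (z / 2)" "(\<theta> - 1) * (u' * poly q z)"]
        unfolding eq by linarith
      also have "\<dots> \<le> \<epsilon>"
      proof -
        have "\<eta> * 1 \<le> \<eta> * exp (3 * R)" "8 * \<eta> * (exp R * exp R) \<le> 8 * \<eta> * exp (3 * R)"
          using \<eta>(1) e3 by (intro mult_left_mono; simp)+
        then show ?thesis using \<eta>(3) by simp
      qed
      finally have 2: "norm (u * poly q z - exp (z / 2)) \<le> \<epsilon>" .
      have 1: "norm (u * poly p z - exp (- z / 2)) \<le> \<epsilon>"
        using order_trans[OF u[OF z] small] \<eta>e \<eta>(1) by linarith
      from 1 2 show "norm (u / s * poly P z - exp (- z / 2) * poly (edrei_poly (\<lambda>i. - \<beta> i) 0) z) \<le> \<epsilon> \<and>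
        norm (u / s * poly Q z - exp (z / 2) * poly (edrei_poly \<alpha> 0) z) \<le> \<epsilon>"
        using s0 by (simp add: s)
    qed
  qed
qed

text \<open>With L the new factor, (L P, Q) interpolates for the old F, with first degree raised by
  one. Such a pair is a combination of the interpolant (p1, q1) on X and of z - x times the
  interpolant (p3, q3) on X without x, with second degree lowered by one. Both have the same limits,
  and since L P vanishes at the zero \<zeta> of L the combination is known up to a factor.\<close>

lemma interp_converges_mult:
  assumes S: "interp_converges k l \<alpha> \<beta> a b" and adm: "admissible (Suc k) l \<alpha> \<beta> {a..b}"
  shows "interp_converges (Suc k) l \<alpha> \<beta> a b"
proof (cases "\<alpha> (Suc k) = 0")
  case True
  then have "edrei_poly \<alpha> (Suc k) = edrei_poly \<alpha> k" by (simp add: edrei_poly_Suc one_pCons)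
  then show ?thesis using S by (simp only: interp_converges_def interp_close_def)
next
  case False
  define v where "v = \<alpha> (Suc k)"
  have "\<alpha> (Suc k) \<ge> 0" using adm unfolding admissible_def by simp
  then have v: "v > 0" using False by (simp add: v_def)
  define \<zeta> where "\<zeta> = complex_of_real (- 1 / v)"
  let ?A = "edrei_poly \<alpha> k" and ?B = "edrei_poly (\<lambda>i. - \<beta> i) l" and ?L = "[:1, of_real v:] :: complex poly"
  have A': "edrei_poly \<alpha> (Suc k) = ?A * ?L" by (simp add: edrei_poly_Suc v_def)
  have L: "poly ?L z = of_real v * (z - \<zeta>)" for z
    using v by (simp add: \<zeta>_def algebra_simps)
  define H G where "H z = exp (- z / 2) * poly ?B z" and "G z = exp (z / 2) * poly ?A z" for z
  have "poly ?B \<zeta> \<noteq> 0" unfolding \<zeta>_def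
  proof (rule edrei_poly_nonzero_at, intro ballI)
    fix i assume "i \<in> {1..l}"
    then have "\<beta> i \<ge> 0" using adm unfolding admissible_def by blast
    then have "\<beta> i * (1 / v) \<ge> 0" using v by (intro mult_nonneg_nonneg) auto
    then show "1 + - \<beta> i * (- 1 / v) > 0" by simp
  qed
  then have H\<zeta>: "norm (H \<zeta>) > 0" by (simp add: H_def)
  define \<eta> where "\<eta> = norm (H \<zeta>)"
  show ?thesis
    unfolding interp_converges_def
  proof (intro allI impI)
    fix h and R0 \<epsilon> :: real assume \<epsilon>: "\<epsilon> > 0"
    \<comment> \<open>The bound R \<ge> 2 / v + 1 keeps the circle of radius R at distance at least
      1 / v from \<zeta>, so that L has modulus at least 1 on it.\<close>
    define R where "R = max (max \<bar>a\<bar> \<bar>b\<bar>) (max R0 (2 / v + 1))"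
    have R: "\<bar>a\<bar> \<le> R" "\<bar>b\<bar> \<le> R" "R0 \<le> R" "2 / v + 1 \<le> R" by (auto simp: R_def)
    have "2 / v > 0" using v by simp
    then have R1: "R \<ge> 1" using R by linarith
    obtain N1 where N1: "\<And>z. norm z \<le> R \<Longrightarrow> norm (H z) \<le> N1"
      by (rule entire_bounded_on_cball[of H R]) (auto simp: H_def[abs_def] intro!: holomorphic_intros)
    obtain N2 where N2: "\<And>z. norm z \<le> R \<Longrightarrow> norm (G z) \<le> N2"
      by (rule entire_bounded_on_cball[of G R]) (auto simp: G_def[abs_def] intro!: holomorphic_intros)
    define N where "N = max 0 (max N1 N2)"
    have N: "norm z \<le> R \<Longrightarrow> norm (H z) \<le> N" "norm z \<le> R \<Longrightarrow> norm (G z) \<le> N" for z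
      using N1[of z] N2[of z] by (auto simp: N_def le_max_iff_disj)
    define C where "C = 8 * R + 8 * R * N / \<eta>"
    have \<eta>: "\<eta> > 0" using H\<zeta> by (simp add: \<eta>_def)
    have C: "C > 0" unfolding C_def using R1 \<eta> by (intro add_pos_nonneg) (auto simp: N_def)
    define \<delta> where "\<delta> = min (\<eta> / 2) (\<epsilon> / (v * C))"
    have \<delta>: "\<delta> > 0" "\<delta> \<le> \<eta> / 2" "v * (\<delta> * C) \<le> \<epsilon>"
      using \<eta> \<epsilon> v C by (auto simp: \<delta>_def min_def field_simps)
    \<comment> \<open>Lowering one degree can increase the difference of the degrees by one, hence
      \<open>Suc h\<close>.\<close>
    obtain M0 where "interp_close k l \<alpha> \<beta> a b (Suc h) R \<delta> M0"
      using S \<delta>(1) unfolding interp_converges_def by blast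
    note M0 = this[unfolded interp_close_def, rule_format]
    show "\<exists>M. interp_close (Suc k) l \<alpha> \<beta> a b h R0 \<epsilon> M"
      unfolding interp_close_def
    \<comment> \<open>The summand h + 4 ensures dq \<ge> 2, so that the lowered degree is still
      positive, and keeps dp + (dq - 1) above M0.\<close>
    proof (intro exI[of _ "M0 + h + 4"] allI impI)
      fix dp dq X P Q
      assume hyp: "dp \<le> dq + h \<and> dq \<le> dp + h \<and> M0 + h + 4 \<le> dp + dq \<and> set X \<subseteq> {a..b} \<and>
         length X = dp + dq + 1 \<and> degree P \<le> dp \<and> degree Q \<le> dq \<and> (P \<noteq> 0 \<or> Q \<noteq> 0) \<and>
         vanishes X (remainder (edrei_poly \<alpha> (Suc k)) ?B P Q)"
      have d: "dp \<ge> 1" "dq \<ge> 1" "dq - 1 \<ge> 1" "dp \<le> dq + h" "dq \<le> dp + h" "M0 + h + 4 \<le> dp + dq" using hyp by linarith+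
      obtain x X' where X: "X = x # X'" using hyp by (cases X) auto
      have xab: "x \<in> {a..b}" "set X' \<subseteq> {a..b}" "set X \<subseteq> {a..b}" using hyp X by auto
      have len: "length X' = dp + (dq - 1) + 1" "length X = dp + dq + 1" using hyp X d by auto
      have admX: "admissible k l \<alpha> \<beta> (set X)" "admissible k l \<alpha> \<beta> (set X')"
        using adm X xab by (auto simp: admissible_def)
      let ?P = "?L * P"
      have van: "vanishes X (remainder ?A ?B ?P Q)"
      proof (rule vanishes_cong)
        show "vanishes X (remainder (edrei_poly \<alpha> (Suc k)) ?B P Q)" using hyp by blast
        show "remainder (edrei_poly \<alpha> (Suc k)) ?B P Q z = remainder ?A ?B ?P Q z" for z
          unfolding remainder_def A' poly_mult by (simp only: mult_ac)
      qed
      have "length X \<le> dp + dq + 1" "length X' \<le> dp + (dq - 1) + 1" using len by auto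
      obtain p1 q1 where pq1: "degree p1 \<le> dp" "degree q1 \<le> dq" "p1 \<noteq> 0 \<or> q1 \<noteq> 0" "vanishes X (remainder ?A ?B p1 q1)"
        using interpolant_exists[OF edrei_poly_real edrei_poly_real \<open>length X \<le> _\<close>] by metis
      obtain p3 q3 where pq3: "degree p3 \<le> dp" "degree q3 \<le> dq - 1" "p3 \<noteq> 0 \<or> q3 \<noteq> 0" "vanishes X' (remainder ?A ?B p3 q3)"
        using interpolant_exists[OF edrei_poly_real edrei_poly_real \<open>length X' \<le> _\<close>] by metis
      obtain c1 where c1: "\<And>z. norm z \<le> R \<Longrightarrow> norm (c1 * poly p1 z - H z) \<le> \<delta>" "\<And>z. norm z \<le> R \<Longrightarrow> norm (c1 * poly q1 z - G z) \<le> \<delta>"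
        using M0[of dp dq X p1 q1] pq1 d len xab unfolding H_def G_def by auto
      obtain c3 where c3: "\<And>z. norm z \<le> R \<Longrightarrow> norm (c3 * poly p3 z - H z) \<le> \<delta>" "\<And>z. norm z \<le> R \<Longrightarrow> norm (c3 * poly q3 z - G z) \<le> \<delta>"
      proof -
        have "dp \<le> (dq - 1) + Suc h" "dq - 1 \<le> dp + Suc h" "M0 \<le> dp + (dq - 1)" using d by linarith+
        then show thesis
          using M0[of dp "dq - 1" X' p3 q3] pq3 len xab that unfolding H_def G_def by blast
      qed
      have \<zeta>R: "norm \<zeta> \<le> R"
      proof -
        have "norm \<zeta> = 1 / v" using v by (simp add: \<zeta>_def norm_divide)
        also have "\<dots> \<le> 2 / v" using v by (simp add: divide_right_mono)
        finally show ?thesis using R by linarith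
      qed
      have c0: "c1 \<noteq> 0" "c3 \<noteq> 0" "poly p1 \<zeta> \<noteq> 0"
      proof -
        have "norm (H \<zeta>) > \<delta>" using \<delta>(2) \<eta> unfolding \<eta>_def by linarith
        then show "c1 \<noteq> 0" "c3 \<noteq> 0" "poly p1 \<zeta> \<noteq> 0"
          using c1(1)[OF \<zeta>R] c3(1)[OF \<zeta>R] by auto
      qed
      let ?X = "[:- of_real x, 1:] :: complex poly"
      have van3: "vanishes X (remainder ?A ?B (?X * p3) (?X * q3))"
        unfolding X vanishes_Cons
        by (rule exI[of _ "remainder ?A ?B p3 q3"]) (use pq3 in \<open>auto simp: remainder_def algebra_simps\<close>)
      have lead3: "coeff p3 dp \<noteq> 0"
        using interpolant_degree_exact(1)[OF admX(2) pq3(4,1,2) _ pq3(3) d(1,3)] len by simp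
      have degX: "degree (?X * p3) \<le> Suc dp" "degree (?X * q3) \<le> dq" "degree ?P \<le> Suc dp"
      proof -
        have "degree ?L \<le> 1" by simp
        then show "degree ?P \<le> Suc dp" using hyp degree_mult_le[of ?L P] by linarith
        have "degree ?X \<le> 1" by simp
        then show "degree (?X * p3) \<le> Suc dp" "degree (?X * q3) \<le> dq"
          using pq3 d degree_mult_le[of ?X p3] degree_mult_le[of ?X q3] by linarith+
      qed
      \<comment> \<open>Chosen to cancel the coefficient of degree dp + 1 in U; what remains is
        proportional to (p1, q1).\<close>
      define s2 where "s2 = coeff ?P (Suc dp) / coeff p3 dp"
      define U V where "U = ?P - smult s2 (?X * p3)" and "V = Q - smult s2 (?X * q3)"
      have vanUV: "vanishes X (remainder ?A ?B U V)"
        unfolding U_def V_def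
        by (rule vanishes_cong[OF vanishes_diff[OF van vanishes_remainder_smult[OF van3]]])
           (simp only: remainder_diff)
      have "coeff (?X * p3) (Suc dp) = coeff p3 dp"
        using pq3(1) by (simp add: coeff_eq_0)
      then have "coeff U (Suc dp) = 0" using lead3 by (simp add: U_def s2_def del: mult_pCons_left)
      moreover have "degree U \<le> Suc dp" unfolding U_def
        using degX by (intro degree_diff_le) (auto intro: order_trans[OF degree_smult_le] simp del: mult_pCons_left)
      ultimately have degU: "degree U \<le> dp"
        by (intro degree_le) (metis coeff_eq_0 le_less_trans less_antisym not_less_eq_eq order_le_less Suc_leI)
      have degV: "degree V \<le> dq" unfolding V_def
        using degX hyp by (intro degree_diff_le) (auto intro: order_trans[OF degree_smult_le] simp del: mult_pCons_left)
      obtain s1 where s1: "U = smult s1 p1" "V = smult s1 q1"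
        using interpolant_proportional[OF admX(1) pq1(4) vanUV pq1(1,2) degU degV _ pq1(3) d(1,2)] len by auto
      have P_eq: "poly ?L z * poly P z = s1 * poly p1 z + s2 * ((z - of_real x) * poly p3 z)"
        and Q_eq: "poly Q z = s1 * poly q1 z + s2 * ((z - of_real x) * poly q3 z)" for z
      proof -
        have PQ: "?P = smult s1 p1 + smult s2 (?X * p3)" "Q = smult s1 q1 + smult s2 (?X * q3)"
          using s1 unfolding U_def V_def by (metis diff_add_cancel)+
        have X: "poly ?X z = z - of_real x" by simp
        show "poly ?L z * poly P z = s1 * poly p1 z + s2 * ((z - of_real x) * poly p3 z)"
          using arg_cong[OF PQ(1), of "\<lambda>p. poly p z"] by (simp only: poly_mult poly_add poly_smult X)
        show "poly Q z = s1 * poly q1 z + s2 * ((z - of_real x) * poly q3 z)"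
          using arg_cong[OF PQ(2), of "\<lambda>p. poly p z"] by (simp only: poly_mult poly_add poly_smult X)
      qed
      \<comment> \<open>Otherwise L P would be a multiple of p1, which is nonzero at \<zeta> since
        its scaled version is close to H there.\<close>
      have s2: "s2 \<noteq> 0"
      proof
        assume s2: "s2 = 0"
        then have "s1 * poly p1 \<zeta> = 0" using P_eq[of \<zeta>] by (simp add: L del: poly_pCons)
        then have "s1 = 0" using c0 by simp
        then have "?P = 0" "Q = 0" using s1 s2 by (auto simp: U_def V_def simp del: mult_pCons_left)
        then have "P = 0" "Q = 0" by (auto simp del: mult_pCons_left)
        then show False using hyp by blast
      qed
      define \<sigma> where "\<sigma> = s1 * c3 / (s2 * c1)"
      have zero: "\<sigma> * (c1 * poly p1 \<zeta>) + (\<zeta> - of_real x) * (c3 * poly p3 \<zeta>) = 0"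
      proof -
        have "s1 * poly p1 \<zeta> + s2 * ((\<zeta> - of_real x) * poly p3 \<zeta>) = 0"
          using P_eq[of \<zeta>] by (simp add: L del: poly_pCons)
        then have "c3 / s2 * (s1 * poly p1 \<zeta> + s2 * ((\<zeta> - of_real x) * poly p3 \<zeta>)) = 0" by simp
        then show ?thesis using s2 c0 by (simp add: \<sigma>_def field_simps)
      qed
      have xR: "norm (of_real x :: complex) \<le> R" using xab R by auto
      note comb = combine_approximants[where R = R and H = H and G = G and \<delta> = \<delta> and N = N and \<eta> = \<eta>,
          OF zero c1(1) c3(1) c1(2) c3(2) N \<zeta>R xR \<eta> _ \<delta>(2), folded C_def]
      define c where "c = of_real v * c3 / s2"
      have cP: "norm (poly ?L z * (c * poly P z - H z)) \<le> \<epsilon>" and cQ: "norm (c * poly Q z - poly ?L z * G z) \<le> \<epsilon>"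
        if z: "norm z \<le> R" for z
      proof -
        have eq: "c * (s1 * u + s2 * ((z - of_real x) * u')) - of_real v * (z - \<zeta>) * J
            = of_real v * (\<sigma> * (c1 * u) + (z - of_real x) * (c3 * u') - (z - \<zeta>) * J)" for u u' J
          using s2 c0 by (simp add: c_def \<sigma>_def field_simps)
        have "poly ?L z * (c * poly P z - H z) = c * (poly ?L z * poly P z) - poly ?L z * H z"
          by (simp add: algebra_simps del: poly_pCons)
        also have "\<dots> = of_real v * (\<sigma> * (c1 * poly p1 z) + (z - of_real x) * (c3 * poly p3 z) - (z - \<zeta>) * H z)"
          unfolding eq[symmetric] by (simp only: P_eq) (simp only: L)
        also have "norm \<dots> \<le> v * (\<delta> * C)"
          unfolding norm_mult[of "of_real v"] using comb(1)[OF _ _ _ _ _ _ _ z] v c1 c3 N by (simp add: \<eta>_def mult_left_mono)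
        finally show "norm (poly ?L z * (c * poly P z - H z)) \<le> \<epsilon>" using \<delta>(3) by linarith
        have "c * poly Q z - poly ?L z * G z = of_real v * (\<sigma> * (c1 * poly q1 z) + (z - of_real x) * (c3 * poly q3 z) - (z - \<zeta>) * G z)"
          unfolding Q_eq eq[symmetric] L by simp
        also have "norm \<dots> \<le> v * (\<delta> * C)"
          unfolding norm_mult[of "of_real v"] using comb(2)[OF _ _ _ _ _ _ _ z] v c1 c3 N by (simp add: \<eta>_def mult_left_mono)
        finally show "norm (c * poly Q z - poly ?L z * G z) \<le> \<epsilon>" using \<delta>(3) by linarith
      qed
      have cP': "norm (c * poly P z - H z) \<le> \<epsilon>" if z: "norm z \<le> R" for z
      proof (rule maximum_modulus_frontier[of "\<lambda>z. c * poly P z - H z" "cball 0 R"])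
        show "(\<lambda>z. c * poly P z - H z) holomorphic_on interior (cball 0 R)"
          unfolding H_def by (intro holomorphic_intros) auto
        show "continuous_on (closure (cball 0 R)) (\<lambda>z. c * poly P z - H z)"
          unfolding H_def by (intro continuous_intros) auto
        fix w :: complex assume "w \<in> frontier (cball 0 R)"
        then have w: "norm w = R" using R1 by (simp add: frontier_cball)
        have "norm (poly ?L w) = v * norm (w - \<zeta>)" using v by (simp add: L norm_mult del: poly_pCons)
        moreover have "norm (w - \<zeta>) \<ge> R - 1 / v"
          using norm_triangle_ineq2[of w \<zeta>] w v by (simp add: \<zeta>_def norm_divide)
        then have "norm (w - \<zeta>) \<ge> 1 / v" using R(4) by (simp add: field_simps) 
        ultimately have "norm (poly ?L w) \<ge> 1" using v by (simp add: field_simps)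
        then have "1 * norm (c * poly P w - H w) \<le> norm (poly ?L w) * norm (c * poly P w - H w)"
          by (intro mult_right_mono) auto
        then show "norm (c * poly P w - H w) \<le> \<epsilon>"
          using cP[of w] w unfolding norm_mult[of "poly ?L w"] by linarith
      qed (use z in auto)
      show "\<exists>c. \<forall>z. norm z \<le> R0 \<longrightarrow> norm (c * poly P z - exp (- z / 2) * poly ?B z) \<le> \<epsilon> \<and>
          norm (c * poly Q z - exp (z / 2) * poly (edrei_poly \<alpha> (Suc k)) z) \<le> \<epsilon>"
      proof (intro exI[of _ c] allI impI conjI)
        fix z :: complex assume "norm z \<le> R0"
        then have z: "norm z \<le> R" using R by linarith
        show "norm (c * poly P z - exp (- z / 2) * poly ?B z) \<le> \<epsilon>" using cP'[OF z] by (simp add: H_def)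
        show "norm (c * poly Q z - exp (z / 2) * poly (edrei_poly \<alpha> (Suc k)) z) \<le> \<epsilon>"
          using cQ[OF z] by (simp only: A' poly_mult G_def mult_ac)
      qed
    qed
  qed
qed

text \<open>Numerator factors are added while no denominator is present; each denominator factor is
  then a numerator factor of the reflected problem.\<close>

theorem interp_converges:
  assumes "a \<le> b" and "admissible k l \<alpha> \<beta> {a..b}"
  shows "interp_converges k l \<alpha> \<beta> a b"
proof -
  have base: "interp_converges k 0 \<alpha> \<beta> a b" if "admissible k 0 \<alpha> \<beta> {a..b}" for k
    using that
  proof (induction k)
    case 0
    show ?case using assms(1) by (rule interp_converges_exp)
  next
    case (Suc k)
    then have "admissible k 0 \<alpha> \<beta> {a..b}" by (auto simp: admissible_def)
    then show ?case using Suc interp_converges_mult by blast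
  qed
  show ?thesis using assms(2)
  proof (induction l)
    case 0
    then show ?case by (rule base)
  next
    case (Suc l)
    then have "admissible k l \<alpha> \<beta> {a..b}" by (auto simp: admissible_def)
    then have "interp_converges l k \<beta> \<alpha> (- b) (- a)"
      using Suc interp_converges_reflect by blast
    moreover have "admissible (Suc l) k \<beta> \<alpha> {- b..- a}"
      using admissible_reflect[OF Suc.prems] by simp
    ultimately have "interp_converges (Suc l) k \<beta> \<alpha> (- b) (- a)" by (rule interp_converges_mult)
    then show ?case using interp_converges_reflect by fastforce
  qed
qed

subsection \<open>Zeros of the linearised error of AAA approximants\<close>

lemma exists_common_kernel:
  fixes \<phi> :: "'b \<Rightarrow> 'i \<Rightarrow> real"
  assumes "finite J" "finite I" "card I > card J"
  shows "\<exists>c :: 'i \<Rightarrow> real. (\<exists>i\<in>I. c i \<noteq> 0) \<and> (\<forall>j\<in>J. (\<Sum>i\<in>I. \<phi> j i * c i) = 0)"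
  using assms
proof (induction J arbitrary: I \<phi> rule: finite_induct)
  case empty
  then have "I \<noteq> {}" by auto
  then show ?case by (intro exI[of _ "\<lambda>_. 1"]) auto
next
  case (insert a J)
  show ?case
  proof (cases "\<forall>i\<in>I. \<phi> a i = 0")
    case True
    then show ?thesis using insert.IH[of I \<phi>] insert.prems insert.hyps by auto
  next
    case False
    then obtain k where k: "k \<in> I" "\<phi> a k \<noteq> 0" by blast
    define \<rho> where "\<rho> i = \<phi> a i / \<phi> a k" for i
    let ?K = "I - {k}"
    have "\<exists>c. (\<exists>i\<in>?K. c i \<noteq> 0) \<and> (\<forall>j\<in>J. (\<Sum>i\<in>?K. (\<phi> j i - \<rho> i * \<phi> j k) * c i) = 0)"
      using insert.prems insert.hyps k by (intro insert.IH) auto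
    then obtain c where c: "\<exists>i\<in>?K. c i \<noteq> 0" "\<forall>j\<in>J. (\<Sum>i\<in>?K. (\<phi> j i - \<rho> i * \<phi> j k) * c i) = 0" by blast
    define d where "d i = (if i = k then - (\<Sum>i\<in>?K. \<rho> i * c i) else c i)" for i
    have eq: "(\<Sum>i\<in>I. \<phi> j i * d i) = (\<Sum>i\<in>?K. (\<phi> j i - \<rho> i * \<phi> j k) * c i)" for j
    proof -
      have "(\<Sum>i\<in>I. \<phi> j i * d i) = \<phi> j k * d k + (\<Sum>i\<in>?K. \<phi> j i * d i)"
        using insert.prems(1) k(1) by (rule sum.remove)
      also have "(\<Sum>i\<in>?K. \<phi> j i * d i) = (\<Sum>i\<in>?K. \<phi> j i * c i)" by (rule sum.cong) (auto simp: d_def)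
      also have "\<phi> j k * d k + \<dots> = (\<Sum>i\<in>?K. (\<phi> j i - \<rho> i * \<phi> j k) * c i)"
        by (simp add: d_def left_diff_distrib right_diff_distrib sum_subtractf sum_distrib_left mult_ac)
      finally show ?thesis .
    qed
    have z: "\<phi> a i - \<rho> i * \<phi> a k = 0" for i using k by (simp add: \<rho>_def)
    have "(\<Sum>i\<in>I. \<phi> a i * d i) = 0" unfolding eq by (simp only: z mult_zero_left sum.neutral_const)
    moreover have "\<exists>i\<in>I. d i \<noteq> 0" using c(1) by (auto simp: d_def)
    ultimately show ?thesis using c(2) eq by (intro exI[of _ d]) auto
  qed
qed

text \<open>The complement of the support is a union of open null sets, and a countable basis
  reduces it to countably many of them.\<close>

lemma AE_measure_support:
  fixes M :: "real measure"
  assumes sets: "sets M = sets borel"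
  shows "AE x in M. x \<in> measure_support M"
proof -
  obtain \<B> :: "real set set" where \<B>: "countable \<B>" "topological_basis \<B>"
    using ex_countable_basis by blast
  define \<N> where "\<N> = {U\<in>\<B>. emeasure M U = 0}"
  have sub: "- measure_support M \<subseteq> \<Union>\<N>"
  proof
    fix x assume "x \<in> - measure_support M"
    then obtain U where U: "open U" "x \<in> U" "emeasure M U = 0"
      by (auto simp: measure_support_def zero_less_iff_neq_zero)
    obtain V where V: "V \<in> \<B>" "x \<in> V" "V \<subseteq> U" using topological_basisE[OF \<B>(2) U(1,2)] by blast
    have "emeasure M V \<le> emeasure M U" using V(3) U(1) sets by (intro emeasure_mono) auto
    then show "x \<in> \<Union>\<N>" using V U by (auto simp: \<N>_def)
  qed
  have "\<Union>\<N> \<in> null_sets M"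
  proof (rule null_sets_UN'[of \<N> "\<lambda>U. U", simplified])
    show "countable \<N>" using \<B>(1) by (simp add: \<N>_def)
    fix U assume "U \<in> \<N>"
    moreover from this have "open U" using \<B>(2) topological_basis_open by (auto simp: \<N>_def)
    ultimately show "U \<in> null_sets M" using sets by (auto simp: \<N>_def null_sets_def)
  qed
  then have "AE x in M. x \<notin> \<Union>\<N>" by (rule AE_not_in)
  then show ?thesis by eventually_elim (use sub in blast)
qed

lemma sign_const_interval:
  assumes "continuous_on {a..b} (g :: real \<Rightarrow> real)" "\<forall>x\<in>{a..b}. g x \<noteq> 0"
  shows "(\<forall>x\<in>{a..b}. g x > 0) \<or> (\<forall>x\<in>{a..b}. g x < 0)"
proof (rule ccontr)
  assume "\<not> ?thesis"
  then obtain x y where xy: "x \<in> {a..b}" "y \<in> {a..b}" "g x < 0" "g y > 0"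
    using assms(2) by (metis linorder_neqE_linordered_idom)
  have "connected (g ` {a..b})" by (intro connected_continuous_image assms) simp
  then have "0 \<in> g ` {a..b}" using xy by (meson connectedD_interval imageI less_imp_le)
  then show False using assms(2) by auto
qed

lemma poly_nodal_of_real: "poly (nodal X) (of_real x) = of_real (\<Prod>y\<leftarrow>X. x - y)"
  by (induction X) (auto simp: poly_nodal_Cons)

lemma coeff_linear_prod_real:
  "coeff (\<Prod>j\<in>K. [:- of_real (t j), 1:]) i \<in> (\<real> :: complex set)"
proof (induction K arbitrary: i rule: infinite_finite_induct)
  case (insert j K)
  then show ?case by (auto simp: coeff_pCons split: nat.splits)
qed (auto simp: coeff_1)

section \<open>Loewner kernels as a Chebyshev system\<close>

locale aaa_setting =
  fixes k l :: nat and \<alpha> \<beta> :: "nat \<Rightarrow> real" and a b :: real and n :: nat and t :: "nat \<Rightarrow> real"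
    and f :: "real \<Rightarrow> real" and A B :: "complex poly"
  assumes adm: "admissible k l \<alpha> \<beta> {a..b}"
    and t_mono: "strict_mono_on {1..n} t" and t_in: "t ` {1..n} \<subseteq> {a..b}"
    and f_def: "f = edrei_fun k l \<alpha> \<beta>"
    and A_def: "A = edrei_poly \<alpha> k" and B_def: "B = edrei_poly (\<lambda>i. - \<beta> i) l"
begin

definition Br :: "real \<Rightarrow> real" where "Br x = (\<Prod>i=1..l. 1 - \<beta> i * x)"

lemma Br_pos: "x \<in> {a..b} \<Longrightarrow> Br x > 0"
  using adm by (auto simp: Br_def admissible_def intro!: prod_pos)

lemma f_Br:
  assumes "Br x \<noteq> 0"
  shows "f x * Br x = exp x * (\<Prod>i=1..k. 1 + \<alpha> i * x)"
proof -
  have "f x = exp x * ((\<Prod>i=1..k. 1 + \<alpha> i * x) / Br x)"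
    by (simp add: f_def edrei_fun_def Br_def)
  then show ?thesis using assms by simp
qed

lemma poly_B: "poly B (of_real x) = of_real (Br x)"
  by (simp add: B_def poly_edrei_poly Br_def)

lemma A_f: "x \<in> {a..b} \<Longrightarrow> poly A (of_real x) * exp (of_real x) = of_real (f x * Br x)"
proof -
  assume x: "x \<in> {a..b}"
  have "f x * Br x = exp x * (\<Prod>i=1..k. 1 + \<alpha> i * x)"
    using f_Br Br_pos[OF x] by simp
  then show ?thesis by (simp add: A_def poly_edrei_poly exp_of_real mult.commute)
qed

lemma g_exists:
  "\<forall>i\<in>{1..n}. \<exists>g. g holomorphic_on UNIV \<and>
     (\<forall>z. poly A z * exp z - of_real (f (t i)) * poly B z = (z - of_real (t i)) * g z)"
proof
  fix i assume i: "i \<in> {1..n}"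
  let ?h = "\<lambda>z. poly A z * exp z - of_real (f (t i)) * poly B z"
  have "t i \<in> {a..b}" using i t_in by blast
  then have "?h (of_real (t i)) = 0" using A_f poly_B by (simp only: of_real_mult) simp
  moreover have "?h holomorphic_on UNIV" by (intro holomorphic_intros)
  ultimately obtain g where "g holomorphic_on UNIV" "\<And>z. ?h z = (z - of_real (t i)) * g z"
    using entire_factor by blast
  then show "\<exists>g. g holomorphic_on UNIV \<and> (\<forall>z. ?h z = (z - of_real (t i)) * g z)" by blast
qed

text \<open>On [a, b] this is the Loewner kernel with second argument \<open>t i\<close>, multiplied
  by the denominator B. Being entire, it allows zeros to be counted with multiplicity.\<close>

definition g :: "nat \<Rightarrow> complex \<Rightarrow> complex" where
  "g = (SOME g. \<forall>i\<in>{1..n}. g i holomorphic_on UNIV \<and>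
     (\<forall>z. poly A z * exp z - of_real (f (t i)) * poly B z = (z - of_real (t i)) * g i z))"

lemma g:
  assumes "i \<in> {1..n}"
  shows "g i holomorphic_on UNIV"
    "poly A z * exp z - of_real (f (t i)) * poly B z = (z - of_real (t i)) * g i z"
proof -
  have "\<exists>g. \<forall>i\<in>{1..n}. g i holomorphic_on UNIV \<and>
     (\<forall>z. poly A z * exp z - of_real (f (t i)) * poly B z = (z - of_real (t i)) * g i z)"
    using g_exists by (rule bchoice)
  then have "\<forall>i\<in>{1..n}. g i holomorphic_on UNIV \<and>
     (\<forall>z. poly A z * exp z - of_real (f (t i)) * poly B z = (z - of_real (t i)) * g i z)"
    unfolding g_def by (rule someI_ex)
  then show "g i holomorphic_on UNIV"
    "poly A z * exp z - of_real (f (t i)) * poly B z = (z - of_real (t i)) * g i z" using assms by blast+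
qed

lemma g_symmetric:
  assumes "i \<in> {1..n}"
  shows "conj_symmetric (g i)"
proof (rule conj_symmetric_cofactor[of "\<lambda>z. poly A z * exp z - of_real (f (t i)) * poly B z" "[t i]"])
  have "coeff A j \<in> \<real>" "coeff B j \<in> \<real>" for j unfolding A_def B_def by (rule edrei_poly_real)+
  then show "conj_symmetric (\<lambda>z. poly A z * exp z - of_real (f (t i)) * poly B z)"
    by (simp add: conj_symmetric_def poly_cnj_real exp_cnj)
qed (use g[OF assms] in \<open>auto simp: poly_nodal_Cons\<close>)

definition h :: "(nat \<Rightarrow> real) \<Rightarrow> complex \<Rightarrow> complex" where
  "h c z = (\<Sum>i=1..n. of_real (c i) * g i z)"

definition E :: "(nat \<Rightarrow> real) \<Rightarrow> real \<Rightarrow> real" where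
  "E c x = (\<Sum>i=1..n. c i * loewner_kernel f x (t i))"

lemma h_holomorphic: "h c holomorphic_on UNIV"
  unfolding h_def using g by (intro holomorphic_intros) auto

lemma h_symmetric: "conj_symmetric (h c)"
  using g_symmetric by (simp add: conj_symmetric_def h_def)

lemma loewner_eq:
  assumes "i \<in> {1..n}" "x \<in> {a..b}" "a < b"
  shows "loewner_kernel f x (t i) = Re (g i (of_real x)) / Br x"
proof -
  have ti: "t i \<in> {a..b}" using assms(1) t_in by blast
  have off: "f y - f (t i) = (y - t i) * (Re (g i (of_real y)) / Br y)" if y: "y \<in> {a..b}" for y
  proof -
    have "of_real (f y * Br y - f (t i) * Br y) = of_real (y - t i) * g i (of_real y)"
      using g(2)[OF assms(1), of "of_real y"] A_f[OF y] by (simp add: poly_B)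
    then have "Re (of_real (f y * Br y - f (t i) * Br y)) = Re (of_real (y - t i) * g i (of_real y))"
      by (rule arg_cong)
    then have "(f y - f (t i)) * Br y = (y - t i) * Re (g i (of_real y))"
      by (simp add: left_diff_distrib)
    then show ?thesis using Br_pos[OF y] by (simp add: field_simps)
  qed
  show ?thesis
  proof (cases "x = t i")
    case False
    then show ?thesis using off[OF assms(2)] by (simp add: loewner_kernel_def)
  next
    case True
    \<comment> \<open>The diagonal value is a two-sided derivative, so the factorisation is required
      on a neighbourhood of \<open>t i\<close>, which leaves [a, b] if \<open>t i\<close> is an
      endpoint. Positivity of \<open>Br\<close> extends there by continuity.\<close>
    have "Br (t i) > 0" using Br_pos ti by blast
    moreover have "continuous (at (t i)) Br" unfolding Br_def by (intro continuous_intros)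
    ultimately have "\<forall>\<^sub>F y in nhds (t i). Br y > 0"
      using order_tendstoD(1)[of Br "Br (t i)" "nhds (t i)" 0]
      by (simp add: continuous_at tendsto_nhds_iff)
    then have ev: "\<forall>\<^sub>F y in nhds (t i). f y - f (t i) = (y - t i) * (Re (g i (of_real y)) / Br y)"
    proof eventually_elim
      case (elim y)
      have fy: "f y * Br y = exp y * (\<Prod>j=1..k. 1 + \<alpha> j * y)"
        using f_Br elim by simp
      have "poly A (of_real y) * exp (of_real y) = of_real (f y * Br y)"
        unfolding fy by (simp add: A_def poly_edrei_poly exp_of_real mult.commute)
      then have "of_real (f y * Br y - f (t i) * Br y) = of_real (y - t i) * g i (of_real y)"
        using g(2)[OF assms(1), of "of_real y"] by (simp add: poly_B)
      then have "Re (of_real (f y * Br y - f (t i) * Br y)) = Re (of_real (y - t i) * g i (of_real y))"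
        by (rule arg_cong)
      then have "(f y - f (t i)) * Br y = (y - t i) * Re (g i (of_real y))"
        by (simp add: left_diff_distrib)
      then show ?case using elim by (simp add: field_simps)
    qed
    have contg: "continuous_on UNIV (g i)" using g(1)[OF assms(1)] by (rule entire_imp_continuous)
    have "isCont (\<lambda>y. g i (of_real y)) (t i)"
      by (rule isCont_o2[of _ of_real "g i"]) (use contg in \<open>auto simp: continuous_on_eq_continuous_at\<close>)
    then have cont: "isCont (\<lambda>y. Re (g i (of_real y)) / Br y) (t i)"
      using \<open>Br (t i) > 0\<close> \<open>continuous (at (t i)) Br\<close>
      by (intro continuous_intros) auto
    have "((\<lambda>y. f (t i) + (y - t i) * (Re (g i (of_real y)) / Br y)) has_real_derivative (Re (g i (of_real (t i))) / Br (t i))) (at (t i))"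
      unfolding CARAT_DERIV by (rule exI[of _ "\<lambda>y. Re (g i (of_real y)) / Br y"]) (use cont in \<open>auto simp: mult.commute\<close>)
    moreover have "\<forall>\<^sub>F y in nhds (t i). f (t i) + (y - t i) * (Re (g i (of_real y)) / Br y) = f y"
      using ev by eventually_elim simp
    ultimately have "(f has_real_derivative (Re (g i (of_real (t i))) / Br (t i))) (at (t i))"
      by (subst (asm) DERIV_cong_ev[OF refl _ refl, of _ f]) auto
    then have "deriv f (t i) = Re (g i (of_real (t i))) / Br (t i)" by (rule DERIV_imp_deriv)
    then show ?thesis using True by (simp add: loewner_kernel_def)
  qed
qed

lemma E_eq: "a < b \<Longrightarrow> x \<in> {a..b} \<Longrightarrow> E c x = Re (h c (of_real x)) / Br x"
  by (simp add: E_def h_def loewner_eq sum_divide_distrib)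

lemma t_inj: "inj_on t {1..n}"
  using t_mono by (rule strict_mono_on_imp_inj_on)

definition nodes :: "nat set \<Rightarrow> real list" where
  "nodes J = map t (sorted_list_of_set J)"

definition LJ :: "nat set \<Rightarrow> nat \<Rightarrow> complex poly" where
  "LJ J i = (\<Prod>j\<in>J - {i}. [:- of_real (t j), 1:])"

text \<open>Weights c give the denominator and weights c f the numerator of the barycentric form.
  General J serves for weight vectors with a vanishing component, which belong to fewer support
  points.\<close>

definition PJ :: "nat set \<Rightarrow> (nat \<Rightarrow> real) \<Rightarrow> complex poly" where
  "PJ J c = (\<Sum>i\<in>J. smult (of_real (c i)) (LJ J i))"

lemma nodal_nodes: "finite J \<Longrightarrow> nodal (nodes J) = (\<Prod>j\<in>J. [:- of_real (t j), 1:])"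
  unfolding nodal_def nodes_def
  by (metis (no_types, lifting) comp_def map_map map_eq_conv prod.distinct_set_conv_list
      distinct_sorted_list_of_set set_sorted_list_of_set)

lemma set_nodes: "finite J \<Longrightarrow> set (nodes J) = t ` J"
  by (simp add: nodes_def)

lemma length_nodes: "length (nodes J) = card J"
  by (simp add: nodes_def)

lemma nodal_LJ: "finite J \<Longrightarrow> i \<in> J \<Longrightarrow> nodal (nodes J) = [:- of_real (t i), 1:] * LJ J i"
  unfolding nodal_nodes LJ_def by (rule prod.remove)

lemma degree_LJ: "finite J \<Longrightarrow> i \<in> J \<Longrightarrow> degree (LJ J i) \<le> card J - 1"
  unfolding LJ_def
  by (rule order_trans[OF degree_prod_sum_le]) (auto simp: card_Diff_singleton)

lemma degree_PJ: "finite J \<Longrightarrow> degree (PJ J c) \<le> card J - 1"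
  unfolding PJ_def by (intro degree_sum_le order_trans[OF degree_smult_le] degree_LJ)

text \<open>For arbitrary weights the support points are zeros of the linearised error; the cofactor
  is, on [a, b], B times the kernel combination whose mean square AAA minimises.\<close>

lemma remainder_PJ:
  assumes "finite J" "J \<subseteq> {1..n}"
  shows "remainder A B (PJ J c) (PJ J (\<lambda>i. c i * f (t i))) z =
    poly (nodal (nodes J)) z * (\<Sum>i\<in>J. of_real (c i) * g i z)"
proof -
  have "remainder A B (PJ J c) (PJ J (\<lambda>i. c i * f (t i))) z =
    (\<Sum>i\<in>J. of_real (c i) * poly (LJ J i) z * (poly A z * exp z - of_real (f (t i)) * poly B z))"
    by (simp add: remainder_def PJ_def poly_sum sum_distrib_right sum_distrib_left right_diff_distrib sum_subtractf mult_ac)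
  also have "\<dots> = (\<Sum>i\<in>J. poly (nodal (nodes J)) z * (of_real (c i) * g i z))"
  proof (rule sum.cong)
    fix i assume i: "i \<in> J"
    have "poly (nodal (nodes J)) z = (z - of_real (t i)) * poly (LJ J i) z"
      unfolding nodal_LJ[OF assms(1) i] by (simp add: algebra_simps)
    then show "of_real (c i) * poly (LJ J i) z * (poly A z * exp z - of_real (f (t i)) * poly B z) =
        poly (nodal (nodes J)) z * (of_real (c i) * g i z)"
      using g(2)[of i z] i assms(2) by (simp add: subset_iff)
  qed simp
  finally show ?thesis by (simp add: sum_distrib_left)
qed

lemma poly_PJ_node:
  assumes "finite J" "i \<in> J"
  shows "poly (PJ J c) (of_real (t i)) = of_real (c i * (\<Prod>j\<in>J - {i}. t i - t j))"
proof -
  have L: "poly (LJ J j) (of_real (t i)) = of_real (\<Prod>m\<in>J - {j}. t i - t m)" for j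
    by (simp add: LJ_def poly_prod)
  have "poly (PJ J c) (of_real (t i)) = (\<Sum>j\<in>J. of_real (c j) * of_real (\<Prod>m\<in>J - {j}. t i - t m))"
    by (simp add: PJ_def poly_sum L del: of_real_prod)
  also have "\<dots> = (\<Sum>j\<in>J. if j = i then of_real (c i * (\<Prod>m\<in>J - {i}. t i - t m)) else 0)"
  proof (rule sum.cong)
    fix j assume "j \<in> J"
    show "of_real (c j) * of_real (\<Prod>m\<in>J - {j}. t i - t m) =
        (if j = i then of_real (c i * (\<Prod>m\<in>J - {i}. t i - t m)) else (0::complex))"
    proof (cases "j = i")
      case False
      then have "(\<Prod>m\<in>J - {j}. t i - t m) = 0" using assms by (intro prod_zero) auto
      then show ?thesis using False by simp
    qed simp
  qed simp
  also have "\<dots> = of_real (c i * (\<Prod>j\<in>J - {i}. t i - t j))"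
    using assms by simp
  finally show ?thesis .
qed

text \<open>The functions \<open>g i\<close> with i in J form a Chebyshev system on [a, b]: card J
  zeros, together with the support points in J, would be 2 card J nodes for two polynomials of
  degree card J - 1.\<close>

lemma zeros_less_card:
  assumes J: "J \<subseteq> {1..n}" and c: "i \<in> J" "c i \<noteq> 0"
    and S: "set S \<subseteq> {a..b}" "vanishes S (\<lambda>z. \<Sum>i\<in>J. of_real (c i) * g i z)"
  shows "length S < card J"
proof (rule ccontr)
  assume "\<not> length S < card J"
  have fin: "finite J" using J finite_subset by blast
  have pos: "card J > 0" using fin c by (auto simp: card_gt_0_iff)
  have "vanishes (nodes J @ S) (remainder A B (PJ J c) (PJ J (\<lambda>i. c i * f (t i))))"
    by (rule vanishes_cong[OF vanishes_times_nodal[OF S(2)]]) (simp only: remainder_PJ[OF fin J])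
  moreover have "admissible k l \<alpha> \<beta> (set (nodes J @ S))"
    by (rule admissible_subset[OF adm]) (use S J t_in fin in \<open>auto simp: set_nodes\<close>)
  ultimately have "PJ J c = 0"
    unfolding A_def B_def
    using remainder_unique[of k l \<alpha> \<beta> "nodes J @ S" "PJ J c" "PJ J (\<lambda>i. c i * f (t i))" "card J - 1" "card J - 1"]
      degree_PJ[OF fin] \<open>\<not> length S < card J\<close> pos length_nodes[of J] by auto
  then have "complex_of_real (c i * (\<Prod>j\<in>J - {i}. t i - t j)) = 0"
    using poly_PJ_node[OF fin c(1), of c] by simp
  then have "(\<Prod>j\<in>J - {i}. t i - t j) = 0" using c(2) by (simp only: of_real_eq_0_iff mult_eq_0_iff) simp
  moreover have "t i - t j \<noteq> 0" if "j \<in> J - {i}" for j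
    using t_inj J c(1) that by (auto dest: inj_onD)
  ultimately show False using fin by (simp add: prod_zero_iff)
qed

definition alternating :: "(nat \<Rightarrow> real) \<Rightarrow> bool" where
  "alternating c \<longleftrightarrow> (\<exists>\<sigma>. \<forall>i\<in>{1..n}. \<sigma> * (-1) ^ i * c i > 0)"

lemma node_product_sign:
  assumes i: "i \<in> {1..n}"
  shows "(-1) ^ (n - i) * (\<Prod>j\<in>{1..n} - {i}. t i - t j) > 0"
proof -
  have lt: "t x < t y" if "x \<in> {1..n}" "y \<in> {1..n}" "x < y" for x y
    using t_mono that by (auto simp: strict_mono_on_def)
  have split: "{1..n} - {i} = {1..<i} \<union> {i<..n}" using i by auto
  have "(\<Prod>j\<in>{1..n} - {i}. t i - t j) = (\<Prod>j\<in>{1..<i}. t i - t j) * (\<Prod>j\<in>{i<..n}. t i - t j)"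
    unfolding split by (rule prod.union_disjoint) auto
  also have "(\<Prod>j\<in>{i<..n}. t i - t j) = (\<Prod>j\<in>{i<..n}. (-1) * (t j - t i))" by simp
  also have "\<dots> = (-1) ^ (n - i) * (\<Prod>j\<in>{i<..n}. t j - t i)" by (simp only: prod.distrib) simp
  finally have "(-1) ^ (n - i) * (\<Prod>j\<in>{1..n} - {i}. t i - t j) =
      ((-1) ^ (n - i) * (-1) ^ (n - i)) * (\<Prod>j\<in>{1..<i}. t i - t j) * (\<Prod>j\<in>{i<..n}. t j - t i)"
    by (simp only: mult_ac)
  also have "(-1) ^ (n - i) * (-1) ^ (n - i) = (1::real)" by (simp flip: power_add mult_2)
  also have "1 * (\<Prod>j\<in>{1..<i}. t i - t j) * (\<Prod>j\<in>{i<..n}. t j - t i) > 0"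
    using i lt by (simp, intro mult_pos_pos prod_pos) auto
  finally show ?thesis .
qed

text \<open>Together with the support points there are 2 n - 1 nodes, the extremal case of the sign
  count, so P has one sign at all support points. Its value there is \<open>c i\<close> times a
  product of node differences whose sign alternates with i.\<close>

lemma alternating_if_zeros:
  assumes c: "i0 \<in> {1..n}" "c i0 \<noteq> 0" and S: "set S \<subseteq> {a..b}" "vanishes S (h c)" "length S = n - 1"
  shows "alternating c"
proof -
  have n: "n \<ge> 1" using c by simp
  let ?J = "{1..n}" and ?P = "PJ {1..n} c" and ?Q = "PJ {1..n} (\<lambda>i. c i * f (t i))"
  have van: "vanishes (nodes ?J @ S) (remainder A B ?P ?Q)"
  proof (rule vanishes_cong[OF vanishes_times_nodal])
    show "vanishes S (h c)" by fact
    show "poly (nodal (nodes ?J)) z * h c z = remainder A B ?P ?Q z" for z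
      by (simp only: remainder_PJ[OF finite_atLeastAtMost order_refl] h_def)
  qed
  have admX: "admissible k l \<alpha> \<beta> (set (nodes ?J @ S))"
    by (rule admissible_subset[OF adm]) (use S t_in in \<open>auto simp: set_nodes\<close>)
  have real: "coeff (PJ ?J d) i \<in> \<real>" for d i
  proof -
    have "coeff (LJ ?J j) i \<in> \<real>" for i j
      unfolding LJ_def
      by (rule coeff_linear_prod_real)
    then show ?thesis by (auto simp: PJ_def coeff_sum intro!: sum_in_Reals Reals_mult)
  qed
  have len: "(n - 1) + (n - 1) + 1 = length (nodes ?J @ S)" using n S(3) length_nodes[of ?J] by simp
  have P0: "?P \<noteq> 0"
  proof
    assume "?P = 0"
    then have "complex_of_real (c i0 * (\<Prod>j\<in>?J - {i0}. t i0 - t j)) = 0"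
      using poly_PJ_node[OF finite_atLeastAtMost c(1), of c] by simp
    then have "(\<Prod>j\<in>?J - {i0}. t i0 - t j) = 0" using c(2) by (simp only: of_real_eq_0_iff mult_eq_0_iff) simp
    then show False using node_product_sign[OF c(1)] by (metis less_irrefl mult_zero_right)
  qed
  define r where "r = Re (coeff ?P (n - 1))"
  have deg: "degree (PJ ?J d) \<le> n - 1" for d using degree_PJ[of ?J d] by simp
  have "(- r) * (-1) ^ i * c i > 0" if i: "i \<in> ?J" for i
  proof -
    have "t i \<in> set (nodes ?J @ S)" using i by (auto simp: set_nodes)
    then have 1: "(-1) ^ (n - 1) * Re (poly ?P (of_real (t i))) * r > 0"
      unfolding r_def
      by (rule remainder_lead_sign[OF admX van[unfolded A_def B_def] deg deg len P0 real real])
    define \<pi> where "\<pi> = (\<Prod>j\<in>?J - {i}. t i - t j)"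
    have 2: "(-1) ^ (n - i) * \<pi> > 0" unfolding \<pi>_def by (rule node_product_sign[OF i])
    have "Re (poly ?P (of_real (t i))) = c i * \<pi>"
      unfolding \<pi>_def using poly_PJ_node[OF finite_atLeastAtMost i, of c] by (simp del: of_real_mult of_real_prod)
    then have "((-1) ^ (n - 1) * (c i * \<pi>) * r) * ((-1) ^ (n - i) * \<pi>) > 0" using 1 2 by simp
    moreover have "(-1) ^ (n - 1) * (-1) ^ (n - i) = - ((-1) ^ i :: real)"
    proof -
      have "even (n - 1 + (n - i)) \<longleftrightarrow> odd i" using i by auto
      then have "(-1) ^ (n - 1 + (n - i)) = - ((-1) ^ i :: real)" by (cases "even i") simp_all
      then show ?thesis by (simp only: power_add)
    qed
    ultimately have "((- r) * (-1) ^ i * c i) * (\<pi> * \<pi>) > 0"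
    proof -
      assume *: "0 < (-1) ^ (n - 1) * (c i * \<pi>) * r * ((-1) ^ (n - i) * \<pi>)"
        and **: "(-1) ^ (n - 1) * (-1) ^ (n - i) = - ((-1) ^ i :: real)"
      have "(-1) ^ (n - 1) * (c i * \<pi>) * r * ((-1) ^ (n - i) * \<pi>) =
          ((-1) ^ (n - 1) * (-1) ^ (n - i)) * (c i * r * (\<pi> * \<pi>))"
        by (simp only: mult_ac)
      also have "\<dots> = ((- r) * (-1) ^ i * c i) * (\<pi> * \<pi>)" unfolding ** by simp
      finally show ?thesis using * by simp
    qed
    moreover have "\<pi> * \<pi> > 0" using 2 by (metis mult_zero_right not_real_square_gt_zero less_irrefl)
    ultimately show ?thesis by (rule zero_less_mult_pos2)
  qed
  then show ?thesis unfolding alternating_def by blast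
qed

lemma h_real: "Im (h c (of_real x)) = 0"
  by (rule conj_symmetric_real[OF h_symmetric])

lemma zeros_less: "i \<in> {1..n} \<Longrightarrow> c i \<noteq> 0 \<Longrightarrow> set S \<subseteq> {a..b} \<Longrightarrow> vanishes S (h c) \<Longrightarrow> length S < n"
  using zeros_less_card[of "{1..n}" i c S] by (simp add: h_def[abs_def])

text \<open>As no zero can be added to S, the cofactor is zero-free on [a, b] and has constant sign
  there.\<close>

lemma maximal_zeros:
  assumes S: "set S \<subseteq> {a..b}" "vanishes S (h c)"
    and max: "\<forall>x\<in>{a..b}. \<not> vanishes (S @ [x]) (h c)"
  obtains G where "continuous_on {a..b} G" "(\<forall>x\<in>{a..b}. G x > 0) \<or> (\<forall>x\<in>{a..b}. G x < (0::real))"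
    "\<And>x. x \<in> {a..b} \<Longrightarrow> Re (h c (of_real x)) = (\<Prod>s\<leftarrow>S. x - s) * G x"
proof -
  obtain G where G: "G holomorphic_on UNIV" "\<And>z. h c z = poly (nodal S) z * G z"
    using S(2) by (auto simp: vanishes_def)
  have sym: "conj_symmetric G" by (rule conj_symmetric_cofactor[OF h_symmetric G(2) G(1)])
  have re: "G (of_real x) = of_real (Re (G (of_real x)))" for x
    using conj_symmetric_real[OF sym] by (simp add: complex_eq_iff)
  have nz: "G (of_real x) \<noteq> 0" if x: "x \<in> {a..b}" for x
  proof
    assume "G (of_real x) = 0"
    then obtain G' where "G' holomorphic_on UNIV" "\<And>z. G z = (z - of_real x) * G' z"
      using entire_factor[OF G(1)] by metis
    then have "vanishes (S @ [x]) (h c)"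
      unfolding vanishes_def nodal_append by (intro exI[of _ G']) (simp add: G(2) poly_nodal_Cons mult.assoc)
    with max x show False by blast
  qed
  have cont: "continuous_on {a..b} (\<lambda>x. Re (G (of_real x)))"
    by (intro continuous_intros continuous_on_compose2[OF entire_imp_continuous[OF G(1)]]) auto
  have "(\<forall>x\<in>{a..b}. Re (G (of_real x)) > 0) \<or> (\<forall>x\<in>{a..b}. Re (G (of_real x)) < 0)"
  proof (rule sign_const_interval[OF cont], intro ballI notI)
    fix x assume "x \<in> {a..b}" "Re (G (of_real x)) = 0"
    then show False using nz[of x] re[of x] by simp
  qed
  moreover have "Re (h c (of_real x)) = (\<Prod>s\<leftarrow>S. x - s) * Re (G (of_real x))" for x
    unfolding G(2) poly_nodal_of_real by (simp add: Re_complex_of_real)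
  ultimately show thesis using that cont by blast
qed

end

section \<open>The Gram form of the Loewner kernels\<close>

locale aaa_measure = aaa_setting +
  fixes \<nu> :: "real measure"
  assumes ab: "a < b" and fin: "finite_measure \<nu>" and sets_\<nu>: "sets \<nu> = sets borel"
    and supp: "measure_support \<nu> \<subseteq> {a..b}"
    and card_supp: "infinite (measure_support \<nu>) \<or> card (measure_support \<nu>) \<ge> n"
begin

definition I :: "(nat \<Rightarrow> real) \<Rightarrow> (nat \<Rightarrow> real) \<Rightarrow> real" where
  "I c d = (\<integral>x. E c x * E d x \<partial>\<nu>)"

lemma continuous_E: "continuous_on {a..b} (E c)"
proof -
  have "continuous_on {a..b} (\<lambda>x. Re (h c (of_real x)) / Br x)"
  proof (intro continuous_intros continuous_on_compose2[OF entire_imp_continuous[OF h_holomorphic]])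
    show "continuous_on {a..b} Br" unfolding Br_def by (intro continuous_intros)
  qed (use Br_pos in force)+
  then show ?thesis by (rule continuous_on_cong[THEN iffD1, rotated 2]) (simp_all add: E_eq[OF ab])
qed

lemma AE_ab: "AE x in \<nu>. x \<in> {a..b}"
  using AE_measure_support[OF sets_\<nu>] by eventually_elim (use supp in blast)

lemma measurable_E: "E c \<in> borel_measurable \<nu>"
proof -
  have f: "f \<in> borel_measurable borel"
    unfolding f_def edrei_fun_def[abs_def] by measurable
  have "(\<lambda>x. loewner_kernel f x y) = (\<lambda>x. if x = y then deriv f y else (f x - f y) / (x - y))" for y
    by (auto simp: loewner_kernel_def fun_eq_iff)
  then have "(\<lambda>x. loewner_kernel f x y) \<in> borel_measurable borel" for y
    using f by simp
  then have "E c \<in> borel_measurable borel" unfolding E_def[abs_def] by measurable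
  then show ?thesis using measurable_cong_sets[OF sets_\<nu> refl] by blast
qed

lemma integrable_E: "integrable \<nu> (\<lambda>x. E c x * E d x)"
proof -
  interpret finite_measure \<nu> by (rule fin)
  have "bounded ((\<lambda>x. E c x * E d x) ` {a..b})"
    by (intro compact_imp_bounded compact_continuous_image continuous_intros continuous_E compact_Icc)
  then obtain M where M: "\<And>x. x \<in> {a..b} \<Longrightarrow> norm (E c x * E d x) \<le> M"
    unfolding bounded_iff by blast
  show ?thesis
  proof (rule integrable_const_bound)
    show "AE x in \<nu>. norm (E c x * E d x) \<le> M" using AE_ab by eventually_elim (rule M)
  qed (intro borel_measurable_times measurable_E)
qed

lemma E_add: "E (\<lambda>i. c i + r * d i) x = E c x + r * E d x"
  by (simp add: E_def algebra_simps sum.distrib sum_distrib_left)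

lemma E_sum: "E (\<lambda>i. \<Sum>j\<in>J. r j * d j i) x = (\<Sum>j\<in>J. r j * E (d j) x)"
  by (simp add: E_def sum_distrib_left sum_distrib_right mult_ac) (rule sum.swap)

lemma I_commute: "I c d = I d c"
  by (simp add: I_def mult.commute)

lemma I_add: "I (\<lambda>i. c i + r * d i) e = I c e + r * I d e"
proof -
  have "I (\<lambda>i. c i + r * d i) e = (\<integral>x. E c x * E e x + r * (E d x * E e x) \<partial>\<nu>)"
    unfolding I_def E_add by (simp add: algebra_simps)
  also have "\<dots> = I c e + r * I d e"
    unfolding I_def by (subst Bochner_Integration.integral_add) (auto intro: integrable_E)
  finally show ?thesis .
qed

lemma I_sum: "I (\<lambda>i. \<Sum>j\<in>J. r j * d j i) e = (\<Sum>j\<in>J. r j * I (d j) e)"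
  unfolding I_def E_sum sum_distrib_right
  by (subst Bochner_Integration.integral_sum)
     (auto simp: mult.assoc intro!: integrable_mult_right integrable_E)

lemma I_cong: "(\<And>i. i \<in> {1..n} \<Longrightarrow> c i = c' i) \<Longrightarrow> I c d = I c' d"
proof -
  assume "\<And>i. i \<in> {1..n} \<Longrightarrow> c i = c' i"
  then have "E c x = E c' x" for x unfolding E_def by (intro sum.cong) auto
  then show ?thesis by (simp add: I_def)
qed

text \<open>A continuous function of constant sign with integral zero vanishes on the support; s
  normalises the sign.\<close>

lemma product_vanishes_on_support:
  assumes s: "s = 1 \<or> s = (-1::real)" and nonneg: "\<And>x. x \<in> {a..b} \<Longrightarrow> s * (E c x * E d x) \<ge> 0" and I0: "I c d = 0"
    and x: "x \<in> measure_support \<nu>"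
  shows "E c x * E d x = 0"
proof (rule ccontr)
  assume nz: "E c x * E d x \<noteq> 0"
  let ?p = "\<lambda>x. s * (E c x * E d x)"
  have "(\<integral>x. ?p x \<partial>\<nu>) = 0" using I0 by (simp add: I_def)
  moreover have "AE x in \<nu>. 0 \<le> ?p x" using AE_ab by eventually_elim (rule nonneg)
  moreover have "integrable \<nu> ?p" by (intro integrable_mult_right integrable_E)
  ultimately have "AE x in \<nu>. ?p x = 0" by (subst (asm) integral_nonneg_eq_0_iff_AE)
  then have AE0: "AE x in \<nu>. E c x * E d x = 0" by eventually_elim (use s in auto)
  have "continuous_on {a..b} (\<lambda>x. E c x * E d x)" by (intro continuous_intros continuous_E)
  then have "openin (top_of_set {a..b}) ({a..b} \<inter> (\<lambda>x. E c x * E d x) -` (- {0}))"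
    by (rule continuous_openin_preimage_gen) (simp add: open_Compl)
  then obtain U where U: "open U" "{a..b} \<inter> (\<lambda>x. E c x * E d x) -` (- {0}) = {a..b} \<inter> U"
    by (auto simp: openin_open)
  have "x \<in> U" using U(2) nz x supp by blast
  then have "emeasure \<nu> U > 0" using x U(1) by (auto simp: measure_support_def)
  moreover have "AE x in \<nu>. x \<notin> U" using AE_ab AE0 by eventually_elim (use U(2) in blast)
  then have "emeasure \<nu> U = 0"
    using U(1) sets_\<nu> by (subst (asm) AE_iff_measurable[of U]) (auto simp: sets_eq_imp_space_eq[OF sets_\<nu>])
  ultimately show False by simp
qed

lemma support_not_small: "finite Z \<Longrightarrow> card Z < n \<Longrightarrow> \<not> measure_support \<nu> \<subseteq> Z"
  using card_supp card_mono finite_subset by (metis leD le_less_trans)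

lemma E_zero_imp_h: "x \<in> {a..b} \<Longrightarrow> E c x = 0 \<Longrightarrow> h c (of_real x) = 0"
  using E_eq[OF ab, of x c] Br_pos[of x] h_real[of c x] by (simp add: complex_eq_iff)

text \<open>Error zero would make \<open>h c\<close> vanish at n points of the support, more than a
  Chebyshev system of n functions admits.\<close>

lemma I_pos:
  assumes "i \<in> {1..n}" "c i \<noteq> 0"
  shows "I c c > 0"
proof -
  have "I c c \<ge> 0" unfolding I_def by simp
  moreover have "I c c \<noteq> 0"
  proof
    assume I0: "I c c = 0"
    have z: "h c (of_real x) = 0" if "x \<in> measure_support \<nu>" for x
      using product_vanishes_on_support[of 1 c c x] I0 that supp E_zero_imp_h by auto
    obtain Z where Z: "Z \<subseteq> measure_support \<nu>" "finite Z" "card Z = n"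
      using card_supp by (metis infinite_arbitrarily_large obtain_subset_with_card_n)
    have "vanishes (sorted_list_of_set Z) (h c)"
      by (rule vanishes_distinct[OF h_holomorphic]) (use Z z in auto)
    then have "length (sorted_list_of_set Z) < n"
      using zeros_less[of i c "sorted_list_of_set Z"] assms Z supp by auto
    then show False using Z by simp
  qed
  ultimately show ?thesis by simp
qed

text \<open>If \<open>h v\<close> had fewer zeros, some \<open>c\<close> with \<open>(\<Sum>i=1..n. \<phi> i * c i) = 0\<close> would have an \<open>h c\<close> with exactly
  these zeros, and then \<open>E c * E v\<close> would have constant sign.\<close>

lemma orthogonal_zeros:
  assumes v: "i0 \<in> {1..n}" "v i0 \<noteq> 0" and n2: "n \<ge> 2"
    and cheb: "\<And>c i S. i \<in> {1..n} \<Longrightarrow> c i \<noteq> 0 \<Longrightarrow> (\<Sum>i=1..n. \<phi> i * c i) = 0 \<Longrightarrow> set S \<subseteq> {a..b} \<Longrightarrow>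
        vanishes S (h c) \<Longrightarrow> length S \<le> n - 2"
    and orth: "\<And>c. (\<Sum>i=1..n. \<phi> i * c i) = 0 \<Longrightarrow> I c v = 0"
  shows "\<exists>S. set S \<subseteq> {a..b} \<and> vanishes S (h v) \<and> length S = n - 1"
proof -
  have zl: "length S < n" if "set S \<subseteq> {a..b}" "vanishes S (h v)" for S
    using zeros_less[of i0 v S] v that by blast
  define Q where "Q m \<longleftrightarrow> (\<exists>S. set S \<subseteq> {a..b} \<and> vanishes S (h v) \<and> length S = m)" for m
  have Q0: "Q 0" using h_holomorphic by (auto simp: Q_def)
  have Qb: "\<forall>m. Q m \<longrightarrow> m \<le> n" using zl by (auto simp: Q_def intro: less_imp_le)
  define m where "m = (GREATEST m. Q m)"
  have Qm: "Q m" unfolding m_def using Q0 Qb by (intro GreatestI_nat[of Q 0 n]) auto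
  have mmax: "\<not> Q (Suc m)" using Greatest_le_nat[of Q "Suc m" n] Qb by (auto simp: m_def)
  obtain S where S: "set S \<subseteq> {a..b}" "vanishes S (h v)" "length S = m" using Qm by (auto simp: Q_def)
  have Smax: "\<forall>x\<in>{a..b}. \<not> vanishes (S @ [x]) (h v)"
  proof (intro ballI notI)
    fix x assume x: "x \<in> {a..b}"
    assume "vanishes (S @ [x]) (h v)"
    then have "Q (Suc m)" unfolding Q_def using S x by (intro exI[of _ "S @ [x]"]) auto
    with mmax show False by blast
  qed
  have "m < n" using zl[OF S(1,2)] S(3) by simp
  show ?thesis
  proof (cases "m = n - 1")
    case True
    then show ?thesis using Qm by (auto simp: Q_def)
  next
    case False
    then have m: "m \<le> n - 2" using \<open>m < n\<close> by linarith
    define e where "e = n - 2 - m"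
    \<comment> \<open>Copies of the endpoint a fill the list up to length n - 2; the factor (x - a)
      ^ e does not change sign on [a, b].\<close>
    define S' where "S' = S @ replicate e a"
    have lenS': "length S' = n - 2" using m S(3) by (simp add: S'_def e_def)
    have S'ab: "set S' \<subseteq> {a..b}" using S(1) ab by (auto simp: S'_def)
    have "card {1..n} > Suc (length S')" using lenS' n2 by simp
    then obtain c where c: "\<exists>i\<in>{1..n}. c i \<noteq> 0" "(\<Sum>i=1..n. \<phi> i * c i) = 0" "vanishes S' (h c)"
      using exists_vanishing_combination_orthogonal[of "{1..n}" S' g \<phi>] g(1) g_symmetric
      by (auto simp: h_def[abs_def])
    then obtain i1 where i1: "i1 \<in> {1..n}" "c i1 \<noteq> 0" by blast
    \<comment> \<open>By \<open>cheb\<close> the list S' has maximal length, so \<open>h c\<close>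
      has no zeros in [a, b] beyond it.\<close>
    have S'max: "\<forall>x\<in>{a..b}. \<not> vanishes (S' @ [x]) (h c)"
    proof (intro ballI notI)
      fix x assume x: "x \<in> {a..b}"
      assume "vanishes (S' @ [x]) (h c)"
      moreover have "set (S' @ [x]) \<subseteq> {a..b}" using S'ab x by auto
      ultimately have "length (S' @ [x]) \<le> n - 2" using cheb[OF i1 c(2)] by blast
      then show False using lenS' by simp
    qed
    obtain G where "continuous_on {a..b} G" and G: "(\<forall>x\<in>{a..b}. G x > 0) \<or> (\<forall>x\<in>{a..b}. G x < (0::real))"
      "\<And>x. x \<in> {a..b} \<Longrightarrow> Re (h v (of_real x)) = (\<Prod>s\<leftarrow>S. x - s) * G x"
      by (rule maximal_zeros[OF S(1,2) Smax]) (rule that)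
    obtain G' where "continuous_on {a..b} G'" and G': "(\<forall>x\<in>{a..b}. G' x > 0) \<or> (\<forall>x\<in>{a..b}. G' x < (0::real))"
      "\<And>x. x \<in> {a..b} \<Longrightarrow> Re (h c (of_real x)) = (\<Prod>s\<leftarrow>S'. x - s) * G' x"
      by (rule maximal_zeros[OF S'ab c(3) S'max]) (rule that)
    have eq: "E c x * E v x = ((\<Prod>s\<leftarrow>S. x - s)\<^sup>2 * (x - a) ^ e / (Br x)\<^sup>2) * (G' x * G x)" if x: "x \<in> {a..b}" for x
      unfolding E_eq[OF ab x] G(2)[OF x] G'(2)[OF x] S'_def by (simp add: power2_eq_square prod_list_replicate)
    have nn: "(\<Prod>s\<leftarrow>S. x - s)\<^sup>2 * (x - a) ^ e / (Br x)\<^sup>2 \<ge> 0" if "x \<in> {a..b}" for x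
      using that by (intro divide_nonneg_nonneg mult_nonneg_nonneg zero_le_power[of "x - a"] zero_le_power2) auto
    have "(\<forall>x\<in>{a..b}. G' x * G x > 0) \<or> (\<forall>x\<in>{a..b}. G' x * G x < 0)"
      using G(1) G'(1) by (meson mult_neg_neg mult_neg_pos mult_pos_neg mult_pos_pos)
    then obtain s where s: "s = 1 \<or> s = (-1::real)" "\<forall>x\<in>{a..b}. s * (G' x * G x) > 0"
      by (metis mult_1 mult_minus1 neg_0_less_iff_less)
    have "E c x * E v x = 0" if "x \<in> measure_support \<nu>" for x
    proof (rule product_vanishes_on_support[OF s(1) _ orth[OF c(2)] that])
      fix x assume x: "x \<in> {a..b}"
      have "((\<Prod>s\<leftarrow>S. x - s)\<^sup>2 * (x - a) ^ e / (Br x)\<^sup>2) * (s * (G' x * G x)) \<ge> 0"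
        by (rule mult_nonneg_nonneg[OF nn[OF x]]) (use s(2) x in \<open>blast intro: less_imp_le\<close>)
      then show "s * (E c x * E v x) \<ge> 0" unfolding eq[OF x] by (simp only: mult_ac)
    qed
    \<comment> \<open>The product vanishes on the support, so all support points would lie among the
      fewer than n points of S'.\<close>
    then have "measure_support \<nu> \<subseteq> set S'"
    proof (intro subsetI)
      fix x assume A: "\<And>x. x \<in> measure_support \<nu> \<Longrightarrow> E c x * E v x = 0" and x: "x \<in> measure_support \<nu>"
      have xab: "x \<in> {a..b}" using x supp by blast
      have "G' x * G x \<noteq> 0" using s(2) xab by force
      moreover have "Br x \<noteq> 0" using Br_pos[OF xab] by simp
      ultimately have "(\<Prod>s\<leftarrow>S. x - s)\<^sup>2 * (x - a) ^ e = 0" using A[OF x] unfolding eq[OF xab] by auto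
      then have "(\<Prod>s\<leftarrow>S. x - s) = 0 \<or> (x = a \<and> e > 0)" by auto
      then show "x \<in> set S'" by (auto simp: S'_def prod_list_zero_iff)
    qed
    moreover have "card (set S') < n" using card_length[of S'] lenS' n2 by linarith
    ultimately show ?thesis using support_not_small[of "set S'"] by blast
  qed
qed

lemma alternating_dot:
  assumes "alternating c" "alternating d" "n \<ge> 1"
  shows "(\<Sum>i=1..n. c i * d i) \<noteq> 0"
proof -
  obtain \<sigma> where \<sigma>: "\<forall>i\<in>{1..n}. \<sigma> * (-1) ^ i * c i > 0" using assms(1) by (auto simp: alternating_def)
  obtain \<tau> where \<tau>: "\<forall>i\<in>{1..n}. \<tau> * (-1) ^ i * d i > 0" using assms(2) by (auto simp: alternating_def)
  have "(\<sigma> * (-1) ^ i * c i) * (\<tau> * (-1) ^ i * d i) > 0" if "i \<in> {1..n}" for i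
    by (rule mult_pos_pos) (use \<sigma> \<tau> that in blast)+
  moreover have "(\<sigma> * (-1) ^ i * c i) * (\<tau> * (-1) ^ i * d i) = \<sigma> * \<tau> * (c i * d i)" for i
  proof -
    have "(-1) ^ i * (-1) ^ i = (1::real)" by (simp flip: power_add mult_2)
    moreover have "(\<sigma> * (-1) ^ i * c i) * (\<tau> * (-1) ^ i * d i) = \<sigma> * \<tau> * (c i * d i) * ((-1) ^ i * (-1) ^ i)"
      by (simp only: mult_ac)
    ultimately show ?thesis by simp
  qed
  ultimately have "(\<Sum>i=1..n. \<sigma> * \<tau> * (c i * d i)) > 0"
    using assms(3) by (intro sum_pos) auto
  then show ?thesis by (auto simp: sum_distrib_left[symmetric])
qed

lemma I_zero: "I (\<lambda>_. 0) d = 0"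
  by (simp add: I_def E_def)

lemma eq_if_I_eq:
  assumes "\<And>c. I c d = I c d'" "i \<in> {1..n}"
  shows "d i = d' i"
proof (rule ccontr)
  assume "d i \<noteq> d' i"
  let ?e = "\<lambda>i. d i + (-1) * d' i"
  have "I ?e ?e > 0" using I_pos[OF assms(2), of ?e] \<open>d i \<noteq> d' i\<close> by simp
  moreover have "I ?e ?e = I d ?e + (-1) * I d' ?e" by (rule I_add)
  moreover have "I d ?e = I d' ?e" using assms(1)[of ?e] I_commute by metis
  ultimately show False by simp
qed

lemma I_basis: "I c e = (\<Sum>i=1..n. c i * I (\<lambda>m. if m = i then 1 else 0) e)"
proof -
  have "I c e = I (\<lambda>m. \<Sum>i=1..n. c i * (if m = i then 1 else 0)) e"
    by (rule I_cong) (auto simp: if_distrib sum.delta cong: if_cong)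
  also have "\<dots> = (\<Sum>i=1..n. c i * I (\<lambda>m. if m = i then 1 else 0) e)" by (rule I_sum)
  finally show ?thesis .
qed

text \<open>u is the j-th column of the inverse Gram matrix: a vector orthogonal to the other unit
  vectors, rescaled by its product with the j-th one. Positive definiteness makes that product
  nonzero and the diagonal entry positive.\<close>

lemma dual_vector:
  assumes j: "j \<in> {1..n}"
  obtains u where "\<And>c. I c u = c j" "u j > 0"
proof -
  let ?e = "\<lambda>i m. if m = i then 1 else 0 :: real"
  have "\<exists>c. (\<exists>i\<in>{1..n}. c i \<noteq> 0) \<and> (\<forall>m\<in>{1..n} - {j}. (\<Sum>i=1..n. I (?e m) (?e i) * c i) = 0)"
    by (rule exists_common_kernel) (use j in auto)
  then obtain v i0 where v: "i0 \<in> {1..n}" "v i0 \<noteq> 0" "\<forall>m\<in>{1..n} - {j}. (\<Sum>i=1..n. I (?e m) (?e i) * v i) = 0"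
    by blast
  have z: "I (?e m) v = 0" if "m \<in> {1..n} - {j}" for m
  proof -
    have "I (?e m) v = I v (?e m)" by (rule I_commute)
    also have "\<dots> = (\<Sum>i=1..n. v i * I (?e i) (?e m))" by (rule I_basis)
    also have "\<dots> = (\<Sum>i=1..n. I (?e m) (?e i) * v i)"
      by (intro sum.cong refl) (metis I_commute mult.commute)
    also have "\<dots> = 0" using v(3) that by blast
    finally show ?thesis .
  qed
  define \<theta> where "\<theta> = I (?e j) v"
  have cv: "I c v = c j * \<theta>" for c
  proof -
    have "I c v = (\<Sum>i=1..n. c i * I (?e i) v)" by (rule I_basis)
    also have "\<dots> = (\<Sum>i=1..n. if i = j then c j * \<theta> else 0)"
      by (rule sum.cong) (use z in \<open>auto simp: \<theta>_def\<close>)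
    finally show ?thesis using j by simp
  qed
  have pos: "v j * \<theta> > 0" using I_pos[of i0 v] v cv[of v] by simp
  then have \<theta>: "\<theta> \<noteq> 0" by auto
  show thesis
  proof
    fix c
    have "I (\<lambda>i. 0 + (1 / \<theta>) * v i) c = 0 + (1 / \<theta>) * I v c" using I_add[of "\<lambda>_. 0" "1 / \<theta>" v c] I_zero by simp
    then have "I c (\<lambda>i. v i / \<theta>) = I c v / \<theta>" using I_commute by simp
    then show "I c (\<lambda>i. v i / \<theta>) = c j" using cv \<theta> by simp
  next
    have "v j / \<theta> = (v j * \<theta>) / \<theta>\<^sup>2" using \<theta> by (simp add: power2_eq_square)
    also have "\<dots> > 0" using pos \<theta> by simp
    finally show "v j / \<theta> > 0" .
  qed
qed

text \<open>The inverse of the Gram matrix has the checkerboard sign pattern.\<close>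

lemma dual_vector_sign:
  assumes n2: "n \<ge> 2" and j: "j \<in> {1..n}" and u: "\<And>c. I c u = c j" "u j > 0" and i: "i \<in> {1..n}"
  shows "(-1) ^ (i + j) * u i > 0"
proof -
  let ?\<phi> = "\<lambda>i. if i = j then 1 else 0 :: real"
  have phi: "(\<Sum>i=1..n. ?\<phi> i * c i) = c j" for c :: "nat \<Rightarrow> real"
  proof -
    have "(\<Sum>i=1..n. ?\<phi> i * c i) = (\<Sum>i=1..n. if i = j then c j else 0)" by (rule sum.cong) auto
    then show ?thesis using j by simp
  qed
  have "\<exists>S. set S \<subseteq> {a..b} \<and> vanishes S (h u) \<and> length S = n - 1"
  proof (rule orthogonal_zeros[of j u ?\<phi>])
    fix c m S
    assume m: "m \<in> {1..n}" "c m \<noteq> 0" "(\<Sum>i=1..n. ?\<phi> i * c i) = 0" and S: "set S \<subseteq> {a..b}" "vanishes S (h c)"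
    have cj: "c j = 0" using m(3) phi by simp
    \<comment> \<open>With \<open>c j = 0\<close> the combination belongs to the Chebyshev system
      without \<open>g j\<close>, which admits at most n - 2 zeros.\<close>
    have "vanishes S (\<lambda>z. \<Sum>i\<in>{1..n} - {j}. of_real (c i) * g i z)"
    proof (rule vanishes_cong[OF S(2)])
      fix z
      have "h c z = of_real (c j) * g j z + (\<Sum>i\<in>{1..n} - {j}. of_real (c i) * g i z)"
        unfolding h_def using j by (intro sum.remove) auto
      then show "h c z = (\<Sum>i\<in>{1..n} - {j}. of_real (c i) * g i z)" using cj by simp
    qed
    then have "length S < card ({1..n} - {j})"
      using m cj S(1) by (intro zeros_less_card[of _ m c]) auto
    then show "length S \<le> n - 2" using j by simp
  next
    fix c :: "nat \<Rightarrow> real" assume "(\<Sum>i=1..n. ?\<phi> i * c i) = 0"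
    then show "I c u = 0" using phi u by simp
  qed (use j u n2 in auto)
  then obtain S where "set S \<subseteq> {a..b}" "vanishes S (h u)" "length S = n - 1" by blast
  then have "alternating u" using alternating_if_zeros[of j u S] j u(2) by simp
  then obtain \<sigma> where \<sigma>: "\<forall>i\<in>{1..n}. \<sigma> * (-1) ^ i * u i > 0" by (auto simp: alternating_def)
  then have "(\<sigma> * (-1) ^ i * u i) * (\<sigma> * (-1) ^ j * u j) > 0"
    by (intro mult_pos_pos[of "\<sigma> * (-1) ^ i * u i"]) (use i j in blast)+
  then have "(\<sigma>\<^sup>2 * u j) * ((-1) ^ (i + j) * u i) > 0" by (simp add: power_add power2_eq_square mult_ac)
  moreover have "\<sigma>\<^sup>2 * u j \<ge> 0" using u(2) by simp
  ultimately show ?thesis by (metis zero_less_mult_iff not_less)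
qed

section \<open>The weights as a lowest eigenvector\<close>

context
  fixes w :: "nat \<Rightarrow> real"
  assumes w: "aaa_weights f \<nu> n t w"
begin

lemma aaa_error_I: "aaa_error f \<nu> n t c = I c c"
  by (simp add: aaa_error_def I_def E_def power2_eq_square)

lemma weights_norm: "(\<Sum>i=1..n. (w i)\<^sup>2) = 1"
  and weights_min: "(\<Sum>i=1..n. (c i)\<^sup>2) = 1 \<Longrightarrow> I w w \<le> I c c"
  using w by (auto simp: aaa_weights_def is_arg_min_def aaa_error_I not_less)

lemma weights_nonzero: obtains i where "i \<in> {1..n}" "w i \<noteq> 0"
proof -
  have "\<exists>i\<in>{1..n}. w i \<noteq> 0"
  proof (rule ccontr)
    assume "\<not> ?thesis"
    then have "(\<Sum>i=1..n. (w i)\<^sup>2) = 0" by simp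
    with weights_norm show False by simp
  qed
  then show thesis using that by blast
qed

lemma rayleigh: "I w w * (\<Sum>i=1..n. (c i)\<^sup>2) \<le> I c c"
proof (cases "(\<Sum>i=1..n. (c i)\<^sup>2) = 0")
  case True
  then have "c i = 0" if "i \<in> {1..n}" for i
    using that by (subst (asm) sum_nonneg_eq_0_iff) auto
  then have "I c c = I (\<lambda>_. 0) c" by (intro I_cong) auto
  then show ?thesis using True I_zero by simp
next
  case False
  let ?s = "\<Sum>i=1..n. (c i)\<^sup>2"
  have s: "?s > 0" using False by (simp add: order_less_le sum_nonneg)
  let ?d = "\<lambda>i. 0 + (1 / sqrt ?s) * c i"
  have "(\<Sum>i=1..n. (?d i)\<^sup>2) = (1 / ?s) * ?s"
    unfolding sum_distrib_left using s by (intro sum.cong) (auto simp: power_divide)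
  then have "I w w \<le> I ?d ?d" using s by (intro weights_min) simp
  also have "I ?d ?d = (1 / sqrt ?s) * ((1 / sqrt ?s) * I c c)"
    using I_add[of "\<lambda>_. 0" "1 / sqrt ?s" c ?d] I_add[of "\<lambda>_. 0" "1 / sqrt ?s" c c] I_zero I_commute[of c ?d] by simp
  also have "\<dots> = I c c / ?s" using s by (simp add: mult.assoc[symmetric])
  finally show ?thesis using s by (simp add: field_simps)
qed

text \<open>First-order optimality on the sphere: perturbing w by e c gives the nonnegative function
  2 e q + e^2 r of e, which forces q = 0.\<close>

lemma eigenvector: "I c w = I w w * (\<Sum>i=1..n. c i * w i)"
proof -
  define \<mu> where "\<mu> = I w w"
  define q where "q = I c w - \<mu> * (\<Sum>i=1..n. c i * w i)"
  define r where "r = I c c - \<mu> * (\<Sum>i=1..n. (c i)\<^sup>2)"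
  have r: "r \<ge> 0" using rayleigh[of c] by (simp add: r_def \<mu>_def)
  have quad: "2 * e * q + e\<^sup>2 * r \<ge> 0" for e
  proof -
    let ?d = "\<lambda>i. w i + e * c i"
    have "I ?d ?d = (I w w + e * I c w) + e * (I c w + e * I c c)"
      unfolding I_add[of w e c ?d] using I_add[of w e c w] I_add[of w e c c] I_commute by metis
    moreover have "(\<Sum>i=1..n. (?d i)\<^sup>2) = 1 + 2 * e * (\<Sum>i=1..n. c i * w i) + e\<^sup>2 * (\<Sum>i=1..n. (c i)\<^sup>2)"
      unfolding weights_norm[symmetric] sum_distrib_left sum.distrib[symmetric]
      by (intro sum.cong) (auto simp: power2_eq_square algebra_simps)
    ultimately show ?thesis
      using rayleigh[of ?d] by (simp add: q_def r_def \<mu>_def[symmetric] algebra_simps power2_eq_square)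
  qed
  have "q = 0"
  proof (rule ccontr)
    assume q: "q \<noteq> 0"
    \<comment> \<open>The minimiser would be - q / r; the shift r + 1 avoids a division by
      zero.\<close>
    let ?e = "- q / (r + 1)"
    have "2 * ?e * q + ?e\<^sup>2 * r = - (q\<^sup>2 * (r + 2)) / (r + 1)\<^sup>2"
      using r by (simp add: power2_eq_square divide_simps) (simp add: algebra_simps)
    also have "\<dots> < 0" using q r by (intro divide_neg_pos) auto
    finally show False using quad[of ?e] by linarith
  qed
  then show ?thesis by (simp add: q_def \<mu>_def)
qed

text \<open>Perron-Frobenius: after conjugation with the signs \<open>(-1) ^ i\<close> the inverse of the Gram matrix is
  positive, and the weights are an eigenvector for its largest eigenvalue.\<close>

lemma weights_alternating:
  assumes n2: "n \<ge> 2"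
  shows "alternating w"
proof -
  define \<mu> where "\<mu> = I w w"
  have \<mu>: "\<mu> > 0" using I_pos weights_nonzero unfolding \<mu>_def by metis
  have "\<forall>j\<in>{1..n}. \<exists>u. (\<forall>c. I c u = c j) \<and> u j > 0" using dual_vector by metis
  then obtain u where u: "\<And>j c. j \<in> {1..n} \<Longrightarrow> I c (u j) = c j" "\<And>j. j \<in> {1..n} \<Longrightarrow> u j j > 0" by metis
  define M where "M i j = (-1) ^ (i + j) * u j i" for i j
  have M: "M i j > 0" if "i \<in> {1..n}" "j \<in> {1..n}" for i j
    unfolding M_def by (rule dual_vector_sign[OF n2 that(2) u(1)[OF that(2)] u(2)[OF that(2)] that(1)])
  define x where "x i = (-1) ^ i * w i" for i
  have sq: "(-1) ^ i * ((-1) ^ i * r) = r" for i and r :: real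
    by (simp add: mult.assoc[symmetric] power_add[symmetric] mult_2[symmetric])
  have wx: "w i = (-1) ^ i * x i" for i by (simp add: x_def sq)
  have uM: "u j i = (-1) ^ i * ((-1) ^ j * M i j)" for i j
  proof -
    have "(-1) ^ i * ((-1) ^ j * M i j) = (-1) ^ i * ((-1) ^ i * ((-1) ^ j * ((-1) ^ j * u j i)))"
      by (simp only: M_def power_add mult_ac)
    then show ?thesis by (simp only: sq)
  qed
  have Isum: "I c (\<lambda>i. \<Sum>j=1..n. y j * u j i) = (\<Sum>j=1..n. y j * c j)" for c y
    unfolding I_commute[of c] I_sum by (intro sum.cong) (auto simp: u(1) I_commute[of _ c])
  have w_eq: "w i = \<mu> * (\<Sum>j=1..n. w j * u j i)" if "i \<in> {1..n}" for i
  proof -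
    have "w i = (\<Sum>j=1..n. (\<mu> * w j) * u j i)"
    proof (rule eq_if_I_eq[OF _ that])
      fix c
      have "I c (\<lambda>i. \<Sum>j=1..n. (\<mu> * w j) * u j i) = (\<Sum>j=1..n. (\<mu> * w j) * c j)" by (rule Isum)
      moreover have "I c w = \<mu> * (\<Sum>i=1..n. c i * w i)" unfolding \<mu>_def by (rule eigenvector)
      ultimately show "I c w = I c (\<lambda>i. \<Sum>j=1..n. (\<mu> * w j) * u j i)"
        by (simp add: sum_distrib_left mult_ac)
    qed
    then show ?thesis by (simp add: sum_distrib_left mult.assoc)
  qed
  have x_eq: "x i = \<mu> * (\<Sum>j=1..n. M i j * x j)" if "i \<in> {1..n}" for i
  proof -
    have "x i = (-1) ^ i * (\<mu> * (\<Sum>j=1..n. w j * u j i))" using w_eq[OF that] by (simp add: x_def)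
    also have "\<dots> = \<mu> * (\<Sum>j=1..n. (-1) ^ i * (w j * u j i))" by (simp add: sum_distrib_left mult_ac)
    also have "(\<Sum>j=1..n. (-1) ^ i * (w j * u j i)) = (\<Sum>j=1..n. M i j * x j)"
      by (rule sum.cong) (simp_all add: M_def x_def power_add mult_ac)
    finally show ?thesis .
  qed
  \<comment> \<open>The quadratic form of the positive matrix M at the vector of moduli. It will
    turn out to be at most 1 / \<mu>, the value at x itself.\<close>
  define q where "q = (\<Sum>i=1..n. \<Sum>j=1..n. M i j * (\<bar>x i\<bar> * \<bar>x j\<bar>))"
  have wq: "1 = \<mu> * (\<Sum>i=1..n. \<Sum>j=1..n. M i j * (x i * x j))"
  proof -
    have "1 = (\<Sum>i=1..n. x i * x i)"
      unfolding weights_norm[symmetric] by (intro sum.cong) (auto simp: x_def power2_eq_square sq mult.left_commute)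
    also have "\<dots> = (\<Sum>i=1..n. x i * (\<mu> * (\<Sum>j=1..n. M i j * x j)))"
      by (intro sum.cong refl) (metis x_eq)
    also have "\<dots> = \<mu> * (\<Sum>i=1..n. \<Sum>j=1..n. M i j * (x i * x j))"
      by (simp add: sum_distrib_left mult_ac)
    finally show ?thesis .
  qed
  have "\<mu> * q \<le> 1"
  proof -
    define y where "y i = (-1) ^ i * \<bar>x i\<bar>" for i
    \<comment> \<open>W is the inverse Gram matrix applied to y. The Rayleigh bound at W and the
      Cauchy-Schwarz inequality give \<mu> q^2 \<le> q.\<close>
    define W where "W i = (\<Sum>j=1..n. y j * u j i)" for i
    have Wy: "(\<Sum>i=1..n. y i * W i) = q"
      unfolding q_def W_def sum_distrib_left
    proof (intro sum.cong refl)
      fix i j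
      have "y i * (y j * u j i) = ((-1) ^ i * ((-1) ^ i * ((-1) ^ j * ((-1) ^ j * (M i j * (\<bar>x i\<bar> * \<bar>x j\<bar>))))))"
        unfolding y_def uM by (simp only: mult_ac)
      then show "y i * (y j * u j i) = M i j * (\<bar>x i\<bar> * \<bar>x j\<bar>)" by (simp only: sq)
    qed
    have IW: "I W W = q"
      using Isum[of W y] Wy unfolding W_def[abs_def] by (simp add: W_def)
    have y1: "(\<Sum>i=1..n. (y i)\<^sup>2) = 1"
    proof -
      have "((-1::real) ^ i)\<^sup>2 = 1" for i by (cases "even i") simp_all
      then have "(y i)\<^sup>2 = (w i)\<^sup>2" for i by (simp add: y_def x_def abs_mult power_mult_distrib)
      then show ?thesis using weights_norm by simp
    qed
    have "q\<^sup>2 \<le> (\<Sum>i=1..n. (y i)\<^sup>2) * (\<Sum>i=1..n. (W i)\<^sup>2)"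
      unfolding Wy[symmetric] by (rule Cauchy_Schwarz_ineq_sum)
    then have "\<mu> * q\<^sup>2 \<le> \<mu> * (\<Sum>i=1..n. (W i)\<^sup>2)" using \<mu> y1 by simp
    also have "\<dots> \<le> q" using rayleigh[of W] IW by (simp add: \<mu>_def)
    finally have "\<mu> * q\<^sup>2 \<le> q" .
    moreover have "q > 0"
    proof -
      have "(\<Sum>i=1..n. \<Sum>j=1..n. M i j * (x i * x j)) \<le> q"
        unfolding q_def using M by (intro sum_mono mult_left_mono) (auto simp: abs_mult[symmetric] less_imp_le)
      moreover have "(\<Sum>i=1..n. \<Sum>j=1..n. M i j * (x i * x j)) > 0"
      proof (rule zero_less_mult_pos[OF _ \<mu>])
        show "0 < \<mu> * (\<Sum>i=1..n. \<Sum>j=1..n. M i j * (x i * x j))" unfolding wq[symmetric] by simp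
      qed
      ultimately show ?thesis by linarith
    qed
    ultimately show ?thesis by (simp add: power2_eq_square)
  qed
  then have "\<mu> * q \<le> \<mu> * (\<Sum>i=1..n. \<Sum>j=1..n. M i j * (x i * x j))" unfolding wq[symmetric] .
  then have "q \<le> (\<Sum>i=1..n. \<Sum>j=1..n. M i j * (x i * x j))" using \<mu> by simp
  then have le: "(\<Sum>i=1..n. \<Sum>j=1..n. M i j * (\<bar>x i\<bar> * \<bar>x j\<bar> - x i * x j)) \<le> 0"
    by (simp add: q_def right_diff_distrib sum_subtractf)
  have nn: "M i j * (\<bar>x i\<bar> * \<bar>x j\<bar> - x i * x j) \<ge> 0" if "i \<in> {1..n}" "j \<in> {1..n}" for i j
    using M[OF that] by (intro mult_nonneg_nonneg) (auto simp: abs_mult[symmetric])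
  \<comment> \<open>Each summand in \<open>le\<close> is nonnegative, hence zero, and
    \<open>M i j > 0\<close> excludes opposite signs of \<open>x i\<close> and
    \<open>x j\<close>.\<close>
  have same: "x i * x j \<ge> 0" if ij: "i \<in> {1..n}" "j \<in> {1..n}" for i j
  proof -
    have "(\<Sum>j=1..n. M i j * (\<bar>x i\<bar> * \<bar>x j\<bar> - x i * x j)) \<le> (\<Sum>i=1..n. \<Sum>j=1..n. M i j * (\<bar>x i\<bar> * \<bar>x j\<bar> - x i * x j))"
      using ij nn by (intro member_le_sum sum_nonneg) auto
    moreover have "M i j * (\<bar>x i\<bar> * \<bar>x j\<bar> - x i * x j) \<le> (\<Sum>j=1..n. M i j * (\<bar>x i\<bar> * \<bar>x j\<bar> - x i * x j))"
      using ij nn by (intro member_le_sum) auto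
    ultimately have "M i j * (\<bar>x i\<bar> * \<bar>x j\<bar> - x i * x j) \<le> 0" using le by linarith
    then have "\<bar>x i\<bar> * \<bar>x j\<bar> \<le> x i * x j" using M[OF ij] by (simp add: mult_le_0_iff)
    moreover have "0 \<le> \<bar>x i\<bar> * \<bar>x j\<bar>" by simp
    ultimately show ?thesis by linarith
  qed
  obtain i0 where i0: "i0 \<in> {1..n}" "w i0 \<noteq> 0" using weights_nonzero .
  then have x0: "x i0 \<noteq> 0" by (simp add: x_def)
  \<comment> \<open>The eigenvector equation with the positive matrix M turns weak sign agreement
    into strict agreement, so no weight vanishes.\<close>
  have "x i0 * (-1) ^ i * w i > 0" if i: "i \<in> {1..n}" for i
  proof -
    have "x i0 * x i = \<mu> * (\<Sum>j=1..n. M i j * (x i0 * x j))"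
      using x_eq[OF i] by (simp add: sum_distrib_left mult_ac)
    also have "(\<Sum>j=1..n. M i j * (x i0 * x j)) \<ge> M i i0 * (x i0 * x i0)"
    proof (rule member_le_sum[OF i0(1)])
      fix j assume "j \<in> {1..n} - {i0}"
      then show "M i j * (x i0 * x j) \<ge> 0"
        using M[OF i, of j] same[OF i0(1), of j] by (intro mult_nonneg_nonneg[of "M i j"]) auto
    qed simp
    then have "\<mu> * (\<Sum>j=1..n. M i j * (x i0 * x j)) > 0"
      using M[OF i i0(1)] x0 \<mu> by (intro mult_pos_pos) (auto intro: less_le_trans[rotated] simp: zero_less_mult_iff linorder_neq_iff)
    finally show ?thesis by (simp add: x_def mult.assoc)
  qed
  then show ?thesis unfolding alternating_def by (intro exI[of _ "x i0"]) blast
qed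

text \<open>The functional in \<open>orthogonal_zeros\<close> is w itself, since the weights are an
  eigenvector. A vector orthogonal to w cannot have n - 1 zeros: it would alternate like w, and all
  terms of the scalar product would have one sign.\<close>

theorem weights_zeros:
  assumes "n \<ge> 1"
  shows "\<exists>S. set S \<subseteq> {a..b} \<and> vanishes S (h w) \<and> length S = n - 1"
proof (cases "n \<ge> 2")
  case False
  then have "n - 1 = 0" by simp
  then show ?thesis using h_holomorphic by (intro exI[of _ "[]"]) auto
next
  case True
  obtain i0 where i0: "i0 \<in> {1..n}" "w i0 \<noteq> 0" using weights_nonzero .
  show ?thesis
  proof (rule orthogonal_zeros[of i0 w w, OF i0 True])
    fix c i S
    assume c: "i \<in> {1..n}" "c i \<noteq> 0" "(\<Sum>i=1..n. w i * c i) = 0" and S: "set S \<subseteq> {a..b}" "vanishes S (h c)"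
    have "length S < n" by (rule zeros_less[of i c]) fact+
    moreover have "length S \<noteq> n - 1"
    proof
      assume "length S = n - 1"
      then have "alternating c" using alternating_if_zeros[of i c S] c S by blast
      then show False using alternating_dot[OF weights_alternating[OF True], of c] c(3) assms by blast
    qed
    ultimately show "length S \<le> n - 2" by linarith
  next
    fix c assume "(\<Sum>i=1..n. w i * c i) = 0"
    then show "I c w = 0" using eigenvector[of c] by (simp only: mult.commute[of "c _"] mult_zero_right)
  qed
qed

end

end

section \<open>Convergence of the quotients\<close>

text \<open>The common normalisation c of both components cancels in the quotient, and H, zero-free
  on the compact set S, is bounded away from zero there.\<close>

lemma ratio_converges:
  assumes ab: "a \<le> b" and adm: "admissible k l \<alpha> \<beta> {a..b}" and S: "compact S"
    and B: "\<And>z. z \<in> S \<Longrightarrow> poly (edrei_poly (\<lambda>i. - \<beta> i) l) z \<noteq> 0" and \<epsilon>: "\<epsilon> > 0"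
  shows "\<exists>M. \<forall>n X P Q z. M \<le> n \<longrightarrow> set X \<subseteq> {a..b} \<longrightarrow> length X = 2 * n + 1 \<longrightarrow>
     degree P \<le> n \<longrightarrow> degree Q \<le> n \<longrightarrow> P \<noteq> 0 \<or> Q \<noteq> 0 \<longrightarrow>
     vanishes X (remainder (edrei_poly \<alpha> k) (edrei_poly (\<lambda>i. - \<beta> i) l) P Q) \<longrightarrow> z \<in> S \<longrightarrow>
     poly P z \<noteq> 0 \<and> norm (poly Q z / poly P z -
       exp z * (poly (edrei_poly \<alpha> k) z / poly (edrei_poly (\<lambda>i. - \<beta> i) l) z)) < \<epsilon>"
proof (cases "S = {}")
  case False
  let ?A = "edrei_poly \<alpha> k" and ?B = "edrei_poly (\<lambda>i. - \<beta> i) l"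
  define H G where "H z = exp (- z / 2) * poly ?B z" and "G z = exp (z / 2) * poly ?A z" for z
  have "continuous_on S (\<lambda>z. norm (H z))" unfolding H_def by (intro continuous_intros) auto
  from continuous_attains_inf[OF S False this]
  obtain z0 where z0: "z0 \<in> S" "\<And>z. z \<in> S \<Longrightarrow> norm (H z0) \<le> norm (H z)" by blast
  define m where "m = norm (H z0)"
  have m: "m > 0" using B[OF z0(1)] by (simp add: m_def H_def)
  have "bounded (H ` S)" "bounded (G ` S)" unfolding H_def G_def
    by (intro compact_imp_bounded compact_continuous_image S continuous_intros; simp)+
  then obtain N1 N2 where N12: "\<forall>z\<in>S. norm (H z) \<le> N1" "\<forall>z\<in>S. norm (G z) \<le> N2"
    unfolding bounded_iff by blast
  define N where "N = max 1 (max N1 N2)"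
  have N: "norm (H z) \<le> N" "norm (G z) \<le> N" if "z \<in> S" for z
    using N12 that by (auto simp: N_def le_max_iff_disj)
  have N1: "N \<ge> 1" by (simp add: N_def)
  obtain R where R: "\<And>z. z \<in> S \<Longrightarrow> norm z \<le> R"
    using compact_imp_bounded[OF S] unfolding bounded_iff by blast
  \<comment> \<open>The first bound keeps the scaled P above m / 2; the second makes the error of
    the quotient at most \<epsilon> / 2.\<close>
  define \<delta> where "\<delta> = min (m / 2) (\<epsilon> * m\<^sup>2 / (8 * N))"
  have \<delta>: "\<delta> > 0" "\<delta> \<le> m / 2" "\<delta> \<le> \<epsilon> * m\<^sup>2 / (8 * N)" using m \<epsilon> N1 by (auto simp: \<delta>_def)
  obtain M where M: "interp_close k l \<alpha> \<beta> a b 0 R \<delta> M"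
    using interp_converges[OF ab adm] \<delta>(1) unfolding interp_converges_def by blast
  show ?thesis
  proof (intro exI[of _ M] allI impI)
    fix n X P Q z
    assume hyp: "M \<le> n" "set X \<subseteq> {a..b}" "length X = 2 * n + 1" "degree P \<le> n" "degree Q \<le> n" "P \<noteq> 0 \<or> Q \<noteq> 0"
      "vanishes X (remainder ?A ?B P Q)" and z: "z \<in> S"
    have arith: "n \<le> n + 0" "M \<le> n + n" "length X = n + n + 1" using hyp by auto
    obtain c where c: "\<forall>z. norm z \<le> R \<longrightarrow> norm (c * poly P z - exp (- z / 2) * poly ?B z) \<le> \<delta> \<and>
        norm (c * poly Q z - exp (z / 2) * poly ?A z) \<le> \<delta>"
      using M[unfolded interp_close_def, rule_format, of n n X P Q] hyp arith by blast
    define u v where "u = c * poly P z" and "v = c * poly Q z"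
    have uv: "norm (u - H z) \<le> \<delta>" "norm (v - G z) \<le> \<delta>"
      using c R[OF z] by (auto simp: u_def v_def H_def G_def)
    have mz: "norm (H z) \<ge> m" using z0(2)[OF z] by (simp add: m_def)
    have u: "norm u \<ge> m / 2"
      using uv(1) mz \<delta>(2) norm_triangle_ineq2[of "H z" u] by (simp add: norm_minus_commute)
    then have nz: "u \<noteq> 0" "H z \<noteq> 0" using m mz by auto
    have "v / u - G z / H z = ((v - G z) * H z - G z * (u - H z)) / (u * H z)"
      using nz by (simp add: field_simps)
    then have "norm (v / u - G z / H z) = norm ((v - G z) * H z - G z * (u - H z)) / (norm u * norm (H z))"
      by (simp only: norm_divide norm_mult)
    also have "\<dots> \<le> (2 * \<delta> * N) / ((m / 2) * m)"
    proof (rule frac_le)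
      have "norm ((v - G z) * H z - G z * (u - H z)) \<le> norm ((v - G z) * H z) + norm (G z * (u - H z))"
        by (rule norm_triangle_ineq4)
      also have "\<dots> \<le> \<delta> * N + N * \<delta>"
        unfolding norm_mult using uv N[OF z] \<delta>(1) N1 by (intro add_mono mult_mono) auto
      finally show "norm ((v - G z) * H z - G z * (u - H z)) \<le> 2 * \<delta> * N" by (simp add: mult_ac)
      show "(m / 2) * m \<le> norm u * norm (H z)" using u mz m by (intro mult_mono) auto
    qed (use m \<delta> N1 in auto)
    also have "\<dots> = \<delta> * (4 * N / m\<^sup>2)" by (simp add: power2_eq_square)
    also have "\<dots> \<le> (\<epsilon> * m\<^sup>2 / (8 * N)) * (4 * N / m\<^sup>2)"
      using \<delta>(3) N1 by (intro mult_right_mono) auto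
    also have "\<dots> = \<epsilon> / 2" using m N1 by simp
    also have "\<dots> < \<epsilon>" using \<epsilon> by simp
    finally have 1: "norm (v / u - G z / H z) < \<epsilon>" .
    have c0: "c \<noteq> 0" "poly P z \<noteq> 0" using nz(1) by (auto simp: u_def)
    have "exp (z / 2) = exp z * exp (- z / 2)" by (simp flip: exp_add)
    then have "G z / H z = exp z * (poly ?A z / poly ?B z)" by (simp add: G_def H_def)
    moreover have "v / u = poly Q z / poly P z" using c0 by (simp add: u_def v_def)
    ultimately show "poly P z \<noteq> 0 \<and> norm (poly Q z / poly P z - exp z * (poly ?A z / poly ?B z)) < \<epsilon>"
      using 1 c0 by simp
  qed
qed simp

subsection \<open>Error bounds for the exponential function\<close>

text \<open>Growth of the monic denominator of the diagonal interpolant to the exponential.\<close>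

definition growth :: "nat \<Rightarrow> real" where
  "growth m = fact (2 * m) / fact m"

lemma growth_pos: "growth m > 0"
  by (simp add: growth_def)

lemma growth_Suc: "growth (Suc m) = growth m * (2 * (2 * m + 1))"
proof -
  have cancel: "(2 * u * (v * F)) / (u * G) = F / G * (2 * v)" if "u \<noteq> 0" for u v F G :: real
    using that by simp
  have 1: "fact (2 * Suc m) = 2 * (real m + 1) * ((2 * real m + 1) * fact (2 * m))"
    by (simp add: algebra_simps)
  have 2: "fact (Suc m) = (real m + 1) * fact m" by (simp add: algebra_simps)
  have "real m + 1 \<noteq> 0" by linarith
  then have "growth (Suc m) = fact (2 * m) / fact m * (2 * (2 * real m + 1))"
    unfolding growth_def 1 2 by (rule cancel)
  then show ?thesis by (simp add: growth_def)
qed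

text \<open>\<rho> is the quotient of the leading coefficients up to the sign (-1) ^ m. It is
  recorded because its positivity, with bounds independent of m, excludes cancellation in the
  difference of consecutive interpolants.\<close>

definition exp_pair_bounds :: "real \<Rightarrow> real \<Rightarrow> real \<Rightarrow> nat \<Rightarrow> complex poly \<Rightarrow> complex poly \<Rightarrow> real \<Rightarrow> bool" where
  "exp_pair_bounds R c C m P Q \<rho> \<longleftrightarrow> degree P = m \<and> degree Q = m \<and> c \<le> \<rho> \<and> \<rho> \<le> C \<and>
     lead_coeff Q = (-1) ^ m * of_real \<rho> * lead_coeff P \<and>
     (\<forall>z. norm z \<le> R \<longrightarrow> c * (norm (lead_coeff P) * growth m) \<le> norm (poly P z) \<and>
        norm (poly P z) \<le> C * (norm (lead_coeff P) * growth m))"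

lemma exp_pair_bounds_exist:
  fixes a b R :: real
  assumes ab: "a \<le> b" and R: "\<bar>a\<bar> \<le> R" "\<bar>b\<bar> \<le> R"
  obtains c C :: real and M where "0 < c" "c \<le> C"
    "\<And>m X P Q. M \<le> m \<Longrightarrow> set X \<subseteq> {a..b} \<Longrightarrow> length X = 2 * m + 1 \<Longrightarrow> degree P \<le> m \<Longrightarrow> degree Q \<le> m \<Longrightarrow>
       P \<noteq> 0 \<or> Q \<noteq> 0 \<Longrightarrow> vanishes X (remainder 1 1 P Q) \<Longrightarrow> \<exists>\<rho>. exp_pair_bounds R c C m P Q \<rho>"
proof -
  have R0: "R \<ge> 0" using R by linarith
  define D where "D = (real 0 + 2 * R) * exp (2 * R) * exp R * R"
  have D: "D \<ge> 0" using R0 by (simp add: D_def)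
  \<comment> \<open>The limits have moduli between exp (- R) and exp (3 R); halving the one and
    adding 1 to the other leaves room for the error D / m.\<close>
  define c1 where "c1 = exp (- R) / 2"
  define C1 where "C1 = exp (3 * R) + 1"
  have c1: "c1 > 0" "c1 \<le> C1" "c1 \<le> 1" "1 \<le> C1"
  proof -
    have "exp (- R) > 0" "exp (- R) \<le> 1" "exp (3 * R) \<ge> 1" using R0 by simp_all
    then show "c1 > 0" "c1 \<le> C1" "c1 \<le> 1" "1 \<le> C1" unfolding c1_def C1_def by linarith+
  qed
  define c where "c = c1 * exp (- R) / C1"
  define C where "C = C1 * exp R / c1"
  have cC: "0 < c" "c \<le> c1" "C1 \<le> C" "c \<le> C"
  proof -
    show c: "0 < c" using c1 by (simp add: c_def)
    have "c1 * exp (- R) \<le> c1 * C1" using c1 R0 by (intro mult_left_mono) (auto intro: order_trans[of _ 1])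
    then show 2: "c \<le> c1" using c1 by (simp add: c_def field_simps)
    have "C1 * c1 \<le> C1 * exp R" using c1 R0 by (intro mult_left_mono) (auto intro: order_trans[of _ 1])
    then show 3: "C1 \<le> C" using c1 by (simp add: C_def field_simps)
    show "c \<le> C" using 2 3 c1 by linarith
  qed
  define M where "M = Suc (nat \<lceil>D / c1\<rceil>)"
  show thesis
  proof (rule that[OF cC(1,4), of M])
    fix m X P Q
    assume hyp: "M \<le> m" "set X \<subseteq> {a..b}" "length X = 2 * m + 1" "degree P \<le> m" "degree Q \<le> m" "P \<noteq> 0 \<or> Q \<noteq> 0"
      "vanishes X (remainder 1 1 P Q)"
    have m1: "m \<ge> 1" using hyp(1) by (simp add: M_def)
    have "D / c1 \<le> m" using hyp(1) unfolding M_def by linarith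
    then have Dm: "D / m \<le> c1" using c1 m1 by (simp add: field_simps)
    have len: "length X = m + m + 1" using hyp(3) by simp
    have adm: "admissible 0 0 (\<lambda>_. 0) (\<lambda>_. 0) (set X)" by (simp add: admissible_def)
    have van0: "vanishes X (remainder (edrei_poly (\<lambda>_. 0) 0) (edrei_poly (\<lambda>i. - 0) 0) P Q)" using hyp(7) by simp
    obtain s p q where pq: "\<And>i. coeff p i \<in> \<real>" "\<And>i. coeff q i \<in> \<real>" "degree p \<le> m" "degree q \<le> m"
      "vanishes X (remainder (edrei_poly (\<lambda>_. 0) 0) (edrei_poly (\<lambda>i. - 0) 0) p q)"
      "coeff p m \<noteq> 0" "coeff q m \<noteq> 0" and s: "P = smult s p" "Q = smult s q" "s \<noteq> 0"
      using real_interpolant[OF adm van0 hyp(4,5) len hyp(6) m1 m1] by metis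
    have van: "vanishes X (remainder 1 1 p q)" using pq(5) by simp
    obtain y y' where y: "1 \<le> y" "y \<le> exp (2 * R)" "1 \<le> y'" "y' \<le> exp (2 * R)"
      and p_est: "\<And>z. norm z \<le> R \<Longrightarrow> norm ((-1) ^ m * of_real (fact m / fact (m + m)) / coeff p m * poly p z
         - of_real y * exp (- (z - of_real a) / 2)) \<le> D / m"
      and q_est: "\<And>z. norm z \<le> R \<Longrightarrow> norm (of_real (fact m / fact (m + m)) / coeff q m * poly q z
         - of_real y' * exp ((z - of_real b) / 2)) \<le> D / m"
      using exp_pair_asymptotics[OF van hyp(2) pq(1,2,3,4) len pq(6,7) m1 m1 _ _ R, of 0] unfolding D_def by auto
    have fg: "fact m / fact (m + m) = 1 / growth m" by (simp add: growth_def mult_2)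
    define \<xi> \<xi>' where "\<xi> z = (-1) ^ m / of_real (growth m) / coeff p m * poly p z"
      and "\<xi>' z = poly q z / of_real (growth m) / coeff q m" for z
    have est: "c1 \<le> norm v \<and> norm v \<le> C1"
      if v: "norm (v - of_real y * exp r) \<le> D / m" and y: "1 \<le> y" "y \<le> exp (2 * R)" and r: "\<bar>Re r\<bar> \<le> R"
      for v r :: complex and y :: real
    proof -
      have n: "norm (of_real y * exp r) = y * exp (Re r)" using y by (simp add: norm_mult norm_exp_eq_Re)
      have "1 * exp (- R) \<le> y * exp (Re r)" using y r by (intro mult_mono) auto
      then have lo: "norm (of_real y * exp r) \<ge> exp (- R)" unfolding n by simp
      have "y * exp (Re r) \<le> exp (2 * R) * exp R" using y r by (intro mult_mono) auto
      then have hi: "norm (of_real y * exp r) \<le> exp (3 * R)" unfolding n by (simp flip: exp_add)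
      have d: "norm (v - of_real y * exp r) \<le> c1" using v Dm by linarith
      have "norm (of_real y * exp r) - norm v \<le> c1" "norm v - norm (of_real y * exp r) \<le> c1"
        using d norm_triangle_ineq2[of "of_real y * exp r" v] norm_triangle_ineq2[of v "of_real y * exp r"]
        by (simp_all add: norm_minus_commute)
      then show ?thesis using lo hi c1(3) unfolding C1_def by (auto simp: c1_def)
    qed
    have Re_le: "\<bar>Re (- (z - of_real a) / 2)\<bar> \<le> R" "\<bar>Re ((z - of_real b) / 2)\<bar> \<le> R" if "norm z \<le> R" for z
      using abs_Re_le_cmod[of z] that R by auto
    have \<xi>: "c1 \<le> norm (\<xi> z) \<and> norm (\<xi> z) \<le> C1" if z: "norm z \<le> R" for z
    proof (rule est[OF _ y(1,2) Re_le(1)[OF z]])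
      show "norm (\<xi> z - of_real y * exp (- (z - of_real a) / 2)) \<le> D / m"
        using p_est[OF z] unfolding fg \<xi>_def by simp
    qed
    have \<xi>': "c1 \<le> norm (\<xi>' z) \<and> norm (\<xi>' z) \<le> C1" if z: "norm z \<le> R" for z
    proof (rule est[OF _ y(3,4) Re_le(2)[OF z]])
      show "norm (\<xi>' z - of_real y' * exp ((z - of_real b) / 2)) \<le> D / m"
        using q_est[OF z] unfolding fg \<xi>'_def by simp
    qed
    obtain x where x: "x \<in> set X" using hyp(3) by (cases X) auto
    have xR: "norm (of_real x :: complex) \<le> R" "\<bar>x\<bar> \<le> R" using x hyp(2) R by (auto simp: subset_iff)
    let ?x = "complex_of_real x"
    have pqx: "poly p ?x * exp ?x = poly q ?x"
      using vanishes_at[OF van x] by (simp add: remainder_def)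
    have real_val: "poly r ?x \<in> \<real>" if "\<And>i. coeff r i \<in> \<real>" for r
      using conj_symmetric_real[of "poly r" x] conj_symmetric_poly[of r] that by (simp add: complex_is_Real_iff)
    have "\<xi> ?x \<in> \<real>" "\<xi>' ?x \<in> \<real>"
      unfolding \<xi>_def \<xi>'_def using real_val pq(1,2)
      by (auto intro!: Reals_mult Reals_divide Reals_power)
    then obtain e e' where e: "\<xi> ?x = of_real e" "\<xi>' ?x = of_real e'" by (auto elim!: Reals_cases)
    have near: "Re v > 0"
      if v: "norm (v - of_real y * exp (of_real r)) \<le> D / m" and y: "1 \<le> y" and r: "\<bar>r\<bar> \<le> R" for v :: complex and y r :: real
    proof -
      have "\<bar>Re v - y * exp r\<bar> \<le> norm (v - of_real y * exp (of_real r))"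
        using abs_Re_le_cmod[of "v - of_real y * exp (of_real r)"] by (simp add: exp_of_real)
      moreover have "1 * exp (- R) \<le> y * exp r" using y r by (intro mult_mono) auto
      moreover have "c1 < exp (- R)" by (simp add: c1_def)
      ultimately show ?thesis using v Dm by linarith
    qed
    have "Re (\<xi> ?x) > 0"
      using near[of "\<xi> ?x" y "- (x - a) / 2"] p_est[OF xR(1)] y(1) xR(2) R unfolding fg \<xi>_def by (simp add: abs_le_iff)
    moreover have "Re (\<xi>' ?x) > 0"
      using near[of "\<xi>' ?x" y' "(x - b) / 2"] q_est[OF xR(1)] y(3) xR(2) R unfolding fg \<xi>'_def by (simp add: abs_le_iff)
    ultimately have pos: "e > 0" "e' > 0" using e by simp_all
    have be: "c1 \<le> e" "e \<le> C1" "c1 \<le> e'" "e' \<le> C1"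
      using \<xi>[OF xR(1)] \<xi>'[OF xR(1)] pos unfolding e by simp_all
    \<comment> \<open>At the node x the normalised values e and e' are positive, and P exp = Q there
      expresses the quotient of the leading coefficients through them.\<close>
    define \<rho> where "\<rho> = e * exp x / e'"
    have g0: "growth m > 0" by (rule growth_pos)
    have s2: "(-1) ^ m * ((-1) ^ m * w) = w" for w :: complex by (simp flip: power_add mult_2 mult.assoc)
    have px: "poly p ?x = (-1) ^ m * coeff p m * of_real (growth m * e)"
    proof -
      have "(-1) ^ m * coeff p m * of_real (growth m) * \<xi> ?x = (-1) ^ m * ((-1) ^ m * poly p ?x)"
        unfolding \<xi>_def using pq(6) g0 by (simp add: field_simps)
      then show ?thesis unfolding e s2 by (simp add: mult.assoc)
    qed
    have qx: "poly q ?x = coeff q m * of_real (growth m * e')"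
    proof -
      have "coeff q m * of_real (growth m) * \<xi>' ?x = poly q ?x"
        unfolding \<xi>'_def using pq(7) g0 by (simp add: field_simps)
      then show ?thesis unfolding e by (simp add: mult.assoc)
    qed
    have "coeff q m * of_real (growth m * e') = (-1) ^ m * coeff p m * of_real (growth m * e) * of_real (exp x)"
      using pqx[symmetric] unfolding px qx exp_of_real .
    then have "coeff q m * of_real (growth m * e') = ((-1) ^ m * coeff p m * of_real (e * exp x / e')) * of_real (growth m * e')"
    proof -
      have r: "of_real (e * exp x / e') * of_real (growth m * e') = (of_real (growth m * e) * of_real (exp x) :: complex)"
      proof -
        have "e * exp x / e' * (growth m * e') = growth m * e * exp x" using pos by simp
        then show ?thesis by (simp only: of_real_mult[symmetric])
      qed
      show ?thesis using \<open>coeff q m * _ = _\<close> by (simp only: mult.assoc r)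
    qed
    then have lead: "coeff q m = (-1) ^ m * of_real \<rho> * coeff p m"
      using g0 pos unfolding \<rho>_def by (simp only: mult_cancel_right of_real_eq_0_iff mult_eq_0_iff) (simp add: mult_ac)
    have ex: "exp (- R) \<le> exp x" "exp x \<le> exp R" using xR(2) by auto
    have "c \<le> \<rho>" unfolding c_def \<rho>_def using be ex c1 pos by (intro frac_le mult_mono) auto
    moreover have "\<rho> \<le> C" unfolding C_def \<rho>_def using be ex c1 pos by (intro frac_le mult_mono) auto
    moreover have degs: "degree p = m" "degree q = m" using pq(3,4) le_degree[OF pq(6)] le_degree[OF pq(7)] by (simp_all add: antisym)
    moreover have "c * (norm (lead_coeff P) * growth m) \<le> norm (poly P z) \<and>
        norm (poly P z) \<le> C * (norm (lead_coeff P) * growth m)" if z: "norm z \<le> R" for z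
    proof -
      have "norm (\<xi> z) = norm (poly p z) / (growth m * norm (coeff p m))"
        using g0 by (simp add: \<xi>_def norm_mult norm_divide norm_power)
      then have "norm (poly p z) = norm (\<xi> z) * (norm (coeff p m) * growth m)"
        using g0 pq(6) by simp
      then have eq: "norm (poly P z) = norm (\<xi> z) * (norm (lead_coeff P) * growth m)"
        by (simp add: s(1) norm_mult degs)
      have "norm (lead_coeff P) * growth m \<ge> 0" using g0 by simp
      then show ?thesis unfolding eq using \<xi>[OF z] cC by (auto intro!: mult_right_mono)
    qed
    ultimately have "exp_pair_bounds R c C m P Q \<rho>"
      unfolding exp_pair_bounds_def using s lead by simp
    then show "\<exists>\<rho>. exp_pair_bounds R c C m P Q \<rho>" by blast
  qed
qed

text \<open>Eliminating the exponential between the two remainders shows that P Q' - P' Q, of degree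
  at most 2 m + 1, vanishes at the 2 m + 1 nodes of X. In its leading coefficient \<rho> and \<rho>'
  add up, because the signs (-1) ^ m and (-1) ^ (m + 1) differ.\<close>

lemma consecutive_difference:
  assumes b0: "exp_pair_bounds R c C m P Q \<rho>" and b1: "exp_pair_bounds R c C (Suc m) P' Q' \<rho>'"
    and van: "vanishes X (remainder 1 1 P Q)" "vanishes (X @ Y) (remainder 1 1 P' Q')"
    and len: "length X = 2 * m + 1" and c: "0 < c"
  shows "P * Q' - P' * Q = smult ((-1) ^ Suc m * lead_coeff P * lead_coeff P' * of_real (\<rho> + \<rho>')) (nodal X)"
proof -
  let ?W = "P * Q' - P' * Q"
  have deg: "degree P = m" "degree Q = m" "degree P' = Suc m" "degree Q' = Suc m"
    and lead: "lead_coeff Q = (-1) ^ m * of_real \<rho> * lead_coeff P" "lead_coeff Q' = (-1) ^ Suc m * of_real \<rho>' * lead_coeff P'"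
    using b0 b1 by (auto simp: exp_pair_bounds_def)
  have van': "vanishes X (remainder 1 1 P' Q')" using van(2) by (rule vanishes_append_left)
  have "vanishes X (\<lambda>z. poly P' z * remainder 1 1 P Q z - poly P z * remainder 1 1 P' Q' z)"
    by (intro vanishes_diff vanishes_mult van van' holomorphic_intros)
  then have "vanishes X (\<lambda>z. poly ?W z * 1)"
    by (rule vanishes_cong) (simp add: remainder_def algebra_simps)
  then have dvd: "nodal X dvd ?W" by (rule nodal_dvd_if_vanishes) auto
  have "degree (P * Q') \<le> m + Suc m" "degree (P' * Q) \<le> m + Suc m"
    using degree_mult_le[of P Q'] degree_mult_le[of P' Q] deg by auto
  then have degW: "degree ?W \<le> m + Suc m" by (rule degree_diff_le)
  have W: "?W = smult (coeff ?W (length X)) (nodal X)"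
    by (rule nodal_dvd_imp_eq[OF dvd]) (use len degW in simp)
  have idx: "length X = degree P + degree Q'" "length X = degree P' + degree Q" using deg len by auto
  have "coeff (P * Q') (length X) = lead_coeff P * lead_coeff Q'"
    unfolding idx(1) by (rule coeff_mult_degree_sum)
  moreover have "coeff (P' * Q) (length X) = lead_coeff P' * lead_coeff Q"
    unfolding idx(2) by (rule coeff_mult_degree_sum)
  ultimately have "coeff ?W (length X) = lead_coeff P * lead_coeff Q' - lead_coeff P' * lead_coeff Q" by simp
  also have "\<dots> = (-1) ^ Suc m * lead_coeff P * lead_coeff P' * of_real (\<rho> + \<rho>')"
    unfolding lead by (simp add: algebra_simps)
  finally have co: "coeff ?W (length X) = \<dots>" .
  show ?thesis using W unfolding co .
qed

text \<open>The terms after the first add up to at most a third of it, so the distance lies between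
  2/3 and 4/3 of \<open>T 0\<close>.\<close>

lemma geometric_telescope:
  fixes r :: "nat \<Rightarrow> complex" and T :: "nat \<Rightarrow> real"
  assumes step: "\<And>j. norm (r (Suc j) - r j) = T j" and T: "\<And>j. T (Suc j) \<le> T j / 4"
    and lim: "\<And>\<epsilon>. \<epsilon> > 0 \<Longrightarrow> \<exists>J\<ge>1. norm (r J - l) < \<epsilon>"
  shows "T 0 / 2 \<le> norm (l - r 0)" "norm (l - r 0) \<le> 2 * T 0"
proof -
  have T0: "T j \<ge> 0" for j unfolding step[symmetric] by simp
  have partial: "norm (r (Suc J) - r 1) \<le> T 0 / 3 - 4 / 3 * T (Suc J)" for J
  proof (induction J)
    case 0
    then show ?case using T[of 0] by simp
  next
    case (Suc J)
    have "norm (r (Suc (Suc J)) - r 1) \<le> norm (r (Suc (Suc J)) - r (Suc J)) + norm (r (Suc J) - r 1)"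
      using norm_triangle_ineq[of "r (Suc (Suc J)) - r (Suc J)" "r (Suc J) - r 1"] by simp
    then show ?case using Suc step[of "Suc J"] T[of "Suc J"] T0[of "Suc (Suc J)"] by linarith
  qed
  have tail: "norm (l - r 1) \<le> T 0 / 3"
  proof (rule field_le_epsilon)
    fix \<epsilon> :: real assume "\<epsilon> > 0"
    then obtain J where J: "J \<ge> 1" "norm (r J - l) < \<epsilon>" using lim by blast
    then obtain J' where J': "J = Suc J'" by (cases J) auto
    have "norm (l - r 1) \<le> norm (r J - l) + norm (r J - r 1)"
      using norm_triangle_ineq4[of "r J - r 1" "r J - l"] by simp
    then show "norm (l - r 1) \<le> T 0 / 3 + \<epsilon>" using J(2) partial[of J'] T0[of "Suc J'"] unfolding J' by linarith
  qed
  have s: "norm (r 1 - r 0) = T 0" using step[of 0] by simp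
  show "norm (l - r 0) \<le> 2 * T 0"
    using norm_triangle_ineq[of "l - r 1" "r 1 - r 0"] tail s T0[of 0] by simp
  show "T 0 / 2 \<le> norm (l - r 0)"
    using norm_triangle_ineq4[of "l - r 0" "l - r 1"] tail s T0[of 0] by simp
qed

text \<open>The error is telescoped over interpolants on node sets enlarged by copies of \<open>a\<close>. The terms
  decrease so fast that the first one dominates.\<close>

lemma exp_error_bounds:
  fixes a b R :: real
  assumes ab: "a \<le> b" and R: "\<bar>a\<bar> \<le> R" "\<bar>b\<bar> \<le> R"
  obtains c C :: real and M where "0 < c" "c < C"
    "\<And>m X P Q z. M \<le> m \<Longrightarrow> set X \<subseteq> {a..b} \<Longrightarrow> length X = 2 * m + 1 \<Longrightarrow> degree P \<le> m \<Longrightarrow> degree Q \<le> m \<Longrightarrow>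
       P \<noteq> 0 \<or> Q \<noteq> 0 \<Longrightarrow> vanishes X (remainder 1 1 P Q) \<Longrightarrow> norm z \<le> R \<Longrightarrow>
       c * norm (poly (nodal X) z) \<le> growth m * growth (Suc m) * norm (exp z - poly Q z / poly P z) \<and>
       growth m * growth (Suc m) * norm (exp z - poly Q z / poly P z) \<le> C * norm (poly (nodal X) z)"
proof -
  obtain c C :: real and M where c: "0 < c" "c \<le> C" and
    bnds: "\<And>m X P Q. M \<le> m \<Longrightarrow> set X \<subseteq> {a..b} \<Longrightarrow> length X = 2 * m + 1 \<Longrightarrow> degree P \<le> m \<Longrightarrow> degree Q \<le> m \<Longrightarrow>
       P \<noteq> 0 \<or> Q \<noteq> 0 \<Longrightarrow> vanishes X (remainder 1 1 P Q) \<Longrightarrow> \<exists>\<rho>. exp_pair_bounds R c C m P Q \<rho>"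
    using exp_pair_bounds_exist[OF ab R] by blast
  have R0: "R \<ge> 0" using R by linarith
  \<comment> \<open>Chosen so that \<open>k2 * (4 * R\<^sup>2) = k1 * \<kappa>\<close>: two further
    nodes cost a factor of at most 4 R^2, and m \<ge> 4 \<kappa> lets the growth factors outweigh
    this by a factor 4.\<close>
  define \<kappa> where "\<kappa> = 4 * R\<^sup>2 * (C / c) * (C / c)\<^sup>2"
  define M' where "M' = Suc (M + nat \<lceil>4 * \<kappa>\<rceil>)"
  \<comment> \<open>The sum of consecutive \<rho> lies between 2 c and 2 C, and each normalised
    denominator between c and C.\<close>
  define k1 k2 where "k1 = 2 * c / C\<^sup>2" and "k2 = 2 * C / c\<^sup>2"
  have k: "0 < k1" "k1 \<le> k2"
  proof -
    show "0 < k1" using c by (simp add: k1_def)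
    have "c\<^sup>2 \<le> C\<^sup>2" using c by (intro power_mono) auto
    then show "k1 \<le> k2" unfolding k1_def k2_def using c by (intro frac_le) auto
  qed
  show thesis
  proof (rule that[of "k1 / 2" "2 * k2" M'])
    show "0 < k1 / 2" "k1 / 2 < 2 * k2" using k by auto
    fix m X P Q and z :: complex
    assume hyp: "M' \<le> m" "set X \<subseteq> {a..b}" "length X = 2 * m + 1" "degree P \<le> m" "degree Q \<le> m" "P \<noteq> 0 \<or> Q \<noteq> 0"
       "vanishes X (remainder 1 1 P Q)" and z: "norm z \<le> R"
    \<comment> \<open>Two nodes are added per step, since both degrees rise by one.\<close>
    define Xs where "Xs j = X @ replicate (2 * j) a" for j
    have Xs: "set (Xs j) \<subseteq> {a..b}" "length (Xs j) = 2 * (m + j) + 1" for j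
      using hyp(2,3) ab by (auto simp: Xs_def)
    have Xs_Suc: "Xs (Suc j) = Xs j @ [a, a]" for j
    proof -
      have "replicate (2 * Suc j) a = replicate (2 * j) a @ replicate 2 a"
        unfolding replicate_add[symmetric] by simp
      then show ?thesis by (simp add: Xs_def numeral_2_eq_2)
    qed
    have "\<forall>j. \<exists>pq. degree (fst pq) \<le> m + j \<and> degree (snd pq) \<le> m + j \<and> (fst pq \<noteq> 0 \<or> snd pq \<noteq> 0) \<and>
       vanishes (Xs j) (remainder 1 1 (fst pq) (snd pq)) \<and> (j = 0 \<longrightarrow> pq = (P, Q))"
    proof
      fix j
      show "\<exists>pq. degree (fst pq) \<le> m + j \<and> degree (snd pq) \<le> m + j \<and> (fst pq \<noteq> 0 \<or> snd pq \<noteq> 0) \<and>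
       vanishes (Xs j) (remainder 1 1 (fst pq) (snd pq)) \<and> (j = 0 \<longrightarrow> pq = (P, Q))"
      proof (cases "j = 0")
        case True
        then show ?thesis using hyp by (intro exI[of _ "(P, Q)"]) (simp add: Xs_def)
      next
        case False
        have "length (Xs j) \<le> (m + j) + (m + j) + 1" using Xs(2)[of j] by simp
        then obtain p q where "degree p \<le> m + j" "degree q \<le> m + j" "p \<noteq> 0 \<or> q \<noteq> 0" "vanishes (Xs j) (remainder 1 1 p q)"
          using interpolant_exists[OF edrei_poly_real edrei_poly_real, of "Xs j" "m + j" "m + j" "\<lambda>_. 0" 0 "\<lambda>_. 0" 0]
          by (metis edrei_poly_0)
        then show ?thesis using False by (intro exI[of _ "(p, q)"]) simp
      qed
    qed
    then obtain PQ where PQ: "\<And>j. degree (fst (PQ j)) \<le> m + j" "\<And>j. degree (snd (PQ j)) \<le> m + j"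
      "\<And>j. fst (PQ j) \<noteq> 0 \<or> snd (PQ j) \<noteq> 0" "\<And>j. vanishes (Xs j) (remainder 1 1 (fst (PQ j)) (snd (PQ j)))" "PQ 0 = (P, Q)"
      by metis
    define p q where "p j = fst (PQ j)" and "q j = snd (PQ j)" for j
    have Mj: "M \<le> m + j" for j using hyp(1) by (simp add: M'_def)
    have "\<forall>j. \<exists>\<rho>. exp_pair_bounds R c C (m + j) (p j) (q j) \<rho>"
      unfolding p_def q_def using bnds[OF Mj Xs PQ(1,2,3,4)] by blast
    then obtain \<rho> where \<rho>: "\<And>j. exp_pair_bounds R c C (m + j) (p j) (q j) (\<rho> j)" by metis
    define L where "L j = norm (lead_coeff (p j)) * growth (m + j)" for j
    have p_bounds: "c * L j \<le> norm (poly (p j) z)" "norm (poly (p j) z) \<le> C * L j" for j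
      using \<rho>[of j] z by (auto simp: exp_pair_bounds_def L_def)
    have p0: "p j \<noteq> 0" for j
    proof
      assume "p j = 0"
      have "lead_coeff (q j) = (-1) ^ (m + j) * of_real (\<rho> j) * lead_coeff (p j)"
        using \<rho>[of j] unfolding exp_pair_bounds_def by blast
      then have "q j = 0" unfolding \<open>p j = 0\<close> by simp
      then show False using PQ(3)[of j] \<open>p j = 0\<close> unfolding p_def q_def by blast
    qed
    have L: "L j > 0" for j unfolding L_def using p0[of j] growth_pos[of "m + j"] by simp
    have pz: "poly (p j) z \<noteq> 0" for j using p_bounds(1)[of j] L[of j] c(1) by (metis mult_pos_pos norm_zero not_less)
    have \<rho>b: "c \<le> \<rho> j" "\<rho> j \<le> C" for j using \<rho>[of j] by (auto simp: exp_pair_bounds_def)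
    define r where "r j = poly (q j) z / poly (p j) z" for j
    define V where "V j = norm (poly (nodal (Xs j)) z)" for j
    define g where "g j = growth (m + j)" for j
    have g: "g j > 0" for j unfolding g_def by (rule growth_pos)
    define T where "T j = norm (r (Suc j) - r j)" for j
    define S where "S j = norm (lead_coeff (p j)) * norm (lead_coeff (p (Suc j)))" for j
    have T_eq: "T j = S j * (\<rho> j + \<rho> (Suc j)) * V j / (norm (poly (p j) z) * norm (poly (p (Suc j)) z))" for j
    proof -
      have v: "vanishes (Xs j) (remainder 1 1 (p j) (q j))" "vanishes (Xs j @ [a, a]) (remainder 1 1 (p (Suc j)) (q (Suc j)))"
        using PQ(4)[of j] PQ(4)[of "Suc j"] by (simp_all add: p_def q_def Xs_Suc)
      have "exp_pair_bounds R c C (Suc (m + j)) (p (Suc j)) (q (Suc j)) (\<rho> (Suc j))" using \<rho>[of "Suc j"] by simp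
      from consecutive_difference[OF \<rho> this v Xs(2) c(1)]
      have W: "p j * q (Suc j) - p (Suc j) * q j = smult ((-1) ^ Suc (m + j) * lead_coeff (p j) * lead_coeff (p (Suc j)) * of_real (\<rho> j + \<rho> (Suc j))) (nodal (Xs j))" .
      have "r (Suc j) - r j = poly (p j * q (Suc j) - p (Suc j) * q j) z / (poly (p j) z * poly (p (Suc j)) z)"
        unfolding r_def using pz[of j] pz[of "Suc j"] by (simp add: field_simps)
      then have "T j = norm (poly (p j * q (Suc j) - p (Suc j) * q j) z) / (norm (poly (p j) z) * norm (poly (p (Suc j)) z))"
        unfolding T_def by (simp only: norm_divide norm_mult)
      also have "norm (poly (p j * q (Suc j) - p (Suc j) * q j) z) = S j * \<bar>\<rho> j + \<rho> (Suc j)\<bar> * V j"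
        unfolding W poly_smult norm_mult norm_power norm_of_real S_def V_def by simp
      also have "\<bar>\<rho> j + \<rho> (Suc j)\<bar> = \<rho> j + \<rho> (Suc j)" using \<rho>b[of j] \<rho>b[of "Suc j"] c by simp
      finally show ?thesis .
    qed
    have S: "S j > 0" and LL: "L j * L (Suc j) = S j * (g j * g (Suc j))" for j
      using p0[of j] p0[of "Suc j"] by (simp_all add: S_def L_def g_def)
    have V0: "V j \<ge> 0" for j by (simp add: V_def)
    have T_hi: "T j \<le> k2 * V j / (g j * g (Suc j))" for j
    proof -
      have "T j \<le> S j * (2 * C) * V j / ((c * L j) * (c * L (Suc j)))"
        unfolding T_eq using p_bounds[of j] p_bounds[of "Suc j"] \<rho>b[of j] \<rho>b[of "Suc j"] S[of j] V0[of j] c L[of j] L[of "Suc j"]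
        by (intro frac_le mult_mono mult_right_mono mult_left_mono mult_nonneg_nonneg) (auto intro: mult_pos_pos)
      also have "(c * L j) * (c * L (Suc j)) = S j * (c\<^sup>2 * (g j * g (Suc j)))"
        using LL[of j] by (simp add: power2_eq_square mult_ac)
      also have "S j * (2 * C) * V j / (S j * (c\<^sup>2 * (g j * g (Suc j)))) = k2 * V j / (g j * g (Suc j))"
        using S[of j] by (simp add: k2_def)
      finally show ?thesis .
    qed
    have T_lo: "T j \<ge> k1 * V j / (g j * g (Suc j))" for j
    proof -
      have "k1 * V j / (g j * g (Suc j)) = S j * (2 * c) * V j / (S j * (C\<^sup>2 * (g j * g (Suc j))))"
        using S[of j] by (simp add: k1_def)
      also have "S j * (C\<^sup>2 * (g j * g (Suc j))) = (C * L j) * (C * L (Suc j))"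
        using LL[of j] by (simp add: power2_eq_square mult_ac)
      also have "S j * (2 * c) * V j / ((C * L j) * (C * L (Suc j))) \<le> T j"
        unfolding T_eq using p_bounds[of j] p_bounds[of "Suc j"] \<rho>b[of j] \<rho>b[of "Suc j"] S[of j] V0[of j] c L[of j] L[of "Suc j"] pz
        by (intro frac_le mult_mono mult_right_mono mult_left_mono mult_nonneg_nonneg mult_pos_pos) auto
      finally show ?thesis .
    qed
    have T_dec: "T (Suc j) \<le> T j / 4" for j
    proof -
      have "V (Suc j) = V j * (norm (z - of_real a))\<^sup>2"
        by (simp add: V_def Xs_Suc nodal_append poly_nodal_Cons norm_mult power2_eq_square)
      also have "\<dots> \<le> V j * (2 * R)\<^sup>2"
        using norm_triangle_ineq4[of z "of_real a"] z R V0 by (intro mult_left_mono power_mono) auto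
      finally have V: "V (Suc j) \<le> 4 * R\<^sup>2 * V j" by (simp add: power_mult_distrib mult_ac)
      have gg: "g (Suc j) = g j * (2 * (2 * real (m + j) + 1))" "g (Suc (Suc j)) = g (Suc j) * (2 * (2 * real (Suc (m + j)) + 1))"
        unfolding g_def using growth_Suc[of "m + j"] growth_Suc[of "Suc (m + j)"] by simp_all
      have mq: "4 * \<kappa> \<le> m" "m \<ge> 1" using hyp(1) unfolding M'_def by linarith+
      have big: "g (Suc (Suc j)) \<ge> g j * (4 * \<kappa>)"
      proof -
        have "g j * (4 * \<kappa>) \<le> g j * m" using mq g[of j] by (intro mult_left_mono) auto
        also have "\<dots> \<le> g j * ((2 * (2 * real (m + j) + 1)) * (2 * (2 * real (Suc (m + j)) + 1)))"
        proof (rule mult_left_mono)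
          have "real m * 1 \<le> (2 * (2 * real (m + j) + 1)) * (2 * (2 * real (Suc (m + j)) + 1))"
            by (rule mult_mono) auto
          then show "real m \<le> (2 * (2 * real (m + j) + 1)) * (2 * (2 * real (Suc (m + j)) + 1))" by simp
        qed (use g[of j] in simp)
        also have "\<dots> = g (Suc (Suc j))" unfolding gg(2) unfolding gg(1) by (simp only: mult.assoc)
        finally show ?thesis .
      qed
      have q0: "\<kappa> \<ge> 0" using c by (simp add: \<kappa>_def)
      have kq: "k2 * (4 * R\<^sup>2) = k1 * \<kappa>"
        unfolding k1_def k2_def \<kappa>_def using c by (simp add: field_simps power2_eq_square)
      have "T (Suc j) * (g (Suc j) * g (Suc (Suc j))) \<le> k2 * V (Suc j)"
        using T_hi[of "Suc j"] g[of "Suc j"] g[of "Suc (Suc j)"] by (simp add: field_simps)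
      also have "\<dots> \<le> k2 * (4 * R\<^sup>2 * V j)" using V k by (intro mult_left_mono) auto
      also have "\<dots> = \<kappa> * (k1 * V j)" using kq by (simp add: mult_ac)
      also have "\<dots> \<le> \<kappa> * (T j * (g j * g (Suc j)))"
        using T_lo[of j] g[of j] g[of "Suc j"] q0 by (intro mult_left_mono) (simp_all add: field_simps)
      also have "\<dots> = (T j / 4) * (g (Suc j) * (g j * (4 * \<kappa>)))" by simp
      also have "\<dots> \<le> (T j / 4) * (g (Suc j) * g (Suc (Suc j)))"
        using big g[of "Suc j"] by (intro mult_left_mono) (auto simp: T_def)
      finally show ?thesis using g[of "Suc j"] g[of "Suc (Suc j)"] by (simp add: mult_le_cancel_right)
    qed
    \<comment> \<open>The convergence theorem at the point z identifies the limit of the telescoping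
      sum as exp z.\<close>
    have lim: "\<exists>J\<ge>1. norm (r J - exp z) < \<epsilon>" if \<epsilon>: "\<epsilon> > 0" for \<epsilon>
    proof -
      have adm: "admissible 0 0 (\<lambda>_. 0) (\<lambda>_. 0) {a..b}" by (simp add: admissible_def)
      obtain N where N: "\<forall>n X P Q z'. N \<le> n \<longrightarrow> set X \<subseteq> {a..b} \<longrightarrow> length X = 2 * n + 1 \<longrightarrow>
         degree P \<le> n \<longrightarrow> degree Q \<le> n \<longrightarrow> P \<noteq> 0 \<or> Q \<noteq> 0 \<longrightarrow>
         vanishes X (remainder (edrei_poly (\<lambda>_. 0) 0) (edrei_poly (\<lambda>i. - 0) 0) P Q) \<longrightarrow> z' \<in> {z} \<longrightarrow>
         poly P z' \<noteq> 0 \<and> norm (poly Q z' / poly P z' -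
           exp z' * (poly (edrei_poly (\<lambda>_. 0) 0) z' / poly (edrei_poly (\<lambda>i. - 0) 0) z')) < \<epsilon>"
        using ratio_converges[OF ab adm, of "{z}" \<epsilon>] \<epsilon> by auto
      have "N \<le> m + Suc N" by simp
      from N[rule_format, OF this Xs PQ(1,2,3), of z] PQ(4)[of "Suc N"]
      have "norm (r (Suc N) - exp z) < \<epsilon>" by (simp add: r_def p_def q_def)
      then show ?thesis by (intro exI[of _ "Suc N"]) simp
    qed
    note tele = geometric_telescope[of r T "exp z", OF T_def[symmetric] T_dec lim]
    have r0: "r 0 = poly Q z / poly P z" and V00: "V 0 = norm (poly (nodal X) z)" and g01: "g 0 = growth m" "g (Suc 0) = growth (Suc m)"
      using PQ(5) by (simp_all add: r_def p_def q_def V_def Xs_def g_def)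
    have gp: "g 0 * g (Suc 0) > 0" using g by simp
    have "k1 * V 0 \<le> T 0 * (g 0 * g (Suc 0))" "T 0 * (g 0 * g (Suc 0)) \<le> k2 * V 0"
      using T_lo[of 0] T_hi[of 0] gp by (simp_all add: pos_divide_le_eq pos_le_divide_eq)
    moreover have "(g 0 * g (Suc 0)) * (T 0 / 2) \<le> (g 0 * g (Suc 0)) * norm (exp z - r 0)"
      by (rule mult_left_mono[OF tele(1) less_imp_le[OF gp]])
    moreover have "(g 0 * g (Suc 0)) * norm (exp z - r 0) \<le> (g 0 * g (Suc 0)) * (2 * T 0)"
      by (rule mult_left_mono[OF tele(2) less_imp_le[OF gp]])
    ultimately show "k1 / 2 * norm (poly (nodal X) z) \<le> growth m * growth (Suc m) * norm (exp z - poly Q z / poly P z) \<and>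
       growth m * growth (Suc m) * norm (exp z - poly Q z / poly P z) \<le> 2 * k2 * norm (poly (nodal X) z)"
      unfolding r0[symmetric] V00[symmetric] g01[symmetric] by (simp add: mult_ac)
  qed
qed

subsection \<open>AAA approximants\<close>

lemma edrei_fun_complex:
  "edrei_fun k l \<alpha> \<beta> z = exp z * (poly (edrei_poly \<alpha> k) z / poly (edrei_poly (\<lambda>i. - \<beta> i) l) z)"
  by (simp add: edrei_fun_def poly_edrei_poly)

lemma edrei_poly_eq_0_iff:
  "poly (edrei_poly \<alpha> k) z = 0 \<longleftrightarrow> (\<exists>i\<in>{1..k}. 1 + of_real (\<alpha> i) * z = 0)"
  by (simp add: poly_edrei_poly)

text \<open>Zeros of A are negative and zeros of B positive, so none cancel. Each nontrivial factor
  yields a genuine zero or pole of F, and the position of the interval becomes positivity of the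
  linear factors.\<close>

lemma admissible_if_between_zeros_and_poles:
  fixes F :: "complex \<Rightarrow> complex"
  assumes F: "F = edrei_fun k l \<alpha> \<beta>"
    and \<alpha>: "\<forall>i\<in>{1..k}. \<alpha> i \<ge> 0" and \<beta>: "\<forall>i\<in>{1..l}. \<beta> i \<ge> 0"
    and zeros: "largest_real_zero F < ereal a" and poles: "ereal b < smallest_real_pole F"
  shows "admissible k l \<alpha> \<beta> {a..b}"
proof -
  let ?A = "poly (edrei_poly \<alpha> k)" and ?B = "poly (edrei_poly (\<lambda>i. - \<beta> i) l)"
  have F_eq: "F = (\<lambda>z. (exp z * ?A z) / ?B z)"
    unfolding F by (simp add: fun_eq_iff edrei_fun_complex)
  have A_nz: "?A (of_real x) \<noteq> 0" if "x > 0" for x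
  proof (rule edrei_poly_nonzero_at, intro ballI)
    fix i assume "i \<in> {1..k}"
    then have "\<alpha> i * x \<ge> 0" using \<alpha> that by (intro mult_nonneg_nonneg) auto
    then show "1 + \<alpha> i * x > 0" by simp
  qed
  have B_nz: "?B (of_real x) \<noteq> 0" if "x < 0" for x
  proof (rule edrei_poly_nonzero_at, intro ballI)
    fix i assume "i \<in> {1..l}"
    then have "\<beta> i * (- x) \<ge> 0" using \<beta> that by (intro mult_nonneg_nonneg) auto
    then show "1 + - \<beta> i * x > 0" by simp
  qed
  have 1: "1 + \<alpha> i * x > 0" if i: "i \<in> {1..k}" and x: "x \<in> {a..b}" for i x
  proof (cases "\<alpha> i = 0")
    case False
    then have pos: "\<alpha> i > 0" using \<alpha> i by force
    define y where "y = - 1 / \<alpha> i"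
    have y: "y < 0" using pos by (simp add: y_def)
    have "1 + of_real (\<alpha> i) * complex_of_real y = of_real (1 + \<alpha> i * y)" by simp
    also have "\<dots> = 0" using pos by (simp add: y_def)
    finally have "?A (of_real y) = 0" unfolding edrei_poly_eq_0_iff using i by blast
    then have zero: "F (of_real y) = 0" unfolding F_eq by simp
    have "isCont F (of_real y)" unfolding F_eq using B_nz[OF y] by (intro continuous_intros) auto
    then have "\<not> is_pole F (of_real y)"
      unfolding isCont_def is_pole_def using not_tendsto_and_filterlim_at_infinity trivial_limit_at by blast
    then have "ereal y \<le> largest_real_zero F"
      unfolding largest_real_zero_def using zero by (intro Sup_upper) blast
    then have "ereal y < ereal a" using zeros by (rule le_less_trans)
    then have "y < x" using x by simp
    then have "\<alpha> i * y < \<alpha> i * x" using pos by (rule mult_strict_left_mono)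
    then show ?thesis using pos by (simp add: y_def)
  qed simp
  have 2: "1 - \<beta> i * x > 0" if i: "i \<in> {1..l}" and x: "x \<in> {a..b}" for i x
  proof (cases "\<beta> i = 0")
    case False
    then have pos: "\<beta> i > 0" using \<beta> i by force
    define y where "y = 1 / \<beta> i"
    have y: "y > 0" using pos by (simp add: y_def)
    have "1 + of_real (- \<beta> i) * complex_of_real y = of_real (1 - \<beta> i * y)" by simp
    also have "\<dots> = 0" using pos by (simp add: y_def)
    finally have B0: "?B (of_real y) = 0" unfolding edrei_poly_eq_0_iff using i by blast
    have "is_pole (\<lambda>z. (exp z * ?A z) / ?B z) (of_real y)"
    proof (rule is_pole_divide)
      show "isCont (\<lambda>z. exp z * ?A z) (of_real y)" by (intro continuous_intros)
      show "exp (of_real y) * ?A (of_real y) \<noteq> 0" using A_nz[OF y] by simp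
      have "isCont ?B (of_real y)" by (intro continuous_intros)
      then have "(?B \<longlongrightarrow> 0) (at (of_real y))" unfolding isCont_def B0 .
      moreover have "eventually (\<lambda>z. ?B z \<noteq> 0) (at (of_real y))"
      proof -
        have "finite {z. ?B z = 0}" by (rule poly_roots_finite) simp
        then have "open (- ({z. ?B z = 0} - {of_real y}))" by (intro open_Compl finite_imp_closed) simp
        then have "eventually (\<lambda>z. z \<in> - ({z. ?B z = 0} - {of_real y})) (nhds (of_real y))"
          by (rule eventually_nhds_in_open) simp
        then show ?thesis unfolding eventually_at_filter by eventually_elim auto
      qed
      ultimately show "filterlim ?B (at 0) (at (of_real y))" by (simp add: filterlim_at)
    qed
    then have "smallest_real_pole F \<le> ereal y"
      unfolding smallest_real_pole_def F_eq by (intro Inf_lower) blast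
    with poles have "ereal b < ereal y" by (rule less_le_trans)
    then have "x < y" using x by simp
    then have "\<beta> i * x < \<beta> i * y" using pos by (rule mult_strict_left_mono)
    then show ?thesis using pos by (simp add: y_def)
  qed simp
  show ?thesis unfolding admissible_def using \<alpha> \<beta> 1 2 by blast
qed

context aaa_measure
begin

lemma node_basis_eq: "node_basis n t i = LJ {1..n} i"
  by (simp add: node_basis_def LJ_def)

lemma aaa_denom_eq: "aaa_denom n t c = PJ {1..n} c"
  by (simp add: aaa_denom_def PJ_def node_basis_eq)

lemma aaa_numer_eq: "aaa_numer f n t c = PJ {1..n} (\<lambda>i. c i * f (t i))"
  by (simp add: aaa_numer_def PJ_def node_basis_eq)

text \<open>The n support points are zeros for any weights; the other n - 1 zeros are due to
  minimality.\<close>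

lemma aaa_interpolates:
  assumes w: "aaa_weights f \<nu> n t w" and n: "n \<ge> 1"
  shows "degree (aaa_denom n t w) \<le> n - 1" "degree (aaa_numer f n t w) \<le> n - 1" "aaa_denom n t w \<noteq> 0"
    "\<exists>X. set X \<subseteq> {a..b} \<and> length X = 2 * n - 1 \<and> vanishes X (remainder A B (aaa_denom n t w) (aaa_numer f n t w))"
proof -
  show "degree (aaa_denom n t w) \<le> n - 1" "degree (aaa_numer f n t w) \<le> n - 1"
    unfolding aaa_denom_eq aaa_numer_eq using degree_PJ[of "{1..n}"] by simp_all
  obtain i where i: "i \<in> {1..n}" "w i \<noteq> 0" using weights_nonzero[OF w] .
  have "poly (aaa_denom n t w) (of_real (t i)) = of_real (w i * (\<Prod>j\<in>{1..n} - {i}. t i - t j))"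
    unfolding aaa_denom_eq by (rule poly_PJ_node) (use i in auto)
  moreover have "w i * (\<Prod>j\<in>{1..n} - {i}. t i - t j) \<noteq> 0"
    using i(2) node_product_sign[OF i(1)] by (metis less_irrefl mult_eq_0_iff mult_zero_right)
  ultimately show "aaa_denom n t w \<noteq> 0" by (metis of_real_eq_0_iff poly_0)
  obtain S where S: "set S \<subseteq> {a..b}" "vanishes S (h w)" "length S = n - 1"
    using weights_zeros[OF w n] by blast
  have "vanishes (nodes {1..n} @ S) (remainder A B (aaa_denom n t w) (aaa_numer f n t w))"
  proof (rule vanishes_cong[OF vanishes_times_nodal[OF S(2)]])
    show "poly (nodal (nodes {1..n})) z * h w z = remainder A B (aaa_denom n t w) (aaa_numer f n t w) z" for z
      unfolding aaa_denom_eq aaa_numer_eq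
      by (simp only: remainder_PJ[OF finite_atLeastAtMost order_refl] h_def)
  qed
  moreover have "set (nodes {1..n} @ S) \<subseteq> {a..b}" using S(1) t_in by (simp add: set_nodes)
  moreover have "length (nodes {1..n} @ S) = 2 * n - 1" using S(3) n length_nodes[of "{1..n}"] by simp
  ultimately show "\<exists>X. set X \<subseteq> {a..b} \<and> length X = 2 * n - 1 \<and> vanishes X (remainder A B (aaa_denom n t w) (aaa_numer f n t w))"
    by blast
qed

end

text \<open>Dividing out a common zero lowers both degrees by one and costs at most one node. The
  remaining 2 n - 2 nodes are one more than a nonzero pair of degrees n - 2 admits.\<close>

lemma interpolant_irreducible:
  assumes adm: "admissible k l \<alpha> \<beta> (set X)"
    and van: "vanishes X (remainder (edrei_poly \<alpha> k) (edrei_poly (\<lambda>i. - \<beta> i) l) P Q)"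
    and deg: "degree P \<le> n - 1" "degree Q \<le> n - 1" "length X = 2 * n - 1" and P: "P \<noteq> 0"
  shows "\<not> (poly P z = 0 \<and> poly Q z = 0)"
proof
  let ?rem = "remainder (edrei_poly \<alpha> k) (edrei_poly (\<lambda>i. - \<beta> i) l)"
  assume z: "poly P z = 0 \<and> poly Q z = 0"
  obtain P1 Q1 where PQ: "P = [:- z, 1:] * P1" "Q = [:- z, 1:] * Q1"
    using z by (metis dvdE poly_eq_0_iff_dvd)
  have P1: "P1 \<noteq> 0" using P PQ by auto
  have "degree P = Suc (degree P1)" unfolding PQ(1) using P1 by (subst degree_mult_eq) auto
  then have n2: "n \<ge> 2" "degree P1 \<le> n - 2" using deg(1) by linarith+
  have degQ: "degree Q1 \<le> n - 2"
  proof (cases "Q1 = 0")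
    case False
    then have "degree Q = Suc (degree Q1)" unfolding PQ(2) by (subst degree_mult_eq) auto
    then show ?thesis using deg(2) by linarith
  qed simp
  have rem: "?rem P Q u = (u - z) * ?rem P1 Q1 u" for u
    unfolding PQ remainder_def by (simp add: algebra_simps)
  have hol: "?rem P1 Q1 holomorphic_on UNIV"
    unfolding remainder_def[abs_def] by (intro holomorphic_intros)
  have "\<exists>Y. set Y \<subseteq> set X \<and> length Y \<ge> 2 * n - 2 \<and> vanishes Y (?rem P1 Q1)"
  \<comment> \<open>A common zero at a node uses up one copy of it; elsewhere the nodes are
    untouched.\<close>
  proof (cases "\<exists>x\<in>set X. z = of_real x")
    case True
    then obtain x where x: "x \<in> set X" "z = of_real x" by blast
    have "mset (x # remove1 x X) = mset X" using x by simp
    then have "vanishes (x # remove1 x X) (?rem P Q)" using van vanishes_mset_cong by metis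
    then have "vanishes (x # remove1 x X) (\<lambda>u. (u - of_real x) * ?rem P1 Q1 u)"
      by (rule vanishes_cong) (simp only: rem x(2))
    then have "vanishes (remove1 x X) (?rem P1 Q1)" using hol by (rule vanishes_Cons_cancel)
    moreover have "length (remove1 x X) = 2 * n - 2" using x deg(3) by (simp add: length_remove1)
    ultimately show ?thesis using set_remove1_subset[of x X] by (metis order_refl)
  next
    case False
    obtain g where g: "g holomorphic_on UNIV" "\<And>u. ?rem P Q u = poly (nodal X) u * g u"
      using van by (auto simp: vanishes_def)
    have "poly (nodal X) z \<noteq> 0" using False by (auto simp: poly_nodal_eq_0_iff)
    moreover have "poly (nodal X) z * g z = 0" using g(2)[of z] rem[of z] by simp
    ultimately have "g z = 0" by simp
    then obtain g1 where g1: "g1 holomorphic_on UNIV" "\<And>u. g u = (u - z) * g1 u"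
      using entire_factor[OF g(1)] by metis
    have "?rem P1 Q1 = (\<lambda>u. poly (nodal X) u * g1 u)"
    proof (rule entire_cancel_linear[OF hol])
      show "(\<lambda>u. poly (nodal X) u * g1 u) holomorphic_on UNIV" by (intro holomorphic_intros g1)
      show "(u - z) * ?rem P1 Q1 u = (u - z) * (poly (nodal X) u * g1 u)" for u
        using g(2)[of u] unfolding rem g1(2) by (simp only: mult_ac)
    qed
    then have "vanishes X (?rem P1 Q1)" unfolding vanishes_def using g1(1) by metis
    then show ?thesis using deg(3) by (intro exI[of _ X]) auto
  qed
  then obtain Y where Y: "set Y \<subseteq> set X" "length Y \<ge> 2 * n - 2" "vanishes Y (?rem P1 Q1)" by blast
  have "P1 = 0 \<and> Q1 = 0"
    by (rule remainder_unique[OF admissible_subset[OF adm Y(1)] Y(3) n2(2) degQ]) (use Y(2) n2(1) in linarith)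
  with P1 show False by blast
qed

text \<open>The extension is given only near [a, b], but all zeros of the nodal function lie there;
  gluing it with the quotient elsewhere gives an entire cofactor. Any such t' thus yields its own
  node list, to which the error bounds apply directly.\<close>

lemma vanishes_if_extra_nodes:
  assumes ex: "extra_nodes a b exp P Q n t t'" and t: "t ` {1..n} \<subseteq> {a..b}" and n: "n \<ge> 1"
  obtains X where "set X \<subseteq> {a..b}" "length X = 2 * n - 1" "vanishes X (remainder 1 1 P Q)"
    "nodal_fun n t t' = poly (nodal X)"
proof -
  define X where "X = map t [1..<Suc n] @ map t' [1..<n]"
  have t': "t' ` {1..n-1} \<subseteq> {a<..<b}" using ex by (simp add: extra_nodes_def)
  have X_ab: "set X \<subseteq> {a..b}"
  proof
    fix x assume "x \<in> set X"
    then consider i where "i \<in> {1..n}" "x = t i" | i where "i \<in> {1..n-1}" "x = t' i"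
      unfolding X_def by fastforce
    then show "x \<in> {a..b}"
    proof cases
      case 1
      then show ?thesis using t by blast
    next
      case 2
      then have "x \<in> {a<..<b}" using t' by blast
      then show ?thesis by simp
    qed
  qed
  have len: "length X = 2 * n - 1" using n by (simp add: X_def)
  have prod: "(\<Prod>x\<leftarrow>map s [1..<Suc m]. z - complex_of_real x) = (\<Prod>k=1..m. z - of_real (s k))" for s m z
    by (induction m) (simp_all add: o_def)
  have nodal: "nodal_fun n t t' = poly (nodal X)"
  proof
    fix z
    have "[1..<n] = [1..<Suc (n - 1)]" using n by simp
    then show "nodal_fun n t t' z = poly (nodal X) z"
      unfolding nodal_fun_def X_def nodal_append poly_mult poly_nodal
      using prod[where s = t and m = n] prod[where s = t' and m = "n - 1"] by simp
  qed
  let ?V = "poly (nodal X)" and ?r = "remainder 1 1 P Q"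
  obtain D g where D: "open D" "of_real ` {a..b} \<subseteq> D" "g holomorphic_on D"
    "\<forall>z\<in>D. ?V z \<noteq> 0 \<longrightarrow> g z = (poly P z * exp z - poly Q z) / ?V z"
    using ex unfolding extra_nodes_def nodal by blast
  have r: "?r z = poly P z * exp z - poly Q z" for z by (simp add: remainder_def)
  define G where "G z = (if ?V z = 0 then g z else ?r z / ?V z)" for z
  have "G holomorphic_on D \<union> {z. ?V z \<noteq> 0}"
  proof (rule holomorphic_on_Un)
    have "G z = g z" if "z \<in> D" for z using D(4) that by (auto simp: G_def r)
    then show "G holomorphic_on D" using D(3) by (metis holomorphic_cong)
    have "(\<lambda>z. ?r z / ?V z) holomorphic_on {z. ?V z \<noteq> 0}"
      unfolding r[abs_def] by (intro holomorphic_intros) auto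
    then show "G holomorphic_on {z. ?V z \<noteq> 0}"
      by (rule holomorphic_transform) (simp add: G_def)
    have "finite {z. ?V z = 0}" by (rule poly_roots_finite) simp
    then have "open (- {z. ?V z = 0})" by (intro open_Compl finite_imp_closed)
    then show "open {z. ?V z \<noteq> 0}" by (simp add: Collect_neg_eq)
  qed (rule D(1))
  moreover have "D \<union> {z. ?V z \<noteq> 0} = UNIV" using D(2) X_ab by (auto simp: poly_nodal_eq_0_iff)
  ultimately have G: "G holomorphic_on UNIV" by simp
  have "?r = (\<lambda>z. ?V z * G z)"
  proof (rule continuous_cancel_nodal)
    show "continuous_on UNIV ?r" unfolding r[abs_def] by (intro continuous_intros)
    show "continuous_on UNIV (\<lambda>z. ?V z * G z)" by (intro continuous_intros entire_imp_continuous G)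
    show "?V z * ?r z = ?V z * (?V z * G z)" for z by (simp add: G_def)
  qed
  then have "vanishes X ?r" unfolding vanishes_def using G by metis
  then show thesis using that X_ab len nodal by blast
qed

text \<open>The constant of the telescoping argument is twice the factorial expression of the
  theorem, whence the halved constants in the final bounds.\<close>

lemma growth_product:
  assumes "n \<ge> 1"
  shows "growth (n - 1) * growth n = 2 * (fact (2 * n - 2) * fact (2 * n - 1) / (fact (n - 1) * fact (n - 1)))"
proof -
  obtain m where m: "n = Suc m" using assms by (cases n) auto
  have "fact (2 * n) = 2 * (real m + 1) * fact (2 * n - 1)" unfolding m by (simp add: algebra_simps)
  moreover have "fact n = (real m + 1) * fact (n - 1)" unfolding m by (simp add: algebra_simps)
  moreover have "2 * (n - 1) = 2 * n - 2" by simp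
  moreover have "x / f * (2 * u * y / (u * f)) = 2 * (x * y / (f * f))" if "u \<noteq> 0" for x y u f :: real
    using that by simp
  moreover have "real m + 1 \<noteq> 0" by linarith
  ultimately show ?thesis unfolding growth_def by metis
qed

theorem corollary3:
  fixes k l :: nat and \<alpha> \<beta> :: "nat \<Rightarrow> real" and a b :: real
    and \<nu> :: "nat \<Rightarrow> real measure" and t w :: "nat \<Rightarrow> nat \<Rightarrow> real"
    and F :: "complex \<Rightarrow> complex" and f :: "real \<Rightarrow> real"
    and P Q :: "nat \<Rightarrow> complex poly" and R :: "nat \<Rightarrow> complex \<Rightarrow> complex"
  defines "F \<equiv> edrei_fun k l \<alpha> \<beta>" and "f \<equiv> edrei_fun k l \<alpha> \<beta>"
    and "P \<equiv> \<lambda>n. aaa_denom n (t n) (w n)"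
    and "Q \<equiv> \<lambda>n. aaa_numer f n (t n) (w n)"
    and "R \<equiv> \<lambda>n. aaa_approx f n (t n) (w n)"
  assumes "\<forall>i\<in>{1..k}. \<alpha> i \<ge> 0" and "\<forall>i\<in>{1..l}. \<beta> i \<ge> 0"
    and "a < b" and "largest_real_zero F < ereal a" and "ereal b < smallest_real_pole F"
    and "\<And>n. n \<ge> 1 \<Longrightarrow> finite_measure (\<nu> n)"
    and "\<And>n. n \<ge> 1 \<Longrightarrow> sets (\<nu> n) = sets borel"
    and "\<And>n. n \<ge> 1 \<Longrightarrow> measure_support (\<nu> n) \<subseteq> {a..b}"
    and "\<And>n. n \<ge> 1 \<Longrightarrow> infinite (measure_support (\<nu> n)) \<or> card (measure_support (\<nu> n)) \<ge> n"
    and "\<And>n. n \<ge> 1 \<Longrightarrow> strict_mono_on {1..n} (t n)"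
    and "\<And>n. n \<ge> 1 \<Longrightarrow> t n ` {1..n} \<subseteq> {a..b}"
    and "\<And>n. n \<ge> 1 \<Longrightarrow> aaa_weights f (\<nu> n) n (t n) (w n)"
  shows "(\<forall>\<^sub>F n in sequentially. \<not> (\<exists>z. poly (P n) z = 0 \<and> poly (Q n) z = 0)) \<and>
    (\<forall>z \<in> UNIV - {of_real (1 / \<beta> i) | i. i \<in> {1..l} \<and> \<beta> i > 0}.
       \<exists>r>0. cball z r \<subseteq> UNIV - {of_real (1 / \<beta> i) | i. i \<in> {1..l} \<and> \<beta> i > 0} \<and>
         (\<forall>\<^sub>F n in sequentially. \<forall>z'\<in>cball z r. poly (P n) z' \<noteq> 0) \<and>
         uniform_limit (cball z r) R F sequentially) \<and>
    (F = exp \<longrightarrow> (\<forall>K. compact K \<longrightarrow>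
       (\<exists>c C::real. 0 < c \<and> c < C \<and>
         (\<forall>\<^sub>F n in sequentially. \<forall>t'. extra_nodes a b F (P n) (Q n) n (t n) t' \<longrightarrow>
            (\<forall>z\<in>K.
               c * cmod (nodal_fun n (t n) t' z)
                 \<le> fact (2*n-2) * fact (2*n-1) / (fact (n-1) * fact (n-1)) * cmod (exp z - R n z) \<and>
               fact (2*n-2) * fact (2*n-1) / (fact (n-1) * fact (n-1)) * cmod (exp z - R n z)
                 \<le> C * cmod (nodal_fun n (t n) t' z))))))"
proof -
  let ?A = "edrei_poly \<alpha> k" and ?B = "edrei_poly (\<lambda>i. - \<beta> i) l"
  let ?poles = "{of_real (1 / \<beta> i) | i. i \<in> {1..l} \<and> \<beta> i > 0} :: complex set"
  have adm: "admissible k l \<alpha> \<beta> {a..b}"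
    using assms(6,7,9,10) by (intro admissible_if_between_zeros_and_poles[of F]) (simp_all add: F_def)
  have setting: "aaa_measure k l \<alpha> \<beta> a b n (t n) f ?A ?B (\<nu> n)" if n: "n \<ge> 1" for n
    by (intro aaa_measure.intro aaa_setting.intro aaa_measure_axioms.intro)
       (use assms(8) assms(11-16)[OF n] adm in \<open>simp_all add: f_def\<close>)
  have weights: "aaa_weights f (\<nu> n) n (t n) (w n)" if "n \<ge> 1" for n
    using assms(17)[OF that] .
  have deg: "degree (P n) \<le> n - 1" "degree (Q n) \<le> n - 1" and P0: "P n \<noteq> 0" if n: "n \<ge> 1" for n
    unfolding P_def Q_def
    using aaa_measure.aaa_interpolates(1,2,3)[OF setting[OF n] weights[OF n] n] by blast+
  have X: "\<exists>X. set X \<subseteq> {a..b} \<and> length X = 2 * n - 1 \<and> vanishes X (remainder ?A ?B (P n) (Q n))" if n: "n \<ge> 1" for n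
    unfolding P_def Q_def
    using aaa_measure.aaa_interpolates(4)[OF setting[OF n] weights[OF n] n] .
  have R_eq: "R n z = poly (Q n) z / poly (P n) z" for n z
    by (simp add: R_def P_def Q_def aaa_approx_def)
  have F_eq: "F z = exp z * (poly ?A z / poly ?B z)" for z
    unfolding F_def by (rule edrei_fun_complex)

  \<comment> \<open>The argument applies to every n \<ge> 1.\<close>
  have irreducible: "\<forall>\<^sub>F n in sequentially. \<not> (\<exists>z. poly (P n) z = 0 \<and> poly (Q n) z = 0)"
    using eventually_ge_at_top[of "1 :: nat"]
  proof eventually_elim
    case (elim n)
    obtain X where X: "set X \<subseteq> {a..b}" "length X = 2 * n - 1" "vanishes X (remainder ?A ?B (P n) (Q n))"
      using X[OF elim] by blast
    show ?case
      using interpolant_irreducible[OF admissible_subset[OF adm X(1)] X(3) deg[OF elim] X(2) P0[OF elim]] by blast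
  qed

  have converges: "\<exists>r>0. cball z r \<subseteq> UNIV - ?poles \<and>
         (\<forall>\<^sub>F n in sequentially. \<forall>z'\<in>cball z r. poly (P n) z' \<noteq> 0) \<and>
         uniform_limit (cball z r) R F sequentially" if z: "z \<in> UNIV - ?poles" for z
  proof -
    have "?poles \<subseteq> (\<lambda>i. of_real (1 / \<beta> i)) ` {1..l}" by blast
    then have "finite ?poles" using finite_subset by blast
    then have "open (UNIV - ?poles)" by (simp add: open_Diff finite_imp_closed)
    then obtain r where r: "r > 0" "cball z r \<subseteq> UNIV - ?poles"
      using z open_contains_cball by blast
    have B0: "poly ?B u \<noteq> 0" if u: "u \<in> cball z r" for u
    proof
      assume "poly ?B u = 0"
      then obtain i where i: "i \<in> {1..l}" "1 + of_real (- \<beta> i) * u = 0"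
        unfolding edrei_poly_eq_0_iff by blast
      have \<beta>u: "of_real (\<beta> i) * u = 1" using i(2) by (simp add: eq_neg_iff_add_eq_0[symmetric])
      then have "\<beta> i \<noteq> 0" by auto
      then have "\<beta> i > 0" using assms(7) i(1) by force
      moreover have "u = of_real (1 / \<beta> i)" using \<beta>u \<open>\<beta> i \<noteq> 0\<close> by (simp add: field_simps)
      ultimately have "u \<in> ?poles" using i(1) by blast
      then show False using u r(2) by blast
    qed
    have ev: "\<forall>\<^sub>F n in sequentially. \<forall>u\<in>cball z r. poly (P n) u \<noteq> 0 \<and> dist (R n u) (F u) < \<epsilon>" if \<epsilon>: "\<epsilon> > 0" for \<epsilon>
    proof -
      obtain M where M: "\<forall>n X P Q u. M \<le> n \<longrightarrow> set X \<subseteq> {a..b} \<longrightarrow> length X = 2 * n + 1 \<longrightarrow>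
         degree P \<le> n \<longrightarrow> degree Q \<le> n \<longrightarrow> P \<noteq> 0 \<or> Q \<noteq> 0 \<longrightarrow>
         vanishes X (remainder ?A ?B P Q) \<longrightarrow> u \<in> cball z r \<longrightarrow>
         poly P u \<noteq> 0 \<and> norm (poly Q u / poly P u - exp u * (poly ?A u / poly ?B u)) < \<epsilon>"
        using ratio_converges[OF less_imp_le[OF assms(8)] adm compact_cball B0 \<epsilon>] by blast
      show ?thesis
        using eventually_ge_at_top[of "Suc M"]
      proof eventually_elim
        case (elim n)
        \<comment> \<open>P and Q have degrees at most n - 1, and 2 n - 1 = 2 (n - 1) + 1, so the
          convergence statement is used with n - 1 in place of n.\<close>
        then have n: "n \<ge> 1" "M \<le> n - 1" by auto
        obtain X where X: "set X \<subseteq> {a..b}" "length X = 2 * n - 1" "vanishes X (remainder ?A ?B (P n) (Q n))"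
          using X[OF n(1)] by blast
        have len: "length X = 2 * (n - 1) + 1" using X(2) n(1) by simp
        show ?case
        proof
          fix u assume u: "u \<in> cball z r"
          show "poly (P n) u \<noteq> 0 \<and> dist (R n u) (F u) < \<epsilon>"
            unfolding dist_norm R_eq F_eq
            using M[rule_format, OF n(2) X(1) len deg[OF n(1)] disjI1[OF P0[OF n(1)]] X(3) u] .
        qed
      qed
    qed
    have "\<forall>\<^sub>F n in sequentially. \<forall>u\<in>cball z r. poly (P n) u \<noteq> 0"
      using ev[OF zero_less_one] by eventually_elim blast
    moreover have "uniform_limit (cball z r) R F sequentially"
    proof (rule uniform_limitI)
      fix \<epsilon> :: real assume "\<epsilon> > 0"
      from ev[OF this] show "\<forall>\<^sub>F n in sequentially. \<forall>u\<in>cball z r. dist (R n u) (F u) < \<epsilon>"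
        by eventually_elim blast
    qed
    ultimately show ?thesis using r by blast
  qed

  have bounds: "\<exists>c C::real. 0 < c \<and> c < C \<and>
         (\<forall>\<^sub>F n in sequentially. \<forall>t'. extra_nodes a b F (P n) (Q n) n (t n) t' \<longrightarrow>
            (\<forall>z\<in>K.
               c * cmod (nodal_fun n (t n) t' z)
                 \<le> fact (2*n-2) * fact (2*n-1) / (fact (n-1) * fact (n-1)) * cmod (exp z - R n z) \<and>
               fact (2*n-2) * fact (2*n-1) / (fact (n-1) * fact (n-1)) * cmod (exp z - R n z)
                 \<le> C * cmod (nodal_fun n (t n) t' z)))" if F_exp: "F = exp" and K: "compact K" for K
  proof -
    obtain R0 where R0: "\<And>z. z \<in> K \<Longrightarrow> norm z \<le> R0"
      using compact_imp_bounded[OF K] unfolding bounded_iff by blast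
    define R' where "R' = max R0 (max \<bar>a\<bar> \<bar>b\<bar>)"
    have R': "\<bar>a\<bar> \<le> R'" "\<bar>b\<bar> \<le> R'" "\<And>z. z \<in> K \<Longrightarrow> norm z \<le> R'"
      using R0 by (auto simp: R'_def le_max_iff_disj)
    obtain c C :: real and M where c: "0 < c" "c < C" and bnd:
      "\<And>m X P Q z. M \<le> m \<Longrightarrow> set X \<subseteq> {a..b} \<Longrightarrow> length X = 2 * m + 1 \<Longrightarrow> degree P \<le> m \<Longrightarrow> degree Q \<le> m \<Longrightarrow>
         P \<noteq> 0 \<or> Q \<noteq> 0 \<Longrightarrow> vanishes X (remainder 1 1 P Q) \<Longrightarrow> norm z \<le> R' \<Longrightarrow>
         c * norm (poly (nodal X) z) \<le> growth m * growth (Suc m) * norm (exp z - poly Q z / poly P z) \<and>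
         growth m * growth (Suc m) * norm (exp z - poly Q z / poly P z) \<le> C * norm (poly (nodal X) z)"
      using exp_error_bounds[OF less_imp_le[OF assms(8)] R'(1,2)] by blast
    show ?thesis
    proof (rule exI[of _ "c / 2"], rule exI[of _ "C / 2"], intro conjI)
      show "\<forall>\<^sub>F n in sequentially. \<forall>t'. extra_nodes a b F (P n) (Q n) n (t n) t' \<longrightarrow>
            (\<forall>z\<in>K.
               c / 2 * cmod (nodal_fun n (t n) t' z)
                 \<le> fact (2*n-2) * fact (2*n-1) / (fact (n-1) * fact (n-1)) * cmod (exp z - R n z) \<and>
               fact (2*n-2) * fact (2*n-1) / (fact (n-1) * fact (n-1)) * cmod (exp z - R n z)
                 \<le> C / 2 * cmod (nodal_fun n (t n) t' z))"
        using eventually_ge_at_top[of "Suc M"]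
      proof eventually_elim
        case (elim n)
        then have n: "n \<ge> 1" "M \<le> n - 1" "Suc (n - 1) = n" by auto
        show ?case
        proof (intro allI impI ballI)
          fix t' z assume ex: "extra_nodes a b F (P n) (Q n) n (t n) t'" and z: "z \<in> K"
          obtain X where X: "set X \<subseteq> {a..b}" "length X = 2 * n - 1" "vanishes X (remainder 1 1 (P n) (Q n))"
            "nodal_fun n (t n) t' = poly (nodal X)"
            using vanishes_if_extra_nodes[OF ex[unfolded F_exp] assms(16)[OF n(1)] n(1)] by blast
          have len: "length X = 2 * (n - 1) + 1" using X(2) n(1) by simp
          define g where "g = (fact (2*n-2) * fact (2*n-1) / (fact (n-1) * fact (n-1)) :: real)"
          have gr: "growth (n - 1) * growth (Suc (n - 1)) = 2 * g"
            using growth_product[OF n(1)] unfolding g_def n(3) .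
          have "c * cmod (nodal_fun n (t n) t' z) \<le> 2 * g * cmod (exp z - R n z) \<and>
              2 * g * cmod (exp z - R n z) \<le> C * cmod (nodal_fun n (t n) t' z)"
            using bnd[OF n(2) X(1) len deg[OF n(1)] disjI1[OF P0[OF n(1)]] X(3) R'(3)[OF z]]
            unfolding gr X(4) R_eq .
          then show "c / 2 * cmod (nodal_fun n (t n) t' z)
                 \<le> fact (2*n-2) * fact (2*n-1) / (fact (n-1) * fact (n-1)) * cmod (exp z - R n z) \<and>
               fact (2*n-2) * fact (2*n-1) / (fact (n-1) * fact (n-1)) * cmod (exp z - R n z)
                 \<le> C / 2 * cmod (nodal_fun n (t n) t' z)"
            unfolding g_def[symmetric] by simp
        qed
      qed
    qed (use c in auto)
  qed
  show ?thesis using irreducible converges bounds by blast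
qed

end
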